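(* Let $Z$ be a finite set of points in $\mathbb{P}^3$ with the Uniform Position Property (UPP) and the Weak Lefschetz Property (WLP). Let $I_Z=(F_1,\dots,F_m)$ be the defining ideal of $Z$, where $F_1,\dots,F_m$ are minimal homogeneous generators with $\deg(F_i)=d_i$ and $d_1\le d_2\le\cdots\le d_m$. Then $$\Delta^2H(R/I_Z,d)>\Delta^2H(R/I_Z,d+1)$$ for all $d$ with $d_2\le d<r_2(R/I_Z)$.
   Context: $K$ is a field of characteristic $0$, $R=K[x_1,\dots,x_4]$ with the standard grading, $\mathbb{P}^3=\operatorname{Proj} R$. $I_Z\subset R$ is the saturated homogeneous ideal of $Z$, $H(R/I,t)=\dim_K(R/I)_t$, $\Delta H(R/I,t)=H(R/I,t)-H(R/I,t-1)$, and $\Delta^2H(R/I,t)=\Delta H(R/I,t)-\Delta H(R/I,t-1)$. $r_2(R/I_Z)=\max\{k : H(R/(I_Z+J),k)\ne 0\}$, where $J$ is generated by $2$ general linear forms. UPP: any two subsets of $Z$ of the same cardinality have the same Hilbert function. WLP: for general linear forms $L_1,L_2$ and $A=R/(I_Z+(L_1))$, the multiplication map $\times L_2:A_t\to A_{t+1}$ has maximal rank (is injective or surjective) for every $t$. *)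

theory Defs
  imports "HOL-Analysis.Analysis" "HOL-Library.Poly_Mapping"
begin

section \<open>Polynomials\<close>

text \<open>Polynomials over \<open>'k\<close> in variables indexed by \<open>'v\<close>, as finitely supported maps from
  exponent vectors to coefficients.\<close>

type_synonym ('v, 'k) mpoly = "('v \<Rightarrow>\<^sub>0 nat) \<Rightarrow>\<^sub>0 'k"

type_synonym 'k R = "(4, 'k) mpoly"

definition mvar :: "'v \<Rightarrow> ('v, 'k::field) mpoly" where
  "mvar i = Poly_Mapping.single (Poly_Mapping.single i 1) 1"

definition const :: "'k \<Rightarrow> ('v, 'k::field) mpoly" where
  "const c = Poly_Mapping.single 0 c"

definition pscale :: "'k \<Rightarrow> ('v, 'k::field) mpoly \<Rightarrow> ('v, 'k) mpoly" where
  "pscale c p = const c * p"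

definition peval :: "('v, 'k::field) mpoly \<Rightarrow> ('v \<Rightarrow> 'k) \<Rightarrow> 'k" where
  "peval p a = (\<Sum>m\<in>Poly_Mapping.keys p.
     Poly_Mapping.lookup p m * (\<Prod>i\<in>Poly_Mapping.keys m. a i ^ Poly_Mapping.lookup m i))"

text \<open>The graded piece of degree \<open>t\<close> (it contains \<open>0\<close>).\<close>

definition homog :: "nat \<Rightarrow> ('v, 'k::field) mpoly set" where
  "homog t = {p. \<forall>m\<in>Poly_Mapping.keys p. (\<Sum>i\<in>Poly_Mapping.keys m. Poly_Mapping.lookup m i) = t}"

interpretation poly: vector_space "pscale :: 'k::field \<Rightarrow> ('v, 'k) mpoly \<Rightarrow> ('v, 'k) mpoly"
  by unfold_locales
    (simp_all add: pscale_def const_def distrib_left distrib_right single_add mult_single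
      mult.assoc[symmetric])

interpretation ideal: module "(*) :: 'a::comm_ring_1 \<Rightarrow> 'a \<Rightarrow> 'a"
  by unfold_locales (simp_all add: algebra_simps)

text \<open>The ideal generated by a set, i.e.\ its span over the ring itself.\<close>

abbreviation ideal_gen :: "'a::comm_ring_1 set \<Rightarrow> 'a set" where
  "ideal_gen \<equiv> ideal.span"


section \<open>Dimension of a quotient space\<close>

text \<open>
  \<open>B\<close> is a finite family of representatives in \<open>V\<close> of a basis of the image of \<open>V\<close> in the
  quotient by \<open>W\<close>; if \<open>W\<close> is contained in \<open>V\<close> this image is \<open>V / W\<close>.
\<close>

definition basis_mod ::
    "('v, 'k::field) mpoly set \<Rightarrow> ('v, 'k) mpoly set \<Rightarrow> ('v, 'k) mpoly set \<Rightarrow> bool" where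
  "basis_mod V W B \<longleftrightarrow> finite B \<and> B \<subseteq> V \<and>
     (\<forall>c. (\<Sum>b\<in>B. pscale (c b) b) \<in> W \<longrightarrow> (\<forall>b\<in>B. c b = 0)) \<and>
     (\<forall>v\<in>V. \<exists>c. v - (\<Sum>b\<in>B. pscale (c b) b) \<in> W)"

definition quot_dim :: "('v, 'k::field) mpoly set \<Rightarrow> ('v, 'k) mpoly set \<Rightarrow> nat" where
  "quot_dim V W = (THE n. \<exists>B. basis_mod V W B \<and> card B = n)"

lemma basis_mod_card:
  fixes V W :: "('v, 'k::field) mpoly set"
  assumes V: "poly.subspace V" and W: "poly.subspace W" and fin: "finite S" "V \<subseteq> poly.span S"
    and B: "basis_mod V W B"
  shows "card B + poly.dim (V \<inter> W) = poly.dim V"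
proof -
  obtain C where C: "C \<subseteq> V \<inter> W" "poly.independent C" "V \<inter> W \<subseteq> poly.span C" "card C = poly.dim (V \<inter> W)"
    by (rule poly.basis_exists)
  have finC: "finite C"
    using poly.independent_span_bound[OF fin(1) C(2)] C(1) fin(2) by blast
  have spanC: "poly.span C \<subseteq> V \<inter> W"
    using C(1) V W by (meson poly.span_minimal poly.subspace_inter)
  have finB: "finite B" and BV: "B \<subseteq> V"
    and ind: "\<And>c. (\<Sum>b\<in>B. pscale (c b) b) \<in> W \<Longrightarrow> \<forall>b\<in>B. c b = 0"
    and gen: "\<And>v. v \<in> V \<Longrightarrow> \<exists>c. v - (\<Sum>b\<in>B. pscale (c b) b) \<in> W"
    using B unfolding basis_mod_def by auto
  have disj: "B \<inter> C = {}"
  proof (rule ccontr)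
    assume "B \<inter> C \<noteq> {}"
    then obtain x where x: "x \<in> B" "x \<in> C" by blast
    have "(\<Sum>b\<in>B. pscale (if b = x then 1 else 0) b) = (\<Sum>b\<in>B. if b = x then b else 0)"
      by (rule sum.cong) auto
    also have "\<dots> = x" using x finB by simp
    finally have "(\<Sum>b\<in>B. pscale (if b = x then 1 else 0) b) \<in> W" using x C(1) by auto
    from ind[OF this] x show False by auto
  qed
  have indBC: "poly.independent (B \<union> C)"
  proof (rule poly.independent_if_scalars_zero)
    show "finite (B \<union> C)" using finB finC by simp
  next
    fix f x assume s: "(\<Sum>x\<in>B \<union> C. pscale (f x) x) = 0" and x: "x \<in> B \<union> C"
    have s': "(\<Sum>x\<in>B. pscale (f x) x) + (\<Sum>x\<in>C. pscale (f x) x) = 0"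
      using s sum.union_disjoint[OF finB finC disj, of "\<lambda>x. pscale (f x) x"] by simp
    have "(\<Sum>x\<in>C. pscale (f x) x) \<in> poly.span C"
      by (intro poly.span_sum poly.span_scale poly.span_base)
    hence "(\<Sum>x\<in>C. pscale (f x) x) \<in> W" using spanC by blast
    moreover have "(\<Sum>x\<in>B. pscale (f x) x) = - (\<Sum>x\<in>C. pscale (f x) x)"
      using s' by (simp add: eq_neg_iff_add_eq_0)
    ultimately have "(\<Sum>x\<in>B. pscale (f x) x) \<in> W" using W by (simp add: poly.subspace_neg)
    from ind[OF this] have B0: "\<forall>b\<in>B. f b = 0" .
    hence "(\<Sum>x\<in>C. pscale (f x) x) = 0" using s' by simp
    hence "\<forall>x\<in>C. f x = 0" using C(2) finC poly.independentD by blast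
    with B0 x show "f x = 0" by blast
  qed
  have "V \<subseteq> poly.span (B \<union> C)"
  proof
    fix v assume v: "v \<in> V"
    then obtain c where c: "v - (\<Sum>b\<in>B. pscale (c b) b) \<in> W" using gen by blast
    have sB: "(\<Sum>b\<in>B. pscale (c b) b) \<in> poly.span B"
      by (intro poly.span_sum poly.span_scale poly.span_base)
    moreover have "poly.span B \<subseteq> V" using BV V by (rule poly.span_minimal)
    ultimately have "v - (\<Sum>b\<in>B. pscale (c b) b) \<in> V" using V v by (meson subsetD poly.subspace_diff)
    with c C(3) have "v - (\<Sum>b\<in>B. pscale (c b) b) \<in> poly.span C" by blast
    hence "v - (\<Sum>b\<in>B. pscale (c b) b) \<in> poly.span (B \<union> C)"
      by (rule subsetD[OF poly.span_mono, rotated]) simp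
    moreover have "(\<Sum>b\<in>B. pscale (c b) b) \<in> poly.span (B \<union> C)"
      by (rule subsetD[OF poly.span_mono sB]) simp
    ultimately have "v - (\<Sum>b\<in>B. pscale (c b) b) + (\<Sum>b\<in>B. pscale (c b) b) \<in> poly.span (B \<union> C)"
      by (rule poly.span_add)
    thus "v \<in> poly.span (B \<union> C)" by simp
  qed
  moreover have "B \<union> C \<subseteq> V" using BV C(1) by blast
  ultimately have "poly.dim V = card (B \<union> C)" using indBC
    by (intro poly.dim_unique[OF _ _ _ refl])
  thus ?thesis using disj finB finC C(4) by (simp add: card_Un_disjoint)
qed

lemma basis_mod_exists:
  fixes V W :: "('v, 'k::field) mpoly set"
  assumes V: "poly.subspace V" and W: "poly.subspace W" and fin: "finite S" "V \<subseteq> poly.span S"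
  shows "\<exists>B. basis_mod V W B"
proof -
  obtain C where C: "C \<subseteq> V \<inter> W" "poly.independent C" "V \<inter> W \<subseteq> poly.span C"
    by (metis poly.basis_exists)
  obtain D where D: "C \<subseteq> D" "D \<subseteq> V" "poly.independent D" "V \<subseteq> poly.span D"
    using poly.maximal_independent_subset_extend[of C V] C by blast
  have finD: "finite D"
    using poly.independent_span_bound[OF fin(1) D(3)] D(2) fin(2) by blast
  have finC: "finite C" using finD D(1) finite_subset by blast
  have split: "(\<Sum>b\<in>D. pscale (c b) b) = (\<Sum>b\<in>D - C. pscale (c b) b) + (\<Sum>b\<in>C. pscale (c b) b)" for c
    using sum.subset_diff[OF D(1) finD] by blast
  have "basis_mod V W (D - C)"
    unfolding basis_mod_def
  proof (intro conjI allI impI ballI)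
    show "finite (D - C)" using finD by simp
    show "D - C \<subseteq> V" using D(2) by blast
  next
    fix c b assume s: "(\<Sum>b\<in>D - C. pscale (c b) b) \<in> W" and b: "b \<in> D - C"
    have "(\<Sum>b\<in>D - C. pscale (c b) b) \<in> V"
      using D(2) V by (intro poly.subspace_sum poly.subspace_scale) auto
    with s C(3) have "(\<Sum>b\<in>D - C. pscale (c b) b) \<in> poly.span C" by blast
    then obtain e where e: "(\<Sum>b\<in>D - C. pscale (c b) b) = (\<Sum>b\<in>C. pscale (e b) b)"
      unfolding poly.span_finite[OF finC] by blast
    define f where "f = (\<lambda>x. if x \<in> C then - e x else c x)"
    have "(\<Sum>x\<in>D - C. pscale (f x) x) = (\<Sum>x\<in>D - C. pscale (c x) x)"
      by (rule sum.cong) (auto simp: f_def)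
    moreover have "(\<Sum>x\<in>C. pscale (f x) x) = - (\<Sum>x\<in>C. pscale (e x) x)"
      by (simp add: f_def sum_negf)
    ultimately have "(\<Sum>x\<in>D. pscale (f x) x) = 0" using split[of f] e by simp
    hence "f b = 0" using D(3) finD b poly.independentD by blast
    thus "c b = 0" using b by (simp add: f_def)
  next
    fix v assume "v \<in> V"
    hence "v \<in> poly.span D" using D(4) by blast
    then obtain c where c: "v = (\<Sum>b\<in>D. pscale (c b) b)" unfolding poly.span_finite[OF finD] by blast
    have "(\<Sum>b\<in>C. pscale (c b) b) \<in> W"
      using C(1) W by (intro poly.subspace_sum poly.subspace_scale) auto
    hence "v - (\<Sum>b\<in>D - C. pscale (c b) b) \<in> W" using c split[of c] by simp
    thus "\<exists>c. v - (\<Sum>b\<in>D - C. pscale (c b) b) \<in> W" by blast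
  qed
  thus ?thesis by blast
qed

lemma quot_dim_eq:
  fixes V W :: "('v, 'k::field) mpoly set"
  assumes "poly.subspace V" "poly.subspace W" "finite S" "V \<subseteq> poly.span S"
  shows "quot_dim V W + poly.dim (V \<inter> W) = poly.dim V"
proof -
  obtain B where B: "basis_mod V W B" using basis_mod_exists[OF assms] by blast
  have "quot_dim V W = card B"
    unfolding quot_dim_def
  proof (rule the_equality)
    fix n assume "\<exists>B. basis_mod V W B \<and> card B = n"
    thus "n = card B"
      using basis_mod_card[OF assms B] basis_mod_card[OF assms] by (metis add_right_cancel)
  qed (use B in blast)
  thus ?thesis using basis_mod_card[OF assms B] by simp
qed


section \<open>Hilbert functions\<close>

text \<open>For a homogeneous ideal \<open>I\<close>, the degree \<open>t\<close> piece of \<open>R/I\<close> is the image of \<open>R\<^sub>t\<close> in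
  \<open>R/I\<close>.\<close>

definition hilb :: "'k::field R set \<Rightarrow> nat \<Rightarrow> nat" where
  "hilb I t = quot_dim (homog t) I"

text \<open>First difference, with the convention that the argument vanishes in degree \<open>-1\<close>.\<close>

definition diff1 :: "(nat \<Rightarrow> int) \<Rightarrow> nat \<Rightarrow> int" where
  "diff1 h t = h t - (if t = 0 then 0 else h (t - 1))"

definition \<Delta>H :: "'k::field R set \<Rightarrow> nat \<Rightarrow> int" where
  "\<Delta>H I = diff1 (\<lambda>t. int (hilb I t))"

definition \<Delta>2H :: "'k::field R set \<Rightarrow> nat \<Rightarrow> int" where
  "\<Delta>2H I = diff1 (\<Delta>H I)"

lemma keys_pscale: "Poly_Mapping.keys (pscale c x) \<subseteq> Poly_Mapping.keys x"
proof
  fix m assume "m \<in> Poly_Mapping.keys (pscale c x)"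
  then obtain a b where "m = a + b" "a \<in> Poly_Mapping.keys (const c)" "b \<in> Poly_Mapping.keys x"
    unfolding pscale_def using keys_mult by blast
  thus "m \<in> Poly_Mapping.keys x" by (simp add: const_def split: if_splits)
qed

lemma subspace_homog: "poly.subspace (homog t :: ('v, 'k::field) mpoly set)"
  unfolding poly.subspace_def
proof (intro conjI allI ballI)
  show "0 \<in> homog t" by (simp add: homog_def)
next
  fix x y :: "('v, 'k) mpoly" assume "x \<in> homog t" "y \<in> homog t"
  thus "x + y \<in> homog t"
    using Poly_Mapping.keys_add[of x y] by (auto simp: homog_def)
next
  fix c and x :: "('v, 'k) mpoly" assume "x \<in> homog t"
  thus "pscale c x \<in> homog t" using keys_pscale[of c x] by (auto simp: homog_def)
qed

lemma subspace_ideal: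
  fixes I :: "('v, 'k::field) mpoly set"
  assumes "ideal.subspace I"
  shows "poly.subspace I"
  using assms by (auto simp: poly.subspace_def ideal.subspace_def pscale_def)

lemma homog_finite_span:
  "\<exists>S. finite S \<and> (homog t :: ('v::finite, 'k::field) mpoly set) \<subseteq> poly.span S"
proof -
  define M where "M = {m :: 'v \<Rightarrow>\<^sub>0 nat. (\<Sum>i\<in>Poly_Mapping.keys m. Poly_Mapping.lookup m i) = t}"
  have "Poly_Mapping.lookup ` M \<subseteq> Pi\<^sub>E UNIV (\<lambda>_. {..t})"
  proof (clarsimp simp: M_def PiE_def Pi_def)
    fix m :: "'v \<Rightarrow>\<^sub>0 nat" and i
    show "Poly_Mapping.lookup m i \<le> sum (Poly_Mapping.lookup m) (Poly_Mapping.keys m)"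
      by (cases "i \<in> Poly_Mapping.keys m") (auto intro: member_le_sum simp: in_keys_iff)
  qed
  hence "finite (Poly_Mapping.lookup ` M)" by (rule finite_subset) (intro finite_PiE, auto)
  hence finM: "finite M" by (rule finite_imageD) (simp add: inj_on_def)
  define S where "S = (\<lambda>m. Poly_Mapping.single m (1::'k)) ` M"
  have "p \<in> poly.span S" if "p \<in> homog t" for p :: "('v, 'k) mpoly"
  proof -
    have "p = (\<Sum>m\<in>Poly_Mapping.keys p. Poly_Mapping.single m (Poly_Mapping.lookup p m))"
      by (rule poly_mapping_eqI)
        (simp add: lookup_sum lookup_single when_def in_keys_iff)
    also have "\<dots> = (\<Sum>m\<in>Poly_Mapping.keys p. pscale (Poly_Mapping.lookup p m) (Poly_Mapping.single m 1))"
      by (simp add: pscale_def const_def mult_single)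
    also have "\<dots> \<in> poly.span S"
      using that by (intro poly.span_sum poly.span_scale poly.span_base)
        (auto simp: S_def M_def homog_def)
    finally show ?thesis .
  qed
  with finM show ?thesis by (intro exI[of _ S]) (auto simp: S_def)
qed

lemma hilb_eq:
  fixes I :: "'k::field R set"
  assumes "ideal.subspace I"
  shows "hilb I t + poly.dim (homog t \<inter> I) = poly.dim (homog t :: 'k R set)"
proof -
  obtain S where "finite S" "(homog t :: 'k R set) \<subseteq> poly.span S"
    by (metis homog_finite_span)
  from quot_dim_eq[OF subspace_homog subspace_ideal[OF assms] this]
  show ?thesis unfolding hilb_def .
qed


section \<open>Points in projective space\<close>

definition proj_rel :: "(('k::field ^ 4) \<times> ('k ^ 4)) set" where
  "proj_rel = {(v, w). v \<noteq> 0 \<and> (\<exists>c. c \<noteq> 0 \<and> w = c *s v)}"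

text \<open>The \<open>'k\<close>-rational points of projective 3-space, as classes of homogeneous coordinate
  vectors.\<close>

definition P3 :: "('k::field ^ 4) set set" where
  "P3 = (UNIV - {0}) // proj_rel"

definition vanishing_ideal :: "('k::field ^ 4) set set \<Rightarrow> 'k R set" where
  "vanishing_ideal Z =
     ideal_gen {f. (\<exists>t. f \<in> homog t) \<and> (\<forall>P\<in>Z. \<forall>v\<in>P. peval f (($) v) = 0)}"

definition UPP :: "('k::field ^ 4) set set \<Rightarrow> bool" where
  "UPP Z \<longleftrightarrow> (\<forall>X Y. X \<subseteq> Z \<longrightarrow> Y \<subseteq> Z \<longrightarrow> card X = card Y \<longrightarrow>
     hilb (vanishing_ideal X) = hilb (vanishing_ideal Y))"


section \<open>General linear forms\<close>

definition zariski_open :: "('v \<Rightarrow> 'k::field) set \<Rightarrow> bool" where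
  "zariski_open U \<longleftrightarrow> (\<exists>G. U = {a. \<exists>g\<in>G. peval g a \<noteq> 0})"

definition linform :: "'k::field ^ 4 \<Rightarrow> 'k R" where
  "linform a = (\<Sum>i\<in>UNIV. pscale (a $ i) (mvar i))"

text \<open>\<open>Q\<close> holds for two general linear forms: for all pairs in a nonempty Zariski open subset of
  the 8-dimensional affine space of coefficients.\<close>

definition for_general_pair :: "('k::field R \<Rightarrow> 'k R \<Rightarrow> bool) \<Rightarrow> bool" where
  "for_general_pair Q \<longleftrightarrow> (\<exists>U :: (4 + 4 \<Rightarrow> 'k) set. zariski_open U \<and> U \<noteq> {} \<and>
     (\<forall>a b :: 'k ^ 4. case_sum (($) a) (($) b) \<in> U \<longrightarrow> Q (linform a) (linform b)))"

text \<open>The maximum is the same for all general pairs; \<open>r2 I\<close> is this common value.\<close>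

definition r2 :: "'k::field R set \<Rightarrow> nat" where
  "r2 I = (THE r. for_general_pair (\<lambda>L1 L2.
     hilb (ideal_gen (I \<union> {L1, L2})) r \<noteq> 0 \<and>
     (\<forall>k. hilb (ideal_gen (I \<union> {L1, L2})) k \<noteq> 0 \<longrightarrow> k \<le> r)))"

text \<open>Multiplication by \<open>L\<close> from degree \<open>t\<close> to degree \<open>t + 1\<close> of \<open>R/J\<close>, with classes modulo
  \<open>J\<close> written through representatives.\<close>

definition mult_inj :: "'k::field R set \<Rightarrow> 'k R \<Rightarrow> nat \<Rightarrow> bool" where
  "mult_inj J L t \<longleftrightarrow>
     (\<forall>f\<in>homog t. \<forall>g\<in>homog t. L * f - L * g \<in> J \<longrightarrow> f - g \<in> J)"

definition mult_surj :: "'k::field R set \<Rightarrow> 'k R \<Rightarrow> nat \<Rightarrow> bool" where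
  "mult_surj J L t \<longleftrightarrow> (\<forall>g\<in>homog (t + 1). \<exists>f\<in>homog t. g - L * f \<in> J)"

definition WLP :: "('k::field ^ 4) set set \<Rightarrow> bool" where
  "WLP Z \<longleftrightarrow> for_general_pair (\<lambda>L1 L2.
     let J = ideal_gen (vanishing_ideal Z \<union> {L1})
     in \<forall>t. mult_inj J L2 t \<or> mult_surj J L2 t)"


section \<open>Minimal homogeneous generators\<close>

text \<open>Indices run from \<open>1\<close> to \<open>m\<close>. Minimality forces the \<open>F i\<close> to be distinct and nonzero, so
  the degrees \<open>d i\<close> are determined by \<open>F\<close>.\<close>

definition minimal_homog_gens ::
    "'k::field R set \<Rightarrow> nat \<Rightarrow> (nat \<Rightarrow> 'k R) \<Rightarrow> (nat \<Rightarrow> nat) \<Rightarrow> bool" where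
  "minimal_homog_gens I m F d \<longleftrightarrow>
     I = ideal_gen (F ` {1..m}) \<and>
     (\<forall>i\<in>{1..m}. F i \<in> homog (d i)) \<and>
     (\<forall>i\<in>{1..m}. F i \<notin> ideal_gen (F ` ({1..m} - {i})))"

end

theory Submission
  imports Defs "Berlekamp_Zassenhaus.Unique_Factorization_Poly"
begin

text \<open>
  By WLP, \<open>\<Delta>\<^sup>2H\<close> is in degrees up to \<open>r\<^sub>2\<close> the Hilbert function of \<open>C = R/(I\<^sub>Z, L\<^sub>1, L\<^sub>2)\<close> for general
  linear forms, and \<open>r\<^sub>2\<close> is the last degree where \<open>\<Delta>\<^sup>2H > 0\<close>. If \<open>\<Delta>\<^sup>2H(e) \<le> \<Delta>\<^sup>2H(e + 1)\<close>, then
  multiplication \<open>C\<^sub>e \<rightarrow> C\<^sub>e\<^sub>+\<^sub>1\<close> by a linear form is injective, and this forces the restrictions of the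
  forms in \<open>(I\<^sub>Z)\<^sub>e\<close> to the general line \<open>L\<^sub>1 = L\<^sub>2 = 0\<close> to have a common factor (Davis).

  The forms in \<open>(I\<^sub>Z)\<^sub>e\<close> then have a common prime factor \<open>D\<close>: otherwise, projecting from a point \<open>p\<close>, the
  ideal they generate contains a nonzero \<open>Q\<close> pulled back from the plane, and on a general line through \<open>p\<close>
  the restriction of \<open>Q\<close> is a nonzero constant in the coordinate \<open>X\<close> on the line. Let \<open>Z\<^sub>1\<close> and \<open>Z\<^sub>2\<close> be the points of \<open>Z\<close> off and on
  \<open>D = 0\<close>. If \<open>Z\<^sub>1\<close> were nonempty, both would lie on forms of degree less than \<open>d\<^sub>1\<close>, so by UPP both impose
  independent conditions in those degrees; correcting by multiples of \<open>D\<close>, every form of degree \<open>e\<close>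
  vanishing on \<open>Z\<^sub>2\<close> would be divisible by \<open>D\<close>, which is absurd. Hence \<open>D \<in> I\<^sub>Z\<close>, so \<open>D\<close> is \<open>F\<^sub>1\<close> up to a
  scalar and divides \<open>F\<^sub>2\<close>, against minimality.
\<close>

no_notation vec_index (infixl \<open>$\<close> 100)

declare ideal.scale_scale [simp del]  \<comment> \<open>reassociates products, so it loops with \<open>algebra_simps\<close>\<close>

section \<open>Evaluation and homogeneous components\<close>

definition mdeg :: "('v::finite \<Rightarrow>\<^sub>0 nat) \<Rightarrow> nat" where
  "mdeg m = (\<Sum>i\<in>UNIV. Poly_Mapping.lookup m i)"

text \<open>The evaluation homomorphism out of the polynomial ring, with coefficients moved along
  \<open>h\<close>. Values at a point, restriction to a line, changes of coordinates and
  homogenisation all have this form, so their homomorphism laws come from one proof.\<close>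

definition ev :: "('k::field \<Rightarrow> 'a::comm_ring_1) \<Rightarrow> ('v::finite \<Rightarrow> 'a) \<Rightarrow> ('v, 'k) mpoly \<Rightarrow> 'a" where
  "ev h a p = (\<Sum>m\<in>Poly_Mapping.keys p. h (Poly_Mapping.lookup p m) * (\<Prod>i\<in>UNIV. a i ^ Poly_Mapping.lookup m i))"

lemma mdeg_keys: "(\<Sum>i\<in>Poly_Mapping.keys m. Poly_Mapping.lookup m i) = mdeg m"
  unfolding mdeg_def by (rule sum.mono_neutral_left) (auto simp: in_keys_iff)

lemma homog_iff: "p \<in> homog t \<longleftrightarrow> (\<forall>m\<in>Poly_Mapping.keys p. mdeg m = t)"
  by (simp add: homog_def mdeg_keys)

lemma mdeg_add: "mdeg (m + n) = mdeg m + mdeg n"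
  by (simp add: mdeg_def lookup_add sum.distrib)

lemma mdeg_zero [simp]: "mdeg 0 = 0"
  by (simp add: mdeg_def)

lemma mdeg_single [simp]: "mdeg (Poly_Mapping.single i n) = n"
  by (simp add: mdeg_def lookup_single when_def)

lemma mpoly_sum_single:
  "(\<Sum>m\<in>Poly_Mapping.keys p. Poly_Mapping.single m (Poly_Mapping.lookup p m)) = p"
  by (rule poly_mapping_eqI) (simp add: lookup_sum lookup_single when_def in_keys_iff)

lemma mpoly_induct [case_names zero single add]:
  fixes p :: "('v, 'k::field) mpoly"
  assumes "P 0" "\<And>m c. P (Poly_Mapping.single m c)" "\<And>p q. P p \<Longrightarrow> P q \<Longrightarrow> P (p + q)"
  shows "P p"
proof -
  have "P (\<Sum>m\<in>A. Poly_Mapping.single m (Poly_Mapping.lookup p m))" if "finite A" for A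
    using that by induction (auto intro: assms)
  from this[of "Poly_Mapping.keys p"] show ?thesis by (simp add: mpoly_sum_single)
qed

lemma peval_ev: "peval p a = ev (\<lambda>c. c) a (p :: ('v::finite, 'k::field) mpoly)"
proof -
  have "(\<Prod>i\<in>Poly_Mapping.keys m. a i ^ Poly_Mapping.lookup m i) =
        (\<Prod>i\<in>UNIV. a i ^ Poly_Mapping.lookup m i)" for m
    by (rule prod.mono_neutral_left) (auto simp: in_keys_iff)
  thus ?thesis by (simp add: peval_def ev_def)
qed

lemma const_hom: "comm_ring_hom (const :: 'k::field \<Rightarrow> ('v, 'k) mpoly)"
  by unfold_locales (auto simp: const_def single_add mult_single)

lemma id_hom: "comm_ring_hom (\<lambda>c::'a::comm_ring_1. c)"
  by unfold_locales auto

lemma comp_hom: "comm_ring_hom g \<Longrightarrow> comm_ring_hom h \<Longrightarrow> comm_ring_hom (\<lambda>x. g (h x))"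
proof -
  assume "comm_ring_hom g" "comm_ring_hom h"
  then interpret g: comm_ring_hom g + h: comm_ring_hom h by auto
  show ?thesis by unfold_locales (auto simp: g.hom_add h.hom_add g.hom_mult h.hom_mult)
qed

lemma single_eq: "Poly_Mapping.single m c = const c * (\<Prod>i\<in>UNIV. mvar i ^ Poly_Mapping.lookup m (i::'v::finite))"
proof -
  have 1: "mvar i ^ n = (Poly_Mapping.single (Poly_Mapping.single i n) 1 :: ('v,'a) mpoly)" for i n
    by (induction n) (simp_all add: mvar_def mult_single single_add[symmetric])
  have 2: "(\<Prod>i\<in>A. mvar i ^ Poly_Mapping.lookup m i) = 
     (Poly_Mapping.single (\<Sum>i\<in>A. Poly_Mapping.single i (Poly_Mapping.lookup m i)) 1 :: ('v,'a) mpoly)" if "finite A" for A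
    using that by induction (simp_all add: 1 mult_single)
  have 3: "(\<Sum>i\<in>UNIV. Poly_Mapping.single i (Poly_Mapping.lookup m i)) = m"
    by (rule poly_mapping_eqI) (simp add: lookup_sum lookup_single when_def)
  show ?thesis by (simp add: 2 3 const_def mult_single)
qed

context
  fixes h :: "'k::field \<Rightarrow> 'a::comm_ring_1" and a :: "'v::finite \<Rightarrow> 'a"
  assumes h: "comm_ring_hom h"
begin

interpretation h: comm_ring_hom h by (rule h)

lemma ev_superset:
  assumes "finite S" "Poly_Mapping.keys p \<subseteq> S"
  shows "ev h a p = (\<Sum>m\<in>S. h (Poly_Mapping.lookup p m) * (\<Prod>i\<in>UNIV. a i ^ Poly_Mapping.lookup m i))"
  unfolding ev_def using assms by (intro sum.mono_neutral_left) (auto simp: in_keys_iff)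

lemma ev_add: "ev h a (p + q) = ev h a p + ev h a q"
proof -
  let ?S = "Poly_Mapping.keys p \<union> Poly_Mapping.keys q"
  have "ev h a r = (\<Sum>m\<in>?S. h (Poly_Mapping.lookup r m) * (\<Prod>i\<in>UNIV. a i ^ Poly_Mapping.lookup m i))"
    if "r \<in> {p, q, p + q}" for r
    using that Poly_Mapping.keys_add[of p q] by (intro ev_superset) auto
  thus ?thesis by (simp add: lookup_add h.hom_add algebra_simps sum.distrib)
qed

lemma ev_single: "ev h a (Poly_Mapping.single m c) = h c * (\<Prod>i\<in>UNIV. a i ^ Poly_Mapping.lookup m i)"
  by (simp add: ev_def)

lemma ev_mult: "ev h a (p * q) = ev h a p * ev h a q"
proof (induction p rule: mpoly_induct)
  case zero show ?case by (simp add: ev_def)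
next
  case (single m c)
  show ?case
  proof (induction q rule: mpoly_induct)
    case zero show ?case by (simp add: ev_def)
  next
    case (single n d)
    show ?case by (simp add: mult_single ev_single h.hom_mult lookup_add power_add prod.distrib)
  next
    case (add p q) thus ?case by (simp add: ev_add algebra_simps)
  qed
next
  case (add p q) thus ?case by (simp add: ev_add algebra_simps)
qed

lemma ev_hom: "comm_ring_hom (ev h a)"
proof unfold_locales
  show "ev h a 1 = 1" using ev_single[of 0 1] by simp
qed (simp_all add: ev_add ev_mult ev_def[of _ _ 0])

lemma ev_const [simp]: "ev h a (const c) = h c"
  by (simp add: const_def ev_single)

lemma ev_mvar [simp]: "ev h a (mvar i) = a i"
proof -
  have "(\<Prod>j\<in>UNIV. a j ^ Poly_Mapping.lookup (Poly_Mapping.single i 1) j) = (\<Prod>j\<in>UNIV. if j = i then a j else 1)"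
    by (rule prod.cong) (auto simp: lookup_single when_def)
  thus ?thesis by (simp add: mvar_def ev_single)
qed

text \<open>A ring homomorphism commutes with the sums, products and powers in \<open>ev\<close>.
  Composites are therefore again evaluations and can be compared on constants and variables.\<close>

lemma ev_comp:
  assumes "comm_ring_hom g"
  shows "g (ev h a p) = ev (\<lambda>c. g (h c)) (\<lambda>i. g (a i)) p"
proof -
  interpret g: comm_ring_hom g by fact
  show ?thesis by (simp add: ev_def g.hom_sum g.hom_mult g.hom_prod g.hom_power)
qed

text \<open>Each monomial of degree \<open>t\<close> contributes the factor \<open>c ^ t\<close>. As
  \<open>c\<close> lies in the target ring, it may itself be a variable, as in
  \<open>hpoly_homog\<close> and \<open>hilb_section_0\<close>.\<close>

lemma ev_scale:
  assumes "p \<in> homog t"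
  shows "ev h (\<lambda>i. c * a i) p = c ^ t * ev h a p"
proof -
  have "h (Poly_Mapping.lookup p m) * (\<Prod>i\<in>UNIV. (c * a i) ^ Poly_Mapping.lookup m i) =
      c ^ t * (h (Poly_Mapping.lookup p m) * (\<Prod>i\<in>UNIV. a i ^ Poly_Mapping.lookup m i))"
    if "m \<in> Poly_Mapping.keys p" for m
  proof -
    have t: "mdeg m = t" using assms that by (simp add: homog_iff)
    have "(\<Prod>i\<in>UNIV. (c * a i) ^ Poly_Mapping.lookup m i) =
       (\<Prod>i\<in>UNIV. c ^ Poly_Mapping.lookup m i) * (\<Prod>i\<in>UNIV. a i ^ Poly_Mapping.lookup m i)"
      unfolding power_mult_distrib prod.distrib ..
    also have "(\<Prod>i\<in>UNIV. c ^ Poly_Mapping.lookup m i) = c ^ t"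
      unfolding t[symmetric] mdeg_def by (rule power_sum[symmetric])
    finally show ?thesis by (simp only: mult.left_commute)
  qed
  thus ?thesis unfolding ev_def sum_distrib_left by (intro sum.cong) auto
qed

end

lemma ev_id: "ev const mvar p = (p :: ('v::finite, 'k::field) mpoly)"
  unfolding ev_def single_eq[symmetric] by (rule mpoly_sum_single)

lemma peval_hom: "comm_ring_hom (\<lambda>p :: ('v::finite, 'k::field) mpoly. peval p a)"
  unfolding peval_ev by (rule ev_hom[OF id_hom])

lemma mvar_homog: "mvar (i::'v::finite) \<in> homog 1"
  by (simp add: homog_iff mvar_def)

lemma const_homog: "(const c :: ('v::finite, 'k::field) mpoly) \<in> homog 0"
  by (simp add: homog_iff const_def)

lemma homog_add: "p \<in> homog t \<Longrightarrow> q \<in> homog t \<Longrightarrow> p + q \<in> homog t"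
  using subspace_homog by (rule poly.subspace_add)

lemma homog_diff: "p \<in> homog t \<Longrightarrow> q \<in> homog t \<Longrightarrow> p - q \<in> homog t"
  using subspace_homog by (rule poly.subspace_diff)

lemma homog_0 [simp]: "0 \<in> homog t"
  using subspace_homog by (rule poly.subspace_0)

lemma homog_sum: "(\<And>i. i \<in> A \<Longrightarrow> f i \<in> homog t) \<Longrightarrow> sum f A \<in> homog t"
  using subspace_homog by (rule poly.subspace_sum)

lemma homog_mult:
  fixes p q :: "('v::finite, 'k::field) mpoly"
  assumes "p \<in> homog s" "q \<in> homog t" shows "p * q \<in> homog (s + t)"
  using assms keys_mult[of p q] by (fastforce simp: homog_iff mdeg_add)

lemma homog_const_mult:
  fixes p :: "('v::finite, 'k::field) mpoly"
  shows "p \<in> homog t \<Longrightarrow> const c * p \<in> homog t"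
  using homog_mult[OF const_homog, of p t c] by simp

lemma homog_power:
  fixes p :: "('v::finite, 'k::field) mpoly"
  assumes "p \<in> homog s" shows "p ^ n \<in> homog (s * n)"
proof (induction n)
  case 0 show ?case using const_homog[of 1] by (simp add: const_def)
next
  case (Suc n) thus ?case using homog_mult[OF assms Suc] by simp
qed

lemma homog_unique:
  fixes p :: "('v::finite, 'k::field) mpoly"
  assumes "p \<in> homog s" "p \<in> homog t" "p \<noteq> 0" shows "s = t"
proof -
  obtain m where "m \<in> Poly_Mapping.keys p" using assms(3) by fastforce
  thus ?thesis using assms by (auto simp: homog_iff)
qed

section \<open>Homogeneous components\<close>

definition hc :: "nat \<Rightarrow> ('v::finite, 'k::field) mpoly \<Rightarrow> ('v, 'k) mpoly" where
  "hc t p = (\<Sum>m\<in>{m \<in> Poly_Mapping.keys p. mdeg m = t}. Poly_Mapping.single m (Poly_Mapping.lookup p m))"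

lemma lookup_hc: "Poly_Mapping.lookup (hc t p) m = (if mdeg m = t then Poly_Mapping.lookup p m else 0)"
  by (simp add: hc_def lookup_sum lookup_single when_def in_keys_iff)

lemma hc_homog: "hc t p \<in> homog t"
  by (auto simp: homog_iff in_keys_iff lookup_hc split: if_splits)

lemma hc_add: "hc t (p + q) = hc t p + hc t q"
  by (rule poly_mapping_eqI) (simp add: lookup_hc lookup_add)

lemma hc_0 [simp]: "hc t 0 = 0"
  by (rule poly_mapping_eqI) (simp add: lookup_hc)

lemma hc_sum: "hc t (sum f A) = (\<Sum>i\<in>A. hc t (f i))"
  by (induction A rule: infinite_finite_induct) (auto simp: hc_add)

lemma hc_id: "p \<in> homog t \<Longrightarrow> hc t p = p"
  by (rule poly_mapping_eqI) (auto simp: lookup_hc homog_iff in_keys_iff)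

lemma hc_other: "p \<in> homog s \<Longrightarrow> s \<noteq> t \<Longrightarrow> hc t p = 0"
  by (rule poly_mapping_eqI) (auto simp: lookup_hc homog_iff in_keys_iff)

lemma hc_decomp: "\<exists>N. \<forall>n\<ge>N. (\<Sum>t<n. hc t p) = p"
proof (intro exI allI impI)
  fix n assume n: "n \<ge> Suc (\<Sum>m\<in>Poly_Mapping.keys p. mdeg m)"
  show "(\<Sum>t<n. hc t p) = p"
  proof (rule poly_mapping_eqI)
    fix m
    have "mdeg m < n" if "m \<in> Poly_Mapping.keys p"
      using member_le_sum[OF that, of mdeg] n by auto
    thus "Poly_Mapping.lookup (\<Sum>t<n. hc t p) m = Poly_Mapping.lookup p m"
      by (cases "m \<in> Poly_Mapping.keys p") (auto simp: lookup_sum lookup_hc in_keys_iff)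
  qed
qed

text \<open>Of the components of \<open>q\<close>, only the one of degree \<open>t - s\<close> is
  carried into degree \<open>t\<close> by \<open>p\<close>.\<close>

lemma hc_mult:
  fixes p q :: "('v::finite, 'k::field) mpoly"
  assumes "p \<in> homog s"
  shows "hc t (p * q) = (if s \<le> t then p * hc (t - s) q else 0)"
proof -
  obtain N where N: "\<forall>n\<ge>N. (\<Sum>u<n. hc u q) = q" using hc_decomp by blast
  define n where "n = max N (Suc t)"
  have n: "(\<Sum>u<n. hc u q) = q" and nt: "n > t" using N by (auto simp: n_def)
  have "hc t (p * q) = (\<Sum>u<n. hc t (p * hc u q))"
    using arg_cong[OF n, of "\<lambda>x. hc t (p * x)"] by (simp add: sum_distrib_left hc_sum)
  also have "\<dots> = (\<Sum>u<n. if u + s = t then p * hc u q else 0)"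
  proof (rule sum.cong)
    fix u
    have "p * hc u q \<in> homog (s + u)" using assms hc_homog by (rule homog_mult)
    thus "hc t (p * hc u q) = (if u + s = t then p * hc u q else 0)"
      using hc_id[of "p * hc u q"] hc_other[of "p * hc u q"] by (metis add.commute)
  qed simp
  also have "\<dots> = (if s \<le> t then p * hc (t - s) q else 0)"
  proof (cases "s \<le> t")
    case True
    hence "(\<Sum>u<n. if u + s = t then p * hc u q else 0) = (\<Sum>u<n. if u = t - s then p * hc u q else 0)"
      by (intro sum.cong) auto
    thus ?thesis using True nt by simp
  next
    case False
    thus ?thesis by (simp add: sum.neutral)
  qed
  finally show ?thesis .
qed

lemma homog_0_const:
  fixes f :: "('v::finite, 'k::field) mpoly"
  assumes "f \<in> homog 0" shows "f = const (Poly_Mapping.lookup f 0)"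
proof (rule poly_mapping_eqI)
  fix m
  show "Poly_Mapping.lookup f m = Poly_Mapping.lookup (const (Poly_Mapping.lookup f 0)) m"
  proof (cases "m = 0")
    case False
    have "Poly_Mapping.lookup f m = 0"
    proof (rule ccontr)
      assume "Poly_Mapping.lookup f m \<noteq> 0"
      hence "mdeg m = 0" using assms by (auto simp: homog_iff in_keys_iff)
      hence "m = 0" by (intro poly_mapping_eqI) (simp add: mdeg_def)
      thus False using False by simp
    qed
    thus ?thesis using False by (simp add: const_def lookup_single)
  qed (simp add: const_def)
qed

section \<open>Common factors\<close>

lemma poly_hom_ext:
  fixes f g :: "'a::comm_ring_1 poly \<Rightarrow> 'b::comm_ring_1"
  assumes "comm_ring_hom f" "comm_ring_hom g"
    and c: "\<And>c. f [:c:] = g [:c:]" and X: "f (pCons 0 1) = g (pCons 0 1)"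
  shows "f p = g p"
proof -
  interpret f: comm_ring_hom f by fact
  interpret g: comm_ring_hom g by fact
  show ?thesis
  proof (induction p)
    case 0 show ?case by simp
  next
    case (pCons a p)
    have "pCons a p = [:a:] + pCons 0 1 * p" by simp
    thus ?case using c X pCons by (metis f.hom_add g.hom_add f.hom_mult g.hom_mult)
  qed
qed

text \<open>For a homomorphism \<open>h\<close>, this is the existence half of the universal
  property; \<open>poly_hom_ext\<close> is the uniqueness half.\<close>

definition plift :: "('a::comm_ring_1 \<Rightarrow> 'b::comm_ring_1) \<Rightarrow> 'b \<Rightarrow> 'a poly \<Rightarrow> 'b" where
  "plift h y P = poly (map_poly h P) y"

lemma plift_hom: "comm_ring_hom h \<Longrightarrow> comm_ring_hom (plift h y)"
proof -
  assume "comm_ring_hom h"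
  then interpret h: comm_ring_hom h .
  interpret m: map_poly_comm_ring_hom h by unfold_locales
  show ?thesis
    by unfold_locales (auto simp: plift_def m.hom_add m.hom_mult)
qed

lemma plift_const [simp]: "comm_ring_hom h \<Longrightarrow> plift h y [:c:] = h c"
proof -
  assume "comm_ring_hom h"
  then interpret h: comm_ring_hom h .
  show ?thesis by (cases "c = 0") (simp_all add: plift_def)
qed

lemma plift_X [simp]: "comm_ring_hom h \<Longrightarrow> plift h y (pCons 0 1) = y"
proof -
  assume "comm_ring_hom h"
  then interpret h: comm_ring_hom h .
  show ?thesis by (simp add: plift_def h.map_poly_pCons_hom)
qed

lemma pconst_hom: "comm_ring_hom (\<lambda>c::'a::comm_ring_1. [:c:])"
  by unfold_locales (auto simp: one_pCons)

text \<open>Order at 0 and degree are both additive over products and agree for a monomial. As the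
  order never exceeds the degree, they agree for each factor, which is then a monomial too.\<close>

lemma monom_factor:
  fixes p q :: "'a::idom poly"
  assumes "p * q = monom c n" "c \<noteq> 0" "i \<noteq> degree p"
  shows "coeff p i = 0"
proof -
  have nz: "p \<noteq> 0" "q \<noteq> 0" "p * q \<noteq> 0" using assms by auto
  have "Polynomial.order 0 p + Polynomial.order 0 q = Polynomial.order 0 (monom c n)"
    using order_mult[OF nz(3), of 0] assms by simp
  also have "\<dots> = n" 
  proof -
    have "monom 1 k dvd monom c n \<longleftrightarrow> k \<le> n" for k
      using assms(2) by (auto simp: monom_1_dvd_iff')
    moreover have "monom c n \<noteq> 0" using assms(2) by simp
    ultimately show ?thesis using monom_1_dvd_iff by (metis order.eq_iff)
  qed
  also have "n = degree p + degree q"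
    using degree_mult_eq[OF nz(1,2)] assms(1,2) by (simp add: degree_monom_eq)
  finally have "degree p \<le> Polynomial.order 0 p"
    using order_degree[OF nz(1), of 0] order_degree[OF nz(2), of 0] by linarith
  hence "\<forall>k<degree p. coeff p k = 0"
    using monom_1_dvd_iff[OF nz(1)] by (simp add: monom_1_dvd_iff')
  thus ?thesis using assms(3) by (metis coeff_eq_0 nat_neq_iff)
qed

text \<open>Substitutes \<open>x_i T\<close> for \<open>x_i\<close>. The coefficient of
  \<open>T ^ t\<close> is the component of degree \<open>t\<close>, so forms become monomials in
  \<open>T\<close>.\<close>

definition hpoly :: "('v::finite, 'k::field) mpoly \<Rightarrow> ('v, 'k) mpoly poly" where
  "hpoly = ev (\<lambda>c. [:const c:]) (\<lambda>i. [:0, mvar i:])"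

lemma hpoly_hom: "comm_ring_hom hpoly"
  unfolding hpoly_def by (intro ev_hom comp_hom[OF pconst_hom const_hom])

lemma hpoly_homog: "p \<in> homog t \<Longrightarrow> hpoly p = monom p t"
proof -
  assume p: "p \<in> homog t"
  have "hpoly p = ev (\<lambda>c. [:const c:]) (\<lambda>i. pCons 0 1 * [:mvar i:]) p" by (simp add: hpoly_def)
  also have "\<dots> = pCons 0 1 ^ t * ev (\<lambda>c. [:const c:]) (\<lambda>i. [:mvar i:]) p"
    by (rule ev_scale[OF comp_hom[OF pconst_hom const_hom] p])
  also have "ev (\<lambda>c. [:const c:]) (\<lambda>i. [:mvar i:]) p = [:p:]"
    using ev_comp[OF const_hom pconst_hom, of mvar p] by (simp add: ev_id)
  also have "pCons 0 1 ^ t * [:p:] = monom p t"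
    by (simp add: monom_altdef)
  finally show ?thesis .
qed

lemma coeff_hpoly: "coeff (hpoly p) t = hc t p"
proof -
  interpret comm_ring_hom hpoly by (rule hpoly_hom)
  obtain N where N: "\<forall>n\<ge>N. (\<Sum>u<n. hc u p) = p" using hc_decomp by blast
  define n where "n = max N (Suc t)"
  have n: "(\<Sum>u<n. hc u p) = p" and nt: "n > t" using N by (auto simp: n_def)
  have "hpoly p = (\<Sum>u<n. monom (hc u p) u)"
    using arg_cong[OF n, of hpoly] by (simp add: hom_sum hpoly_homog[OF hc_homog])
  thus ?thesis using nt by (simp add: coeff_sum)
qed

text \<open>Under \<open>hpoly\<close> the product becomes a monomial in \<open>T\<close>, and by
  \<open>monom_factor\<close> its factors are monomials. Hence \<open>D\<close> has only one
  component.\<close>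

lemma homog_factor:
  fixes D G :: "'k::field R"
  assumes "D * G \<in> homog e" "D * G \<noteq> 0"
  shows "\<exists>s. D \<in> homog s"
proof -
  interpret comm_ring_hom "hpoly :: 'k R \<Rightarrow> _" by (rule hpoly_hom)
  have "hpoly D * hpoly G = monom (D * G) e"
    using hpoly_homog[OF assms(1)] by (simp add: hom_mult)
  from monom_factor[OF this assms(2)]
  have z: "hc i D = 0" if "i \<noteq> degree (hpoly D)" for i
    using that by (simp add: coeff_hpoly)
  let ?s = "degree (hpoly D)"
  have "hc ?s D = D"
  proof (rule poly_mapping_eqI)
    fix m show "Poly_Mapping.lookup (hc ?s D) m = Poly_Mapping.lookup D m"
      using arg_cong[OF z[of "mdeg m"], of "\<lambda>q. Poly_Mapping.lookup q m"] by (auto simp: lookup_hc)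
  qed
  thus ?thesis using hc_homog by metis
qed

text \<open>\<open>to_poly p\<close> rewrites a form in the coordinates \<open>x\<^sub>1\<close> and \<open>x\<^sub>i - p\<^sub>i x\<^sub>1\<close>, \<open>i = 2, 3, 4\<close>,
  the outermost variable being \<open>x\<^sub>1\<close>. The other coordinates vanish at \<open>p\<close> when \<open>p\<^sub>1 = 1\<close>.\<close>

definition to_poly :: "(4 \<Rightarrow> 'k) \<Rightarrow> 'k::field R \<Rightarrow> 'k poly poly poly poly" where
  "to_poly p = ev (\<lambda>c. [:[:[:[:c:]:]:]:])
     (\<lambda>i. if i = 1 then pCons 0 1
          else (if i = 2 then [:pCons 0 1:] else if i = 3 then [:[:pCons 0 1:]:] else [:[:[:pCons 0 1:]:]:])
            + [:0, [:[:[:p i:]:]:]:])"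

text \<open>The part of the inverse of \<open>to_poly\<close> that deals with polynomials free of
  the outermost variable. From the outside in, the three nested variables stand for
  \<open>x_i - p_i x_1\<close> with \<open>i = 2, 3, 4\<close>.\<close>

definition of_poly3 :: "(4 \<Rightarrow> 'k) \<Rightarrow> 'k::field poly poly poly \<Rightarrow> 'k R" where
  "of_poly3 p = (let y = \<lambda>i. mvar i - const (p i) * mvar 1 in
     plift (plift (plift const (y 4)) (y 3)) (y 2))"

definition of_poly :: "(4 \<Rightarrow> 'k) \<Rightarrow> 'k::field poly poly poly poly \<Rightarrow> 'k R" where
  "of_poly p = plift (of_poly3 p) (mvar 1)"

lemmas pconst2_hom = comp_hom[OF pconst_hom pconst_hom]
lemmas pconst3_hom = comp_hom[OF pconst_hom pconst2_hom]
lemmas pconst4_hom = comp_hom[OF pconst_hom pconst3_hom]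

lemma to_poly_hom: "comm_ring_hom (to_poly p)"
  unfolding to_poly_def by (rule ev_hom[OF pconst4_hom])

lemma of_poly3_hom: "comm_ring_hom (of_poly3 p)"
  unfolding of_poly3_def Let_def by (intro plift_hom const_hom)

lemma of_poly_hom: "comm_ring_hom (of_poly p)"
  unfolding of_poly_def by (intro plift_hom of_poly3_hom)

lemma four_cases: "(i::4) = 1 \<or> i = 2 \<or> i = 3 \<or> i = 4"
  using exhaust_4 by blast

lemma four_neq [simp]: "(2::4) \<noteq> 1" "(3::4) \<noteq> 1" "(4::4) \<noteq> 1" "(3::4) \<noteq> 2" "(4::4) \<noteq> 2" "(4::4) \<noteq> 3"
  "(1::4) \<noteq> 2" "(1::4) \<noteq> 3" "(1::4) \<noteq> 4" "(2::4) \<noteq> 3" "(2::4) \<noteq> 4" "(3::4) \<noteq> 4"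
  by simp_all

lemma of_poly3_simps:
  "of_poly3 p [:[:[:c:]:]:] = const c"
  "of_poly3 p (pCons 0 1) = mvar 2 - const (p 2) * mvar 1"
  "of_poly3 p [:pCons 0 1:] = mvar 3 - const (p 3) * mvar 1"
  "of_poly3 p [:[:pCons 0 1:]:] = mvar 4 - const (p 4) * mvar 1"
  by (simp_all add: of_poly3_def Let_def plift_hom const_hom)

lemma of_poly_simps:
  "of_poly p [:q:] = of_poly3 p q" "of_poly p (pCons 0 1) = mvar 1"
  by (simp_all add: of_poly_def of_poly3_hom)

lemma of_to_poly: "of_poly p (to_poly p f) = f"
proof -
  interpret o: comm_ring_hom "of_poly p" by (rule of_poly_hom)
  \<comment> \<open>As a product of a constant and the variable, the term is accessible to the
    homomorphism laws.\<close>
  have X: "[:0, [:[:[:c:]:]:]:] = [:[:[:[:c:]:]:]:] * pCons 0 1" for c :: 'a by simp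
  have "of_poly p (to_poly p f) = ev const mvar f"
    unfolding to_poly_def ev_comp[OF pconst4_hom of_poly_hom]
  proof (rule arg_cong2[where f = "\<lambda>h a. ev h a f"])
    show "(\<lambda>i. of_poly p (if i = 1 then pCons 0 1
          else (if i = 2 then [:pCons 0 1:] else if i = 3 then [:[:pCons 0 1:]:] else [:[:[:pCons 0 1:]:]:])
            + [:0, [:[:[:p i:]:]:]:])) = mvar"
    proof
      fix i :: 4
      consider "i = 1" | "i = 2" | "i = 3" | "i = 4" using four_cases by blast
      thus "of_poly p (if i = 1 then pCons 0 1
          else (if i = 2 then [:pCons 0 1:] else if i = 3 then [:[:pCons 0 1:]:] else [:[:[:pCons 0 1:]:]:])
            + [:0, [:[:[:p i:]:]:]:]) = mvar i"
        unfolding X by cases (simp_all add: o.hom_add o.hom_mult of_poly_simps of_poly3_simps del: mult_pCons_left mult_pCons_right)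
    qed
  qed (simp add: of_poly_simps of_poly3_simps)
  thus ?thesis by (simp add: ev_id)
qed

lemma to_of_poly: "to_poly p (of_poly p P) = P"
proof -
  interpret t: comm_ring_hom "to_poly p" by (rule to_poly_hom)
  have C: "to_poly p (const c) = [:[:[:[:c:]:]:]:]" for c
    unfolding to_poly_def by (rule ev_const[OF pconst4_hom])
  have V: "to_poly p (mvar i) = (if i = 1 then pCons 0 1
          else (if i = 2 then [:pCons 0 1:] else if i = 3 then [:[:pCons 0 1:]:] else [:[:[:pCons 0 1:]:]:])
            + [:0, [:[:[:p i:]:]:]:])" for i
    unfolding to_poly_def by (rule ev_mvar[OF pconst4_hom])
  have h4: "comm_ring_hom (\<lambda>P. to_poly p (of_poly p P))"
    by (rule comp_hom[OF to_poly_hom of_poly_hom])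
  have h3: "comm_ring_hom (\<lambda>P. to_poly p (of_poly3 p P))"
    by (rule comp_hom[OF to_poly_hom of_poly3_hom])
  have h2: "comm_ring_hom (\<lambda>P. to_poly p (of_poly3 p [:P:]))"
    by (rule comp_hom[OF h3 pconst_hom])
  have h1: "comm_ring_hom (\<lambda>P. to_poly p (of_poly3 p [:[:P:]:]))"
    by (rule comp_hom[OF h3 pconst2_hom])
  \<comment> \<open>One nested variable at a time, from the inside out: each level is checked on its
    coefficients, by the preceding level, and on its own variable.\<close>
  have s1: "to_poly p (of_poly3 p [:[:q:]:]) = [:[:[:q:]:]:]" for q
    by (rule poly_hom_ext[OF h1 pconst3_hom]) (simp_all add: of_poly3_simps C V t.hom_minus t.hom_mult)
  have s2: "to_poly p (of_poly3 p [:q:]) = [:[:q:]:]" for q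
    by (rule poly_hom_ext[OF h2 pconst2_hom]) (simp_all add: s1 of_poly3_simps C V t.hom_minus t.hom_mult)
  have s3: "to_poly p (of_poly3 p q) = [:q:]" for q
    by (rule poly_hom_ext[OF h3 pconst_hom]) (simp_all add: s2 of_poly3_simps C V t.hom_minus t.hom_mult)
  show ?thesis
    by (rule poly_hom_ext[OF h4 id_hom]) (simp_all add: s3 of_poly_simps V)
qed

text \<open>\<open>of_poly\<close> and \<open>to_poly\<close> are mutually inverse ring
  isomorphisms, so they respect divisibility. Prime factors found among nested polynomials are
  brought back to \<open>R\<close> in this way.\<close>

lemma prime_of_poly:
  assumes "prime_elem P" shows "prime_elem (of_poly p P)"
proof -
  interpret t: comm_ring_hom "to_poly p" by (rule to_poly_hom)
  interpret o: comm_ring_hom "of_poly p" by (rule of_poly_hom)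
  have dvd: "of_poly p P dvd f \<longleftrightarrow> P dvd to_poly p f" for f
  proof
    assume "of_poly p P dvd f"
    thus "P dvd to_poly p f" using t.hom_dvd[of "of_poly p P" f] by (simp add: to_of_poly)
  next
    assume "P dvd to_poly p f"
    thus "of_poly p P dvd f" using o.hom_dvd[of P "to_poly p f"] by (simp add: of_to_poly)
  qed
  show ?thesis
  proof (rule prime_elemI)
    show "of_poly p P \<noteq> 0" using prime_elem_not_zeroI[OF assms] to_of_poly[of p P] by (metis t.hom_zero)
    show "\<not> of_poly p P dvd 1" unfolding dvd using prime_elem_not_unit[OF assms] by simp
  next
    fix a b assume "of_poly p P dvd a * b"
    thus "of_poly p P dvd a \<or> of_poly p P dvd b"
      unfolding dvd t.hom_mult using prime_elem_dvd_multD[OF assms] by blast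
  qed
qed

lemma degree_0_prod_mset:
  fixes A :: "'a::idom poly multiset"
  shows "(\<And>x. x \<in># A \<Longrightarrow> degree x = 0) \<Longrightarrow> degree (prod_mset A) = 0"
proof (induction A)
  case (add x A)
  hence "degree (x * prod_mset A) \<le> 0" using degree_mult_le[of x "prod_mset A"] by simp
  thus ?case by simp
qed simp

text \<open>The forms \<open>x_i - p_i x_1\<close> vanish at \<open>p\<close>, hence do not change
  under translation by multiples of \<open>p\<close>. Polynomials in them are those pulled back
  under projection from \<open>p\<close>.\<close>

lemma peval_of_poly3:
  fixes p :: "4 \<Rightarrow> 'k::field"
  assumes p: "p 1 = 1"
  shows "peval (of_poly3 p q) (\<lambda>i. c * p i + \<beta> i) = peval (of_poly3 p q) \<beta>"
proof -
  let ?a = "\<lambda>i. c * p i + \<beta> i"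
  have h: "comm_ring_hom (\<lambda>q. peval (of_poly3 p q) a)" for a
    by (rule comp_hom[of "\<lambda>f. peval f a" "of_poly3 p", OF peval_hom of_poly3_hom])
  have h': "comm_ring_hom (\<lambda>q. peval (of_poly3 p [:q:]) a)" for a
    by (rule comp_hom[of "\<lambda>q. peval (of_poly3 p q) a" "\<lambda>q. [:q:]", OF h pconst_hom])
  have h'': "comm_ring_hom (\<lambda>q. peval (of_poly3 p [:[:q:]:]) a)" for a
    by (rule comp_hom[of "\<lambda>q. peval (of_poly3 p q) a" "\<lambda>q. [:[:q:]:]", OF h pconst2_hom])
  have c: "peval (const x) a = x" for x and a :: "4 \<Rightarrow> 'k"
    unfolding peval_ev by (rule ev_const[OF id_hom])
  have v: "peval (mvar i) a = a i" for i and a :: "4 \<Rightarrow> 'k"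
    unfolding peval_ev by (rule ev_mvar[OF id_hom])
  have y: "peval (mvar i - const (p i) * mvar 1) ?a = peval (mvar i - const (p i) * mvar 1) \<beta>" for i
  proof -
    interpret e: comm_ring_hom "\<lambda>f::'k R. peval f a" for a by (rule peval_hom)
    show ?thesis by (simp add: e.hom_minus e.hom_mult c v p algebra_simps)
  qed
  have s1: "peval (of_poly3 p [:[:q:]:]) ?a = peval (of_poly3 p [:[:q:]:]) \<beta>" for q
    by (rule poly_hom_ext[OF h'' h'']) (simp_all add: of_poly3_simps c y)
  have s2: "peval (of_poly3 p [:q:]) ?a = peval (of_poly3 p [:q:]) \<beta>" for q
    by (rule poly_hom_ext[OF h' h']) (simp_all add: of_poly3_simps s1 y)
  show ?thesis
    by (rule poly_hom_ext[OF h h]) (simp_all add: of_poly3_simps s2 y)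
qed

text \<open>Pseudo-division by an element of least degree in \<open>x\<^sub>1\<close> decides between a common factor and
  an element of the ideal that does not involve \<open>x\<^sub>1\<close>.\<close>

lemma common_factor_or_eliminant:
  fixes V :: "'k::field R set" and p :: "4 \<Rightarrow> 'k"
  assumes V: "V \<subseteq> homog e" and F: "F \<in> V" "F \<noteq> 0" and p: "p 1 = 1"
  shows "(\<exists>D s. s \<ge> 1 \<and> D \<in> homog s \<and> prime_elem D \<and> (\<forall>f\<in>V. D dvd f)) \<or>
    (\<exists>Q\<in>ideal_gen V. Q \<noteq> 0 \<and> (\<forall>c \<beta>. peval Q (\<lambda>i. c * p i + \<beta> i) = peval Q \<beta>))"
proof -
  interpret t: comm_ring_hom "to_poly p" by (rule to_poly_hom)
  interpret o: comm_ring_hom "of_poly p" by (rule of_poly_hom)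
  have t0: "to_poly p f = 0 \<longleftrightarrow> f = 0" for f
    using of_to_poly[of p f] by auto
  have "F \<in> ideal_gen V \<and> F \<noteq> 0" using F ideal.span_base by blast
  from ex_has_least_nat[of "\<lambda>E. E \<in> ideal_gen V \<and> E \<noteq> 0", OF this, of "\<lambda>E. degree (to_poly p E)"]
  obtain E where E: "E \<in> ideal_gen V" "E \<noteq> 0"
    and min: "\<And>f. f \<in> ideal_gen V \<Longrightarrow> f \<noteq> 0 \<Longrightarrow> degree (to_poly p E) \<le> degree (to_poly p f)"
    by blast
  have E0: "to_poly p E \<noteq> 0" using E(2) t0 by simp
  \<comment> \<open>The pseudo-remainder corresponds to an element of the ideal of smaller degree in
    \<open>x_1\<close>, so it is zero by the choice of \<open>E\<close>.\<close>
  have pd: "\<exists>a q. a \<noteq> 0 \<and> smult a (to_poly p f) = to_poly p E * q" if f: "f \<in> ideal_gen V" for f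
  proof -
    obtain a q where aq: "a \<noteq> 0" "smult a (to_poly p f) = to_poly p E * q + pseudo_mod (to_poly p f) (to_poly p E)"
      using pseudo_mod(1)[OF E0] by blast
    define r where "r = of_poly p [:a:] * f - of_poly p q * E"
    have tr: "to_poly p r = pseudo_mod (to_poly p f) (to_poly p E)"
      using aq(2) by (simp add: r_def t.hom_minus t.hom_mult to_of_poly algebra_simps)
    have "r \<in> ideal_gen V" unfolding r_def
      using f E(1) by (intro ideal.span_diff ideal.span_scale)
    hence "r = 0" using min[of r] pseudo_mod(2)[OF E0, of "to_poly p f"] t0[of r] unfolding tr[symmetric] by linarith
    hence "smult a (to_poly p f) = to_poly p E * q" using aq(2) tr by simp
    thus ?thesis using aq(1) by blast
  qed
  show ?thesis
  proof (cases "degree (to_poly p E) = 0")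
    case True
    then obtain q where q: "to_poly p E = [:q:]" by (rule degree_eq_zeroE)
    \<comment> \<open>Here \<open>E\<close> does not involve \<open>x_1\<close> and is itself the
      required eliminant.\<close>
    have "E = of_poly3 p q" using of_to_poly[of p E] q by (simp add: of_poly_simps)
    hence inv: "\<forall>c \<beta>. peval E (\<lambda>i. c * p i + \<beta> i) = peval E \<beta>" using peval_of_poly3[of p, OF p] by simp
    show ?thesis by (rule disjI2, rule bexI[OF _ E(1)], rule conjI[OF E(2) inv])
  next
    case False
    hence "\<not> to_poly p E dvd 1" using dvd_imp_degree_le[of "to_poly p E" 1] by force
    then obtain A where A: "mset_factors A (to_poly p E)" using mset_factors_exist[OF E0] by blast
    \<comment> \<open>Some irreducible factor involves \<open>x_1\<close>, since otherwise the
      product would not.\<close>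
    obtain P where P: "P \<in># A" "degree P \<noteq> 0"
      using degree_0_prod_mset[of A] False unfolding mset_factorsD(3)[OF A, symmetric] by blast
    have Pp: "prime_elem P" using mset_factorsD(1)[OF A P(1)] by (simp only: prime_elem_iff_irreducible)
    have PE: "P dvd to_poly p E" using mset_factors_imp_dvd[OF A P(1)] .
    \<comment> \<open>The multiplier \<open>a\<close> is free of \<open>x_1\<close> while
      \<open>P\<close> is not. So \<open>P\<close> does not divide \<open>a\<close>, and being prime
      it divides the form.\<close>
    have Pf: "P dvd to_poly p f" if f: "f \<in> V" for f
    proof -
      obtain a q where aq: "a \<noteq> 0" "smult a (to_poly p f) = to_poly p E * q"
        using pd ideal.span_base[OF f] by blast
      have "P dvd to_poly p E * q" using PE by (rule dvd_mult2)
      hence "P dvd [:a:] * to_poly p f" using aq(2) by simp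
      moreover have "\<not> P dvd [:a:]" 
      proof
        assume "P dvd [:a:]"
        from dvd_imp_degree_le[OF this] aq(1) P(2) show False by simp
      qed
      ultimately show ?thesis using prime_elem_dvd_multD[OF Pp, of "[:a:]" "to_poly p f"] by (simp only: simp_thms)
    qed
    define D where "D = of_poly p P"
    have Dp: "prime_elem D" unfolding D_def by (rule prime_of_poly[OF Pp])
    have Df: "D dvd f" if "f \<in> V" for f
      using o.hom_dvd[OF Pf[OF that]] by (simp add: of_to_poly D_def)
    obtain G where G: "F = D * G" using Df[OF F(1)] by (rule dvdE)
    then obtain s where s: "D \<in> homog s" using homog_factor[of D G e] V F by auto
    have "s \<noteq> 0"
    proof
      assume "s = 0"
      hence "D = const (Poly_Mapping.lookup D 0)" using s homog_0_const by blast
      hence "to_poly p D = to_poly p (const (Poly_Mapping.lookup D 0))" by (rule arg_cong)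
      also have "\<dots> = [:[:[:[:Poly_Mapping.lookup D 0:]:]:]:]"
        unfolding to_poly_def by (rule ev_const[OF pconst4_hom])
      finally have "to_poly p D = [:[:[:[:Poly_Mapping.lookup D 0:]:]:]:]" .
      hence "degree (to_poly p D) = 0" by (metis degree_pCons_0)
      thus False using P(2) by (simp add: D_def to_of_poly)
    qed
    hence "s \<ge> 1" by simp
    thus ?thesis using s Dp Df by (intro disjI1 exI[of _ D] exI[of _ s] conjI ballI)
  qed
qed

section \<open>Points and independent conditions\<close>

lemma hc_ideal_gen:
  fixes S :: "('v::finite, 'k::field) mpoly set"
  assumes S: "\<And>s. s \<in> S \<Longrightarrow> \<exists>u. s \<in> homog u" and f: "f \<in> ideal_gen S"
  shows "hc t f \<in> ideal_gen S"
  using f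
proof (induction rule: ideal.span_induct_alt)
  case base show ?case by (simp add: ideal.span_zero)
next
  case (step c s y)
  obtain u where u: "s \<in> homog u" using S[OF step(1)] by blast
  have "hc t (s * c) \<in> ideal_gen S"
    unfolding hc_mult[OF u] using ideal.span_scale[OF ideal.span_base[OF step(1)], of "hc (t - u) c"]
    by (simp add: ideal.span_zero mult.commute)
  thus ?case using step(2) by (simp add: hc_add mult.commute ideal.span_add)
qed

context fixes a :: "'v::finite \<Rightarrow> 'k::field" begin
interpretation peval: comm_ring_hom "\<lambda>f. peval f a" by (rule peval_hom)
lemmas peval_add = peval.hom_add
lemmas peval_mult = peval.hom_mult
lemmas peval_diff = peval.hom_minus
lemmas peval_power = peval.hom_power
lemmas peval_sum = peval.hom_sum
lemmas peval_zero = peval.hom_zero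
lemmas peval_one = peval.hom_one
lemma peval_const: "peval (const c) a = c"
  unfolding peval_ev by (rule ev_const[OF id_hom])
lemma peval_mvar: "peval (mvar i) a = a i"
  unfolding peval_ev by (rule ev_mvar[OF id_hom])
lemma peval_scale: "f \<in> homog t \<Longrightarrow> peval f (\<lambda>i. c * a i) = c ^ t * peval f a"
  unfolding peval_ev by (rule ev_scale[OF id_hom])
end

lemmas peval_simps = peval_add peval_mult peval_diff peval_power peval_sum peval_zero peval_one
  peval_const peval_mvar

lemma P3_rep:
  assumes "P \<in> P3"
  obtains v where "v \<noteq> 0" "v \<in> P" "\<And>f t. f \<in> homog t \<Longrightarrow> peval f (($) v) = 0 \<Longrightarrow> \<forall>w\<in>P. peval f (($) w) = 0"
proof -
  obtain v where v: "v \<noteq> 0" "P = proj_rel `` {v}" using assms by (auto simp: P3_def quotient_def)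
  show thesis
  proof (rule that[OF v(1)])
    have "v = 1 *s v" by simp
    hence "\<exists>c. c \<noteq> 0 \<and> v = c *s v" using one_neq_zero by metis
    thus "v \<in> P" using v by (simp add: proj_rel_def)
  next
    fix f :: "'a R" and t assume f: "f \<in> homog t" "peval f (($) v) = 0"
    show "\<forall>w\<in>P. peval f (($) w) = 0"
    proof
      fix w assume "w \<in> P"
      then obtain c where "w = c *s v" using v(2) by (auto simp: proj_rel_def)
      hence "($) w = (\<lambda>i. c * v $ i)" by (auto simp: vector_scalar_mult_def)
      thus "peval f (($) w) = 0" using peval_scale[OF f(1), of c "($) v"] f(2) by simp
    qed
  qed
qed

text \<open>A nonzero coordinate vector of the point at which the vanishing of a form on the whole
  class can be tested. By \<open>P3_rep\<close> such a choice exists for every point of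
  \<open>P3\<close>.\<close>

definition rep :: "('k::field ^ 4) set \<Rightarrow> 4 \<Rightarrow> 'k" where
  "rep P = (($) (SOME v. v \<noteq> 0 \<and> v \<in> P \<and>
     (\<forall>f t. f \<in> homog t \<longrightarrow> peval f (($) v) = 0 \<longrightarrow> (\<forall>w\<in>P. peval f (($) w) = 0))))"

lemma rep:
  assumes "P \<in> P3"
  shows "\<exists>v\<in>P. rep P = ($) v" "\<exists>i. rep P i \<noteq> 0"
    "f \<in> homog t \<Longrightarrow> (\<forall>w\<in>P. peval f (($) w) = 0) \<longleftrightarrow> peval f (rep P) = 0"
proof -
  obtain v where v: "v \<noteq> 0" "v \<in> P" "\<forall>f t. f \<in> homog t \<longrightarrow> peval f (($) v) = 0 \<longrightarrow> (\<forall>w\<in>P. peval f (($) w) = 0)"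
    and r: "rep P = ($) v"
  proof -
    define Q where "Q = (\<lambda>v. v \<noteq> 0 \<and> v \<in> P \<and>
       (\<forall>f t. f \<in> homog t \<longrightarrow> peval f (($) v) = 0 \<longrightarrow> (\<forall>w\<in>P. peval f (($) w) = 0)))"
    obtain v where "v \<noteq> 0" "v \<in> P" "\<And>f t. f \<in> homog t \<Longrightarrow> peval f (($) v) = 0 \<Longrightarrow> \<forall>w\<in>P. peval f (($) w) = 0"
      by (rule P3_rep[OF assms]) (rule that)
    hence "Q v" unfolding Q_def by (intro conjI allI impI)
    hence "Q (SOME v. Q v)" by (rule someI)
    moreover have "rep P = ($) (SOME v. Q v)" unfolding rep_def Q_def ..
    ultimately show thesis using that[of "SOME v. Q v"] unfolding Q_def by (elim conjE)
  qed
  show "\<exists>v\<in>P. rep P = ($) v" using r v(2) by blast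
  show "\<exists>i. rep P i \<noteq> 0" using v(1) unfolding r by (simp add: Finite_Cartesian_Product.vec_eq_iff)
  show "f \<in> homog t \<Longrightarrow> (\<forall>w\<in>P. peval f (($) w) = 0) \<longleftrightarrow> peval f (rep P) = 0"
    using v(2,3) unfolding r by blast
qed

lemma subspace_vanishing_ideal: "ideal.subspace (vanishing_ideal X)"
  unfolding vanishing_ideal_def by (rule ideal.subspace_span)

lemma vanishing_ideal_peval:
  assumes "f \<in> vanishing_ideal X" "P \<in> X" "v \<in> P" shows "peval f (($) v) = 0"
  using assms(1) unfolding vanishing_ideal_def
  by (induction rule: ideal.span_induct_alt) (use assms(2,3) in \<open>auto simp: peval_simps\<close>)

lemma vanishing_ideal_iff:
  assumes "f \<in> homog t" "X \<subseteq> P3"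
  shows "f \<in> vanishing_ideal X \<longleftrightarrow> (\<forall>P\<in>X. peval f (rep P) = 0)"
proof
  assume "f \<in> vanishing_ideal X"
  hence "\<forall>P\<in>X. \<forall>v\<in>P. peval f (($) v) = 0" using vanishing_ideal_peval by blast
  thus "\<forall>P\<in>X. peval f (rep P) = 0" using rep(3)[OF _ assms(1)] assms(2) by blast
next
  assume "\<forall>P\<in>X. peval f (rep P) = 0"
  hence "\<forall>P\<in>X. \<forall>v\<in>P. peval f (($) v) = 0" using rep(3)[OF _ assms(1)] assms(2) by blast
  thus "f \<in> vanishing_ideal X"
    unfolding vanishing_ideal_def using assms(1) by (intro ideal.span_base) blast
qed

lemma hc_vanishing_ideal: "f \<in> vanishing_ideal X \<Longrightarrow> hc t f \<in> vanishing_ideal X"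
  unfolding vanishing_ideal_def by (rule hc_ideal_gen) blast

section \<open>Independent conditions and uniform position\<close>

text \<open>In the usual terms: the points of \<open>Y\<close> impose independent conditions on
  forms of degree \<open>t\<close>.\<close>

definition sep :: "nat \<Rightarrow> ('k::field ^ 4) set set \<Rightarrow> bool" where
  "sep t Y \<longleftrightarrow> (\<forall>P\<in>Y. \<exists>g\<in>homog t. peval g (rep P) \<noteq> 0 \<and> (\<forall>Q\<in>Y - {P}. peval g (rep Q) = 0))"

lemma sep_subset: "sep t Y \<Longrightarrow> X \<subseteq> Y \<Longrightarrow> sep t X"
  unfolding sep_def
proof
  fix P assume Y: "\<forall>P\<in>Y. \<exists>g\<in>homog t. peval g (rep P) \<noteq> 0 \<and> (\<forall>Q\<in>Y - {P}. peval g (rep Q) = 0)"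
    and X: "X \<subseteq> Y" and P: "P \<in> X"
  then obtain g where "g \<in> homog t" "peval g (rep P) \<noteq> 0" "\<forall>Q\<in>Y - {P}. peval g (rep Q) = 0" by blast
  thus "\<exists>g\<in>homog t. peval g (rep P) \<noteq> 0 \<and> (\<forall>Q\<in>X - {P}. peval g (rep Q) = 0)" using X by blast
qed

lemma sep_interpolate:
  assumes "sep t Y" "finite Y"
  shows "\<exists>g\<in>homog t. \<forall>P\<in>Y. peval g (rep P) = \<phi> P"
proof -
  obtain E where E: "\<And>P. P \<in> Y \<Longrightarrow> E P \<in> homog t" "\<And>P. P \<in> Y \<Longrightarrow> peval (E P) (rep P) \<noteq> 0"
    "\<And>P Q. P \<in> Y \<Longrightarrow> Q \<in> Y \<Longrightarrow> Q \<noteq> P \<Longrightarrow> peval (E P) (rep Q) = 0"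
    using assms(1) unfolding sep_def by (metis Diff_iff singletonD)
  let ?g = "\<Sum>P\<in>Y. const (\<phi> P / peval (E P) (rep P)) * E P"
  show ?thesis
  proof (intro bexI[of _ ?g] ballI)
    show "?g \<in> homog t" using E(1) by (intro homog_sum homog_const_mult)
    fix Q assume Q: "Q \<in> Y"
    have "peval ?g (rep Q) = (\<Sum>P\<in>Y. if P = Q then \<phi> Q else 0)"
      unfolding peval_sum by (rule sum.cong) (use E Q in \<open>auto simp: peval_simps\<close>)
    thus "peval ?g (rep Q) = \<phi> Q" using assms(2) Q by simp
  qed
qed

text \<open>\<open>g\<close> itself separates \<open>Q\<close>. Subtracting a multiple of
  \<open>g\<close> makes the old separators vanish at \<open>Q\<close> and leaves their values on
  \<open>Y\<close> unchanged.\<close>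

lemma sep_insert:
  assumes Y: "sep t Y" and g: "g \<in> homog t" "\<forall>P\<in>Y. peval g (rep P) = 0" "peval g (rep Q) \<noteq> 0"
  shows "sep t (insert Q Y)"
  unfolding sep_def
proof
  fix P assume P: "P \<in> insert Q Y"
  show "\<exists>g\<in>homog t. peval g (rep P) \<noteq> 0 \<and> (\<forall>Q\<in>insert Q Y - {P}. peval g (rep Q) = 0)"
  proof (cases "P = Q")
    case True thus ?thesis using g by auto
  next
    case False
    then obtain E where E: "E \<in> homog t" "peval E (rep P) \<noteq> 0" "\<forall>Q\<in>Y - {P}. peval E (rep Q) = 0"
      using Y P unfolding sep_def by blast
    let ?h = "E - const (peval E (rep Q) / peval g (rep Q)) * g"
    have "?h \<in> homog t" using E(1) g(1) by (intro homog_diff homog_const_mult)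
    moreover have "peval ?h (rep P) \<noteq> 0" using E(2) g(2) P False by (simp add: peval_simps)
    moreover have "\<forall>R\<in>insert Q Y - {P}. peval ?h (rep R) = 0" using E(3) g by (auto simp: peval_simps)
    ultimately show ?thesis by blast
  qed
qed

text \<open>A separator of \<open>P\<close> is multiplied by a power of a coordinate that is nonzero
  at \<open>P\<close>.\<close>

lemma sep_mono:
  assumes "sep t Y" "t \<le> u" "Y \<subseteq> P3" shows "sep u Y"
  unfolding sep_def
proof
  fix P assume P: "P \<in> Y"
  obtain E where E: "E \<in> homog t" "peval E (rep P) \<noteq> 0" "\<forall>Q\<in>Y - {P}. peval E (rep Q) = 0"
    using assms(1) P unfolding sep_def by blast
  obtain i where i: "rep P i \<noteq> 0" using rep(2) P assms(3) by blast
  have "E * mvar i ^ (u - t) \<in> homog (t + 1 * (u - t))"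
    by (intro homog_mult E(1) homog_power mvar_homog)
  hence "E * mvar i ^ (u - t) \<in> homog u" using assms(2) by simp
  thus "\<exists>g\<in>homog u. peval g (rep P) \<noteq> 0 \<and> (\<forall>Q\<in>Y - {P}. peval g (rep Q) = 0)"
    using E i by (intro bexI[of _ "E * mvar i ^ (u - t)"]) (auto simp: peval_simps)
qed

text \<open>Take \<open>Y\<close> of greatest cardinality. A form vanishing on \<open>Y\<close> but
  not at some point of \<open>X\<close> would enlarge it by \<open>sep_insert\<close>.\<close>

lemma max_sep:
  assumes "finite X"
  obtains Y where "Y \<subseteq> X" "sep t Y" "\<And>g. g \<in> homog t \<Longrightarrow> \<forall>P\<in>Y. peval g (rep P) = 0 \<Longrightarrow> \<forall>P\<in>X. peval g (rep P) = 0"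
    "\<And>Y'. Y' \<subseteq> X \<Longrightarrow> sep t Y' \<Longrightarrow> card Y' \<le> card Y"
proof -
  have "{} \<subseteq> X \<and> sep t {}" by (simp add: sep_def)
  moreover have "\<forall>Y. Y \<subseteq> X \<and> sep t Y \<longrightarrow> card Y < Suc (card X)"
    using assms by (simp add: card_mono less_Suc_eq_le)
  ultimately have "\<exists>Y. (Y \<subseteq> X \<and> sep t Y) \<and> (\<forall>Y'. Y' \<subseteq> X \<and> sep t Y' \<longrightarrow> card Y' \<le> card Y)"
    by (rule Lattices_Big.ex_has_greatest_nat)
  then obtain Y where Y: "Y \<subseteq> X" "sep t Y" "\<And>Y'. Y' \<subseteq> X \<Longrightarrow> sep t Y' \<Longrightarrow> card Y' \<le> card Y"
    by auto
  have "peval g (rep Q) = 0" if g: "g \<in> homog t" "\<forall>P\<in>Y. peval g (rep P) = 0" and Q: "Q \<in> X" for g Q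
  proof (rule ccontr)
    assume nz: "peval g (rep Q) \<noteq> 0"
    hence "Q \<notin> Y" using g(2) by blast
    hence "card (insert Q Y) = Suc (card Y)" using Y(1) assms by (simp add: finite_subset)
    moreover have "card (insert Q Y) \<le> card Y" using Y(1) Q sep_insert[OF Y(2) g nz] by (intro Y(3)) auto
    ultimately show False by simp
  qed
  thus thesis using that[OF Y(1,2) _ Y(3)] by blast
qed

text \<open>Counts an indexed family in place of a set of representatives. Independence modulo
  \<open>I\<close> makes the family injective.\<close>

lemma hilb_eq_card:
  fixes b :: "'i \<Rightarrow> 'k::field R"
  assumes I: "ideal.subspace I" and A: "finite A" "\<And>i. i \<in> A \<Longrightarrow> b i \<in> homog t"
    and ind: "\<And>c i. (\<Sum>i\<in>A. pscale (c i) (b i)) \<in> I \<Longrightarrow> i \<in> A \<Longrightarrow> c i = 0"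
    and gen: "\<And>v. v \<in> homog t \<Longrightarrow> \<exists>c. v - (\<Sum>i\<in>A. pscale (c i) (b i)) \<in> I"
  shows "hilb I t = card A"
proof -
  have inj: "inj_on b A"
  proof (rule inj_onI, rule ccontr)
    fix i j assume ij: "i \<in> A" "j \<in> A" "b i = b j" "i \<noteq> j"
    let ?c = "\<lambda>n. (if n = i then 1 else 0) - (if n = j then 1 else (0::'k))"
    have "(\<Sum>n\<in>A. pscale (?c n) (b n)) = (\<Sum>n\<in>A. (if n = i then b i else 0) - (if n = j then b j else 0))"
      by (rule sum.cong) (auto simp: poly.scale_left_diff_distrib)
    also have "\<dots> = 0" using ij A(1) by (simp add: sum_subtractf)
    finally have "(\<Sum>n\<in>A. pscale (?c n) (b n)) \<in> I" using ideal.subspace_0[OF I] by simp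
    from ind[OF this ij(1)] ij(4) show False by simp
  qed
  have re: "(\<Sum>x\<in>b ` A. pscale (c x) x) = (\<Sum>i\<in>A. pscale (c (b i)) (b i))" for c
    using inj by (simp add: sum.reindex)
  have "basis_mod (homog t) I (b ` A)"
    unfolding basis_mod_def
  proof (intro conjI allI impI ballI)
    show "finite (b ` A)" using A(1) by simp
    show "b ` A \<subseteq> homog t" using A(2) by blast
  next
    fix c x assume "(\<Sum>x\<in>b ` A. pscale (c x) x) \<in> I" "x \<in> b ` A"
    thus "c x = 0" unfolding re using ind[of "\<lambda>i. c (b i)"] by auto
  next
    fix v :: "'k R" assume "v \<in> homog t"
    then obtain c where c: "v - (\<Sum>i\<in>A. pscale (c i) (b i)) \<in> I" using gen by blast
    have "(\<Sum>i\<in>A. pscale (c (inv_into A b (b i))) (b i)) = (\<Sum>i\<in>A. pscale (c i) (b i))"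
      by (rule sum.cong) (use inj in auto)
    thus "\<exists>c. v - (\<Sum>x\<in>b ` A. pscale (c x) x) \<in> I"
      unfolding re using c by (intro exI[of _ "\<lambda>x. c (inv_into A b x)"]) simp
  qed
  moreover obtain S where S: "finite S" "(homog t :: 'k R set) \<subseteq> poly.span S" by (metis homog_finite_span)
  ultimately have "card (b ` A) + poly.dim (homog t \<inter> I) = poly.dim (homog t :: 'k R set)"
    using basis_mod_card[OF subspace_homog subspace_ideal[OF I] S] by blast
  thus ?thesis using hilb_eq[OF I, of t] card_image[OF inj] by simp
qed

text \<open>The separators of \<open>Y\<close> form a basis modulo the ideal: their evaluation
  matrix on \<open>Y\<close> is diagonal and invertible, and a form vanishing on \<open>Y\<close>
  vanishes on \<open>X\<close>.\<close>

lemma hilb_card: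
  assumes X: "X \<subseteq> P3" "finite X" and Y: "Y \<subseteq> X" "sep t Y"
    and g: "\<And>g. g \<in> homog t \<Longrightarrow> \<forall>P\<in>Y. peval g (rep P) = 0 \<Longrightarrow> \<forall>P\<in>X. peval g (rep P) = 0"
  shows "hilb (vanishing_ideal X) t = card Y"
proof -
  let ?I = "vanishing_ideal X"
  have finY: "finite Y" using X(2) Y(1) finite_subset by blast
  obtain E where E: "\<And>P. P \<in> Y \<Longrightarrow> E P \<in> homog t" "\<And>P. P \<in> Y \<Longrightarrow> peval (E P) (rep P) \<noteq> 0"
    "\<And>P Q. P \<in> Y \<Longrightarrow> Q \<in> Y \<Longrightarrow> Q \<noteq> P \<Longrightarrow> peval (E P) (rep Q) = 0"
    using Y(2) unfolding sep_def by (metis Diff_iff singletonD)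
  have ev: "peval (\<Sum>P\<in>Y. pscale (c P) (E P)) (rep Q) = c Q * peval (E Q) (rep Q)" if Q: "Q \<in> Y" for c Q
  proof -
    have "peval (\<Sum>P\<in>Y. pscale (c P) (E P)) (rep Q) = (\<Sum>P\<in>Y. if P = Q then c Q * peval (E Q) (rep Q) else 0)"
      unfolding peval_sum by (rule sum.cong) (use E Q in \<open>auto simp: peval_simps pscale_def\<close>)
    thus ?thesis using finY Q by simp
  qed
  have hom: "(\<Sum>P\<in>Y. pscale (c P) (E P)) \<in> homog t" for c
    using E(1) by (intro homog_sum) (simp add: pscale_def homog_const_mult)
  show ?thesis
  proof (rule hilb_eq_card[OF subspace_vanishing_ideal finY E(1)])
    fix c Q assume s: "(\<Sum>P\<in>Y. pscale (c P) (E P)) \<in> ?I" and Q: "Q \<in> Y"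
    have "peval (\<Sum>P\<in>Y. pscale (c P) (E P)) (rep Q) = 0"
      using s vanishing_ideal_iff[OF hom[of c] X(1)] Q Y(1) by blast
    thus "c Q = 0" using ev[OF Q, of c] E(2)[OF Q] by simp
  next
    fix v :: "'a R" assume v: "v \<in> homog t"
    define c where "c = (\<lambda>P. peval v (rep P) / peval (E P) (rep P))"
    let ?w = "v - (\<Sum>P\<in>Y. pscale (c P) (E P))"
    have w: "?w \<in> homog t" using v hom by (rule homog_diff)
    have "\<forall>Q\<in>Y. peval ?w (rep Q) = 0"
      using ev[of _ c] E(2) by (simp add: peval_diff c_def)
    hence "?w \<in> ?I" using g[OF w] vanishing_ideal_iff[OF w X(1)] by blast
    thus "\<exists>c. v - (\<Sum>P\<in>Y. pscale (c P) (E P)) \<in> ?I" by (rule exI[of _ c])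
  qed
qed

lemma hilb_le_card:
  assumes "X \<subseteq> P3" "finite X" shows "hilb (vanishing_ideal X) t \<le> card X"
proof -
  obtain Y where "Y \<subseteq> X" "sep t Y" "\<And>g. g \<in> homog t \<Longrightarrow> \<forall>P\<in>Y. peval g (rep P) = 0 \<Longrightarrow> \<forall>P\<in>X. peval g (rep P) = 0"
    by (rule max_sep[OF assms(2), of t]) blast
  from hilb_card[OF assms this] this(1) show ?thesis using assms(2) by (simp add: card_mono)
qed

text \<open>Let \<open>Y\<close> be a largest separated subset of \<open>Z\<close>. If
  \<open>X\<close> has at most as many points as \<open>Y\<close>, then some subset of
  \<open>Y\<close> of the same size is separated, and UPP carries the full rank over to
  \<open>X\<close>. A larger \<open>X\<close> is excluded by means of \<open>g\<close>.\<close>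

lemma UPP_sep:
  assumes Z: "UPP Z" "Z \<subseteq> P3" "finite Z" and X: "X \<subseteq> Z"
    and g: "g \<in> homog t" "\<forall>P\<in>X. peval g (rep P) = 0" "Q \<in> Z" "peval g (rep Q) \<noteq> 0"
  shows "sep t X"
proof -
  obtain Y where Y: "Y \<subseteq> Z" "sep t Y" "\<And>g. g \<in> homog t \<Longrightarrow> \<forall>P\<in>Y. peval g (rep P) = 0 \<Longrightarrow> \<forall>P\<in>Z. peval g (rep P) = 0"
    "\<And>Y'. Y' \<subseteq> Z \<Longrightarrow> sep t Y' \<Longrightarrow> card Y' \<le> card Y"
    by (rule max_sep[OF Z(3), of t]) blast
  have finX: "finite X" using X Z(3) finite_subset by blast
  have finY: "finite Y" using Y(1) Z(3) finite_subset by blast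
  obtain X' where X': "X' \<subseteq> X" "sep t X'" "\<And>g. g \<in> homog t \<Longrightarrow> \<forall>P\<in>X'. peval g (rep P) = 0 \<Longrightarrow> \<forall>P\<in>X. peval g (rep P) = 0"
    by (rule max_sep[OF finX, of t]) blast
  have X3: "X \<subseteq> P3" using X Z(2) by blast
  have hX: "hilb (vanishing_ideal X) t = card X'" by (rule hilb_card[OF X3 finX X'])
  have "card X \<le> card Y"
  proof (rule ccontr)
    assume "\<not> card X \<le> card Y"
    moreover have "card X \<le> card Z" using X Z(3) by (rule card_mono[rotated])
    ultimately obtain W where W: "Y \<subseteq> W" "W \<subseteq> Z" "card W = card X"
      using exists_subset_between[of Y "card X" Z] Y(1) Z(3) by auto
    have "W \<subseteq> P3" "finite W" using W(2) Z(2,3) finite_subset by blast+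
    hence "hilb (vanishing_ideal W) t = card Y"
      using Y(3) W(2) by (intro hilb_card[OF _ _ W(1) Y(2)]) blast+
    moreover have "hilb (vanishing_ideal W) = hilb (vanishing_ideal X)"
      using Z(1) W(2,3) X unfolding UPP_def by blast
    ultimately have eq: "card X' = card Y" using hX by simp
    \<comment> \<open>By UPP a largest separated subset \<open>X'\<close> of \<open>X\<close> has as
      many points as \<open>Y\<close>. Adding \<open>Q\<close> with the form \<open>g\<close> gives
      a separated set that is too large.\<close>
    have "Q \<notin> X'" using g(2,4) X'(1) by blast
    hence "card (insert Q X') = Suc (card Y)" using eq X'(1) finX by (simp add: finite_subset)
    moreover have "sep t (insert Q X')" using X'(1) g by (intro sep_insert[OF X'(2)]) auto
    ultimately show False using Y(4)[of "insert Q X'"] g(3) X' X by auto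
  qed
  then obtain W where W: "W \<subseteq> Y" "card W = card X" using obtain_subset_with_card_n by metis
  have WZ: "W \<subseteq> Z" using W(1) Y(1) by blast
  have "W \<subseteq> P3" "finite W" using WZ Z(2,3) finite_subset by blast+
  hence "hilb (vanishing_ideal W) t = card W"
    using sep_subset[OF Y(2) W(1)] by (intro hilb_card) auto
  moreover have "hilb (vanishing_ideal W) = hilb (vanishing_ideal X)"
    using Z(1) WZ W(2) X unfolding UPP_def by blast
  ultimately have "card X' = card X" using hX W(2) by simp
  hence "X' = X" using X'(1) finX by (simp add: card_subset_eq)
  thus ?thesis using X'(2) by simp
qed

text \<open>By degrees, \<open>l1\<close> is a constant \<open>h\<close> times \<open>D\<close>. At
  \<open>u\<close> the form \<open>D\<close> is nonzero because its multiple \<open>l2\<close> is,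
  so \<open>h\<close> vanishes there and is zero.\<close>

lemma no_common_linear_factor:
  fixes D :: "'k::field R"
  assumes D: "D \<in> homog s" "s \<ge> 1" and l1: "l1 \<in> homog 1" "l1 \<noteq> 0" "D dvd l1" and l2: "D dvd l2"
    and u: "peval l1 u = 0" "peval l2 u \<noteq> 0"
  shows False
proof -
  obtain h where h: "l1 = D * h" using l1(3) by (rule dvdE)
  obtain k where k: "l2 = D * k" using l2 by (rule dvdE)
  have "peval h u = 0" using u unfolding h k by (simp add: peval_mult)
  have "h * D \<in> homog 1" "h * D \<noteq> 0" using l1(1,2) h by (simp_all add: mult.commute)
  then obtain n where n: "h \<in> homog n" using homog_factor by blast
  have "s + n = 1" using homog_unique[OF homog_mult[OF D(1) n]] l1(1,2) unfolding h by blast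
  hence "n = 0" using D(2) by simp
  hence hc: "h = const (Poly_Mapping.lookup h 0)" using n homog_0_const by blast
  hence "peval h u = Poly_Mapping.lookup h 0" using peval_const by metis
  hence "h = 0" using hc \<open>peval h u = 0\<close> by (simp add: const_def)
  thus False using h l1(2) by simp
qed

text \<open>Here \<open>a\<close> is the least degree of a form through \<open>Z\<close>. If
  \<open>D\<close> missed a point of \<open>Z\<close>, then \<open>D\<close> would divide every
  linear form through a suitable point of \<open>Z\<close>, which is impossible in four
  variables.\<close>

lemma common_prime_factor_vanishes:
  fixes Z :: "('k::field ^ 4) set set"
  assumes Z: "UPP Z" "Z \<subseteq> P3" "finite Z"
    and D: "D \<in> homog s" "s \<ge> 1" "prime_elem D"
    and a: "\<And>g t. g \<in> homog t \<Longrightarrow> t < a \<Longrightarrow> \<forall>P\<in>Z. peval g (rep P) = 0 \<Longrightarrow> g = 0"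
    and F: "F \<in> homog a" "F \<noteq> 0" "\<forall>P\<in>Z. peval F (rep P) = 0" "D dvd F" and ae: "a \<le> e"
    and e: "\<And>f. f \<in> homog e \<Longrightarrow> \<forall>P\<in>Z. peval f (rep P) = 0 \<Longrightarrow> D dvd f"
  shows "\<forall>P\<in>Z. peval D (rep P) = 0"
proof (rule ccontr)
  assume nv: "\<not> (\<forall>P\<in>Z. peval D (rep P) = 0)"
  then obtain Q where Q: "Q \<in> Z" "peval D (rep Q) \<noteq> 0" by blast
  obtain G where G: "F = D * G" using F(4) by (rule dvdE)
  have G0: "G \<noteq> 0" using G F(2) by auto
  have "G * D \<in> homog a" "G * D \<noteq> 0" using F(1,2) G by (simp_all add: mult.commute)
  then obtain r where r: "G \<in> homog r" using homog_factor by blast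
  have sr: "s + r = a" using homog_unique[OF homog_mult[OF D(1) r]] F(1,2) unfolding G by blast
  have GQ: "peval G (rep Q) = 0" using F(3) Q by (auto simp: G peval_mult)
  \<comment> \<open>If \<open>G\<close> were constant it would be zero, as it vanishes at
    \<open>Q\<close>. So both factors \<open>D\<close> and \<open>G\<close> have degree below
    \<open>a\<close>.\<close>
  have "r \<noteq> 0"
  proof
    assume "r = 0"
    hence hc: "G = const (Poly_Mapping.lookup G 0)" using r homog_0_const by blast
    hence "peval G (rep Q) = Poly_Mapping.lookup G 0" using peval_const by metis
    hence "G = 0" using hc GQ by (simp add: const_def)
    thus False using G0 by simp
  qed
  hence sa: "s < a" using sr by simp
  have ra: "r < a" using sr D(2) by simp
  define Z1 where "Z1 = {P\<in>Z. peval D (rep P) \<noteq> 0}"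
  define Z2 where "Z2 = {P\<in>Z. peval D (rep P) = 0}"
  have GZ1: "\<forall>P\<in>Z1. peval G (rep P) = 0" using F(3) by (auto simp: Z1_def G peval_mult)
  obtain Q' where Q': "Q' \<in> Z" "peval G (rep Q') \<noteq> 0" using a[OF r ra] G0 by blast
  \<comment> \<open>Having degree below \<open>a\<close>, \<open>G\<close> vanishes on
    \<open>Z1\<close> but not on all of \<open>Z\<close>; \<open>D\<close> vanishes on
    \<open>Z2\<close> but not at \<open>Q\<close>. These are the forms that \<open>UPP_sep\<close>
    asks for.\<close>
  have sep1: "sep r Z1" by (rule UPP_sep[OF Z _ r GZ1 Q']) (auto simp: Z1_def)
  have sep2: "sep s Z2" by (rule UPP_sep[OF Z _ D(1) _ Q]) (auto simp: Z2_def)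
  have P: "Q' \<in> Z2" using GZ1 Q' by (auto simp: Z1_def Z2_def)
  obtain E where E: "E \<in> homog s" "peval E (rep Q') \<noteq> 0" "\<forall>R\<in>Z2 - {Q'}. peval E (rep R) = 0"
    using sep2 P unfolding sep_def by blast
  have sep1': "sep (e - s) Z1"
    by (rule sep_mono[OF sep1]) (use sr ae Z(2) in \<open>auto simp: Z1_def\<close>)
  have finZ1: "finite Z1" using Z(3) by (simp add: Z1_def)
  \<comment> \<open>\<open>E\<close> vanishes on \<open>Z2\<close> except at \<open>Q'\<close>, and
    \<open>l\<close> vanishes at \<open>Q'\<close>, so \<open>E * l ^ (e - s)\<close> vanishes on
    \<open>Z2\<close>. A multiple of \<open>D\<close> corrects its values on \<open>Z1\<close>. The
    difference vanishes on \<open>Z\<close>, so it is divisible by \<open>D\<close>, while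
    \<open>E\<close> is not.\<close>
  have lin: "D dvd l" if l: "l \<in> homog 1" "peval l (rep Q') = 0" for l
  proof -
    let ?H = "E * l ^ (e - s)"
    have "?H \<in> homog (s + 1 * (e - s))" by (intro homog_mult homog_power E(1) l(1))
    hence H: "?H \<in> homog e" using sa ae by simp
    \<comment> \<open>The exponent is positive because \<open>s < a \<le> e\<close>; otherwise the
      power of \<open>l\<close> would not vanish at \<open>Q'\<close>.\<close>
    have H2: "\<forall>R\<in>Z2. peval ?H (rep R) = 0" using E(3) l(2) sa ae by (auto simp: peval_simps)
    obtain g where g: "g \<in> homog (e - s)" "\<forall>R\<in>Z1. peval g (rep R) = peval ?H (rep R) / peval D (rep R)"
      using sep_interpolate[OF sep1' finZ1, of "\<lambda>R. peval ?H (rep R) / peval D (rep R)"] by blast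
    have "D * g \<in> homog (s + (e - s))" by (rule homog_mult[OF D(1) g(1)])
    hence Dg: "D * g \<in> homog e" using sa ae by simp
    have "peval (?H - D * g) (rep R) = 0" if R: "R \<in> Z" for R
    proof (cases "R \<in> Z1")
      case True
      hence "peval D (rep R) \<noteq> 0" by (simp add: Z1_def)
      thus ?thesis using g(2) True by (simp add: peval_diff peval_mult[of D])
    next
      case False
      hence "peval D (rep R) = 0" "R \<in> Z2" using R by (auto simp: Z1_def Z2_def)
      thus ?thesis using H2 by (simp add: peval_diff peval_mult[of D])
    qed
    hence "D dvd ?H - D * g" by (intro e homog_diff H Dg ballI)
    hence "D dvd ?H" using dvd_add[of D "?H - D * g" "D * g"] by simp
    moreover have "\<not> D dvd E"
    proof
      assume "D dvd E"
      then obtain h where h: "E = D * h" by (rule dvdE)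
      show False using E(2) P unfolding h by (simp add: Z2_def peval_mult)
    qed
    ultimately have "D dvd l ^ (e - s)" using prime_elem_dvd_multD[OF D(3), of E "l ^ (e - s)"] by (simp only: simp_thms)
    thus "D dvd l" using prime_elem_dvd_power[OF D(3)] by (simp only: simp_thms)
  qed
  \<comment> \<open>Two independent linear forms through \<open>Q'\<close>, each involving
    \<open>x_k\<close> and one of two further coordinates, cannot share the factor
    \<open>D\<close>.\<close>
  obtain k where k: "rep Q' k \<noteq> 0" using rep(2) Q'(1) Z(2) by blast
  obtain i j :: 4 where ij: "i \<noteq> k" "j \<noteq> k" "i \<noteq> j"
    using four_cases[of k] four_neq by metis
  let ?l = "\<lambda>i. const (rep Q' k) * mvar i - const (rep Q' i) * mvar k"
  have l: "?l i \<in> homog 1" "peval (?l i) (rep Q') = 0" for i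
    by (intro homog_diff homog_const_mult mvar_homog) (simp add: peval_simps)
  have "peval (?l i) (\<lambda>n. if n = i then 1 else 0) \<noteq> 0"
    using ij k by (simp add: peval_simps)
  hence "?l i \<noteq> 0" using peval_zero by metis
  thus False
    using no_common_linear_factor[OF D(1,2) l(1) _ lin[OF l] lin[OF l], of i "\<lambda>n. if n = j then 1 else 0" j] ij k
    by (simp add: peval_simps)
qed

section \<open>Hilbert functions and linear forms\<close>

lemma hilb_basis:
  fixes I :: "'k::field R set"
  assumes I: "ideal.subspace I"
  obtains B where "basis_mod (homog t) I B" "hilb I t = card B"
proof -
  obtain S where S: "finite S" "(homog t :: 'k R set) \<subseteq> poly.span S" by (metis homog_finite_span)
  obtain B where B: "basis_mod (homog t) I B"
    using basis_mod_exists[OF subspace_homog subspace_ideal[OF I] S] by (rule exE)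
  have "card B + poly.dim (homog t \<inter> I) = poly.dim (homog t :: 'k R set)"
    by (rule basis_mod_card[OF subspace_homog subspace_ideal[OF I] S B])
  hence "hilb I t = card B" using hilb_eq[OF I, of t] by simp
  thus thesis using that B by simp
qed

text \<open>The kernel of \<open>R_t/J \<rightarrow> R_t/K\<close> is the image of
  \<open>V/W\<close> under multiplication by \<open>L\<close>. A basis of \<open>R_t/J\<close>
  consists of \<open>L\<close> times \<open>B\<close> and a basis modulo \<open>K\<close>. The cases
  used are \<open>L = 1\<close> and linear forms.\<close>

lemma hilb_split:
  fixes J K V W :: "'k::field R set"
  assumes J: "ideal.subspace J" and K: "ideal.subspace K" "J \<subseteq> K"
    and V: "\<And>v. v \<in> V \<Longrightarrow> L * v \<in> homog t \<inter> K" and B: "basis_mod V W B"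
    and W: "\<And>v. L * v \<in> J \<longleftrightarrow> v \<in> W"
    and surj: "\<And>x. x \<in> homog t \<inter> K \<Longrightarrow> \<exists>v\<in>V. x - L * v \<in> J"
  shows "hilb J t = hilb K t + card B"
proof -
  obtain C where C: "basis_mod (homog t) K C" "hilb K t = card C" by (rule hilb_basis[OF K(1)])
  have B': "finite B" "B \<subseteq> V" "\<And>c b. (\<Sum>b\<in>B. pscale (c b) b) \<in> W \<Longrightarrow> b \<in> B \<Longrightarrow> c b = 0"
    "\<And>v. v \<in> V \<Longrightarrow> \<exists>c. v - (\<Sum>b\<in>B. pscale (c b) b) \<in> W"
    using B unfolding basis_mod_def by simp_all
  have C': "finite C" "C \<subseteq> homog t" "\<And>c b. (\<Sum>b\<in>C. pscale (c b) b) \<in> K \<Longrightarrow> b \<in> C \<Longrightarrow> c b = 0"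
    "\<And>v. v \<in> homog t \<Longrightarrow> \<exists>c. v - (\<Sum>b\<in>C. pscale (c b) b) \<in> K"
    using C(1) unfolding basis_mod_def by simp_all
  have LB: "(\<Sum>b\<in>B. pscale (c b) (L * b)) = L * (\<Sum>b\<in>B. pscale (c b) b)" for c
    unfolding sum_distrib_left pscale_def by (simp only: mult.left_commute)
  have LK: "(\<Sum>b\<in>B. pscale (c b) (L * b)) \<in> K" for c
  proof (rule ideal.subspace_sum[OF K(1)])
    fix b assume "b \<in> B"
    hence "L * b \<in> K" using V B'(2) by blast
    thus "pscale (c b) (L * b) \<in> K" unfolding pscale_def by (rule ideal.subspace_scale[OF K(1)])
  qed
  define b where "b = case_sum ((*) L) (\<lambda>x::'k R. x)"
  have su: "(\<Sum>i\<in>B <+> C. pscale (c i) (b i)) =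
      (\<Sum>x\<in>B. pscale (c (Inl x)) (L * x)) + (\<Sum>x\<in>C. pscale (c (Inr x)) x)" for c
    using B'(1) C'(1) by (subst sum.Plus) (simp_all add: b_def o_def)
  have "hilb J t = card (B <+> C)"
  proof (rule hilb_eq_card[OF J, of _ b])
    show "finite (B <+> C)" using B'(1) C'(1) by simp
    show "b i \<in> homog t" if "i \<in> B <+> C" for i
      using that V B'(2) C'(2) by (auto simp: b_def)
  next
    fix c i assume s: "(\<Sum>i\<in>B <+> C. pscale (c i) (b i)) \<in> J" and i: "i \<in> B <+> C"
    have "(\<Sum>x\<in>C. pscale (c (Inr x)) x) \<in> K"
      using ideal.subspace_diff[OF K(1) subsetD[OF K(2) s] LK[of "\<lambda>x. c (Inl x)"]] by (simp add: su)
    hence C0: "c (Inr x) = 0" if "x \<in> C" for x using C'(3)[of "\<lambda>x. c (Inr x)"] that by simp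
    hence "L * (\<Sum>x\<in>B. pscale (c (Inl x)) x) \<in> J" using s by (simp add: su LB)
    hence B0: "c (Inl x) = 0" if "x \<in> B" for x using B'(3)[of "\<lambda>x. c (Inl x)"] that by (simp add: W)
    show "c i = 0" using i B0 C0 by auto
  next
    fix v :: "'k R" assume v: "v \<in> homog t"
    obtain d where d: "v - (\<Sum>b\<in>C. pscale (d b) b) \<in> K" using C'(4)[OF v] by blast
    have "(\<Sum>b\<in>C. pscale (d b) b) \<in> homog t"
      using C'(2) by (intro poly.subspace_sum[OF subspace_homog] poly.subspace_scale[OF subspace_homog]) blast
    hence "v - (\<Sum>b\<in>C. pscale (d b) b) \<in> homog t \<inter> K" using d v by (simp add: homog_diff)
    then obtain u where u: "u \<in> V" "v - (\<Sum>b\<in>C. pscale (d b) b) - L * u \<in> J" using surj by blast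
    obtain c where c: "u - (\<Sum>b\<in>B. pscale (c b) b) \<in> W" using B'(4)[OF u(1)] by blast
    hence "L * (u - (\<Sum>b\<in>B. pscale (c b) b)) \<in> J" by (simp add: W)
    from ideal.subspace_add[OF J u(2) this]
    moreover have "v - C' - L * u + L * (u - B') = v - (L * B' + C')" for B' C' :: "'k R"
      by (simp add: right_diff_distrib)
    ultimately have "v - (\<Sum>i\<in>B <+> C. pscale (case_sum c d i) (b i)) \<in> J"
      by (simp add: su LB)
    thus "\<exists>c. v - (\<Sum>i\<in>B <+> C. pscale (c i) (b i)) \<in> J" by (intro exI[of _ "case_sum c d"])
  qed
  thus ?thesis using C(2) B'(1) C'(1) by (simp add: card_Plus)
qed

lemma hilb_cong:
  fixes J K :: "'k::field R set"
  assumes "ideal.subspace J" "ideal.subspace K" "homog t \<inter> J = homog t \<inter> K"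
  shows "hilb J t = hilb K t"
  using hilb_eq[OF assms(1), of t] hilb_eq[OF assms(2), of t] assms(3) by simp

lemma hilb_antimono_split:
  fixes J K :: "'k::field R set"
  assumes J: "ideal.subspace J" and K: "ideal.subspace K" "J \<subseteq> K"
  obtains B where "basis_mod (homog t \<inter> K) J B" "hilb J t = hilb K t + card B"
proof -
  obtain S where S: "finite S" "(homog t :: 'k R set) \<subseteq> poly.span S" by (metis homog_finite_span)
  have "poly.subspace (homog t \<inter> K)"
    by (intro poly.subspace_inter subspace_homog subspace_ideal K(1))
  moreover have "homog t \<inter> K \<subseteq> poly.span S" using S(2) by blast
  ultimately obtain B where B: "basis_mod (homog t \<inter> K) J B"
    using basis_mod_exists[of "homog t \<inter> K" J S] subspace_ideal[OF J] S(1) by blast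
  have "hilb J t = hilb K t + card B"
  proof (rule hilb_split[OF J K _ B, of 1])
    fix x assume "x \<in> homog t \<inter> K"
    thus "\<exists>v\<in>homog t \<inter> K. x - 1 * v \<in> J" using ideal.subspace_0[OF J] by (intro bexI[of _ x]) auto
  qed simp_all
  thus thesis using that B by simp
qed

lemma hilb_antimono:
  fixes J K :: "'k::field R set"
  assumes "ideal.subspace J" "ideal.subspace K" "J \<subseteq> K"
  shows "hilb K t \<le> hilb J t"
  by (rule hilb_antimono_split[OF assms, of t]) simp

lemma hilb_antimono_eq:
  fixes J K :: "'k::field R set"
  assumes "ideal.subspace J" "ideal.subspace K" "J \<subseteq> K" and le: "hilb J t \<le> hilb K t"
    and f: "f \<in> homog t" "f \<in> K"
  shows "f \<in> J"
proof -
  obtain B where B: "basis_mod (homog t \<inter> K) J B" "hilb J t = hilb K t + card B"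
    by (rule hilb_antimono_split[OF assms(1-3), of t])
  have "finite B" using B(1) by (simp add: basis_mod_def)
  hence "B = {}" using B(2) le by simp
  thus ?thesis using B(1) f by (simp add: basis_mod_def)
qed

lemma hilb_eq_0_iff:
  fixes J :: "'k::field R set"
  assumes J: "ideal.subspace J"
  shows "hilb J t = 0 \<longleftrightarrow> homog t \<subseteq> J"
proof
  assume "homog t \<subseteq> J"
  hence "homog t \<inter> J = homog t" by blast
  thus "hilb J t = 0" using hilb_eq[OF J, of t] by simp
next
  assume 0: "hilb J t = 0"
  have "ideal.subspace (UNIV :: 'k R set)" by (simp add: ideal.subspace_def)
  hence "f \<in> J" if "f \<in> homog t" for f using hilb_antimono_eq[OF J _ subset_UNIV _ that] 0 by simp
  thus "homog t \<subseteq> J" by (rule subsetI)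
qed

section \<open>Homogeneous ideals and multiplication by a linear form\<close>

definition homogeneous :: "'k::field R set \<Rightarrow> bool" where
  "homogeneous J \<longleftrightarrow> ideal.subspace J \<and> (\<forall>f\<in>J. \<forall>t. hc t f \<in> J)"

lemma homogeneousD: "homogeneous J \<Longrightarrow> ideal.subspace J" "homogeneous J \<Longrightarrow> f \<in> J \<Longrightarrow> hc t f \<in> J"
  by (auto simp: homogeneous_def)

lemma mem_ideal_gen_Un:
  fixes J :: "'k::field R set"
  assumes J: "ideal.subspace J"
  shows "f \<in> ideal_gen (J \<union> {L}) \<longleftrightarrow> (\<exists>j\<in>J. \<exists>g. f = j + L * g)"
proof -
  have "ideal_gen J = J" using J by (simp add: ideal.span_eq_iff)
  hence "f \<in> ideal_gen (J \<union> {L}) \<longleftrightarrow> (\<exists>g. f - g * L \<in> J)"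
    using ideal.span_breakdown_eq[of f L J] by (simp only: Un_insert_right Un_empty_right)
  also have "\<dots> \<longleftrightarrow> (\<exists>j\<in>J. \<exists>g. f = j + L * g)"
  proof
    assume "\<exists>g. f - g * L \<in> J"
    then obtain g where g: "f - g * L \<in> J" ..
    have "f = (f - g * L) + L * g" by (simp add: mult.commute)
    thus "\<exists>j\<in>J. \<exists>g. f = j + L * g" using g by (intro bexI exI)
  next
    assume "\<exists>j\<in>J. \<exists>g. f = j + L * g"
    then obtain j g where "j \<in> J" "f = j + L * g" by (elim bexE exE)
    thus "\<exists>g. f - g * L \<in> J" by (intro exI[of _ g]) (simp add: mult.commute)
  qed
  finally show ?thesis .
qed

lemma homogeneous_Un:
  fixes J :: "'k::field R set"
  assumes J: "homogeneous J" and L: "L \<in> homog 1"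
  shows "homogeneous (ideal_gen (J \<union> {L}))"
  unfolding homogeneous_def
proof (intro conjI ballI allI)
  fix f t assume "f \<in> ideal_gen (J \<union> {L})"
  then obtain j g where jg: "j \<in> J" "f = j + L * g"
    unfolding mem_ideal_gen_Un[OF homogeneousD(1)[OF J]] by (elim bexE exE)
  have "hc t f = hc t j + L * (if 1 \<le> t then hc (t - 1) g else 0)"
    unfolding jg(2) hc_add hc_mult[OF L] by simp
  thus "hc t f \<in> ideal_gen (J \<union> {L})"
    unfolding mem_ideal_gen_Un[OF homogeneousD(1)[OF J]] by (intro bexI exI, assumption) (rule homogeneousD(2)[OF J jg(1)])
qed (rule ideal.subspace_span)

lemma homog_mem_ideal_gen_Un:
  fixes J :: "'k::field R set"
  assumes J: "homogeneous J" and L: "L \<in> homog 1" and f: "f \<in> homog t" "f \<in> ideal_gen (J \<union> {L})"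
  shows "if t = 0 then f \<in> J else \<exists>j\<in>J \<inter> homog t. \<exists>g\<in>homog (t - 1). f = j + L * g"
proof -
  obtain j g where jg: "j \<in> J" "f = j + L * g"
    using f(2) unfolding mem_ideal_gen_Un[OF homogeneousD(1)[OF J]] by (elim bexE exE)
  have "f = hc t f" using hc_id[OF f(1)] by simp
  also have "\<dots> = hc t j + (if 1 \<le> t then L * hc (t - 1) g else 0)"
    unfolding jg(2) hc_add hc_mult[OF L] ..
  finally have eq: "f = hc t j + (if 1 \<le> t then L * hc (t - 1) g else 0)" .
  show ?thesis
  proof (cases "t = 0")
    case True thus ?thesis using eq homogeneousD(2)[OF J jg(1), of t] by simp
  next
    case False
    hence "f = hc t j + L * hc (t - 1) g" using eq by simp
    moreover have "hc t j \<in> J \<inter> homog t" using homogeneousD(2)[OF J jg(1)] hc_homog by simp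
    ultimately have "\<exists>j\<in>J \<inter> homog t. \<exists>g\<in>homog (t - 1). f = j + L * g" using hc_homog by (intro bexI)
    thus ?thesis using False by simp
  qed
qed

definition colon :: "'k::field R set \<Rightarrow> 'k R \<Rightarrow> 'k R set" where
  "colon J L = {f. L * f \<in> J}"

lemma subspace_colon:
  assumes "ideal.subspace J" shows "ideal.subspace (colon J L)"
proof (rule ideal.subspaceI)
  show "0 \<in> colon J L" using ideal.subspace_0[OF assms] by (simp add: colon_def)
  show "x + y \<in> colon J L" if "x \<in> colon J L" "y \<in> colon J L" for x y
    using ideal.subspace_add[OF assms, of "L * x" "L * y"] that by (simp add: colon_def distrib_left)
  show "c * x \<in> colon J L" if "x \<in> colon J L" for c x
    using ideal.subspace_scale[OF assms, of "L * x" c] that unfolding colon_def mem_Collect_eq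
    by (simp only: mult.left_commute[of L c])
qed

lemma colon_superset: "ideal.subspace J \<Longrightarrow> J \<subseteq> colon J L"
  unfolding colon_def using ideal.subspace_scale[of J _ L] by blast

text \<open>The exact sequence \<open>0 \<rightarrow> (R/(J:L))_t \<rightarrow> (R/J)_(t+1)
  \<rightarrow> (R/(J,L))_(t+1) \<rightarrow> 0\<close>. In degree 0 no multiple of \<open>L\<close>
  occurs.\<close>

lemma hilb_add_linear:
  fixes J :: "'k::field R set"
  assumes J: "homogeneous J" and L: "L \<in> homog 1"
  shows "hilb J (Suc t) = hilb (ideal_gen (J \<union> {L})) (Suc t) + hilb (colon J L) t"
    and "hilb J 0 = hilb (ideal_gen (J \<union> {L})) 0"
proof -
  note Js = homogeneousD(1)[OF J]
  have sub: "J \<subseteq> ideal_gen (J \<union> {L})" using ideal.span_superset[of "J \<union> {L}"] by blast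
  obtain B where B: "basis_mod (homog t) (colon J L) B" "hilb (colon J L) t = card B"
    by (rule hilb_basis[OF subspace_colon[OF Js]])
  have "hilb J (Suc t) = hilb (ideal_gen (J \<union> {L})) (Suc t) + card B"
  proof (rule hilb_split[OF Js ideal.subspace_span sub _ B(1)])
    fix v :: "'k R" assume v: "v \<in> homog t"
    have "L * v \<in> homog (Suc t)" using homog_mult[OF L v] by simp
    moreover have "L * v \<in> ideal_gen (J \<union> {L})"
      using ideal.span_scale[OF ideal.span_base[of L "J \<union> {L}"], of v] by (simp add: mult.commute)
    ultimately show "L * v \<in> homog (Suc t) \<inter> ideal_gen (J \<union> {L})" by simp
  next
    fix x assume x: "x \<in> homog (Suc t) \<inter> ideal_gen (J \<union> {L})"
    obtain j g where "j \<in> J" "g \<in> homog t" "x = j + L * g"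
      using homog_mem_ideal_gen_Un[OF J L, of x "Suc t"] x by auto
    thus "\<exists>v\<in>homog t. x - L * v \<in> J" by (intro bexI[of _ g]) auto
  qed (simp add: colon_def)
  thus "hilb J (Suc t) = hilb (ideal_gen (J \<union> {L})) (Suc t) + hilb (colon J L) t" using B(2) by simp
  show "hilb J 0 = hilb (ideal_gen (J \<union> {L})) 0"
    by (rule hilb_cong[OF Js ideal.subspace_span])
      (use homog_mem_ideal_gen_Un[OF J L, of _ 0] sub in auto)
qed

section \<open>General pairs of linear forms\<close>

lemma linform_homog: "linform a \<in> homog 1"
  unfolding linform_def pscale_def by (intro homog_sum homog_const_mult mvar_homog)

lemma peval_linform: "peval (linform a) v = (\<Sum>i\<in>UNIV. a $ i * v i)"
  by (simp add: linform_def pscale_def peval_simps)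

lemma poly_eval_hom: "comm_ring_hom (\<lambda>p :: 'a::comm_ring_1 poly. poly p t)"
  by unfold_locales auto

lemma peval_curve: "peval g (\<lambda>v. poly (\<Gamma> v) t) = poly (ev (\<lambda>c. [:c:]) \<Gamma> g) t"
  unfolding peval_ev ev_comp[OF pconst_hom poly_eval_hom] by simp

text \<open>Along the curve, a polynomial nonzero at \<open>t0\<close> becomes a nonzero polynomial
  in \<open>t\<close>, which has finitely many roots. Every later choice of general members rests on
  this.\<close>

lemma zariski_open_curve:
  fixes \<Gamma> :: "'v::finite \<Rightarrow> 'k::field poly"
  assumes "zariski_open U" "(\<lambda>v. poly (\<Gamma> v) t0) \<in> U"
  shows "finite {t. (\<lambda>v. poly (\<Gamma> v) t) \<notin> U}"
proof -
  obtain G where U: "U = {a. \<exists>g\<in>G. peval g a \<noteq> 0}" using assms(1) unfolding zariski_open_def by (rule exE)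
  then obtain g where g: "g \<in> G" "peval g (\<lambda>v. poly (\<Gamma> v) t0) \<noteq> 0" using assms(2) by blast
  let ?q = "ev (\<lambda>c. [:c:]) \<Gamma> g"
  have "?q \<noteq> 0" using g(2) unfolding peval_curve by (metis poly_0)
  hence "finite {t. poly ?q t = 0}" by (rule poly_roots_finite)
  moreover have "{t. (\<lambda>v. poly (\<Gamma> v) t) \<notin> U} \<subseteq> {t. poly ?q t = 0}"
    using g(1) unfolding U peval_curve[symmetric] by blast
  ultimately show ?thesis by (rule finite_subset[rotated])
qed

text \<open>The line joining a point of \<open>U\<close> to a point of \<open>W\<close> leaves each
  set at only finitely many parameters, and the field is infinite.\<close>

lemma zariski_open_Int:
  fixes U W :: "('v::finite \<Rightarrow> 'k::field_char_0) set"
  assumes U: "zariski_open U" "U \<noteq> {}" and W: "zariski_open W" "W \<noteq> {}"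
  shows "zariski_open (U \<inter> W)" "U \<inter> W \<noteq> {}"
proof -
  obtain G where G: "U = {a. \<exists>g\<in>G. peval g a \<noteq> 0}" using U(1) unfolding zariski_open_def by (rule exE)
  obtain H where H: "W = {a. \<exists>g\<in>H. peval g a \<noteq> 0}" using W(1) unfolding zariski_open_def by (rule exE)
  have "U \<inter> W = {a. \<exists>f\<in>(\<lambda>(g, h). g * h) ` (G \<times> H). peval f a \<noteq> 0}"
    unfolding G H by (auto simp: peval_mult)
  thus "zariski_open (U \<inter> W)" unfolding zariski_open_def by (rule exI)
  obtain u w where uw: "u \<in> U" "w \<in> W" using U(2) W(2) by blast
  define \<Gamma> where "\<Gamma> = (\<lambda>v. [:u v, w v - u v:])"
  have "finite {t. (\<lambda>v. poly (\<Gamma> v) t) \<notin> U}"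
    by (rule zariski_open_curve[OF U(1), of _ 0]) (simp add: \<Gamma>_def uw)
  moreover have "finite {t. (\<lambda>v. poly (\<Gamma> v) t) \<notin> W}"
    by (rule zariski_open_curve[OF W(1), of _ 1]) (simp add: \<Gamma>_def uw)
  ultimately have "finite ({t. (\<lambda>v. poly (\<Gamma> v) t) \<notin> U} \<union> {t. (\<lambda>v. poly (\<Gamma> v) t) \<notin> W})" by simp
  then obtain t where "t \<notin> {t. (\<lambda>v. poly (\<Gamma> v) t) \<notin> U} \<union> {t. (\<lambda>v. poly (\<Gamma> v) t) \<notin> W}"
    using ex_new_if_finite[OF infinite_UNIV_char_0] by blast
  thus "U \<inter> W \<noteq> {}" by blast
qed

lemma for_general_pair_mono:
  "for_general_pair Q \<Longrightarrow> (\<And>a b. Q (linform a) (linform b) \<Longrightarrow> Q' (linform a) (linform b)) \<Longrightarrow> for_general_pair Q'"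
  unfolding for_general_pair_def by meson

lemma for_general_pair_conj:
  fixes Q Q' :: "'k::field_char_0 R \<Rightarrow> 'k R \<Rightarrow> bool"
  assumes "for_general_pair Q" "for_general_pair Q'"
  shows "for_general_pair (\<lambda>L1 L2. Q L1 L2 \<and> Q' L1 L2)"
proof -
  obtain U where U: "zariski_open U" "U \<noteq> {}" "\<And>a b. case_sum (($) a) (($) b) \<in> U \<Longrightarrow> Q (linform a) (linform b)"
    using assms(1) unfolding for_general_pair_def by auto
  obtain W where W: "zariski_open W" "W \<noteq> {}" "\<And>a b. case_sum (($) a) (($) b) \<in> W \<Longrightarrow> Q' (linform a) (linform b)"
    using assms(2) unfolding for_general_pair_def by auto
  show ?thesis unfolding for_general_pair_def
    by (rule exI[of _ "U \<inter> W"]) (use U W zariski_open_Int[OF U(1,2) W(1,2)] in auto)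
qed

lemma case_sum_vec: "\<exists>a b. x = case_sum (($) a) (($) b)"
proof (intro exI)
  show "x = case_sum (($) (\<chi> i. x (Inl i))) (($) (\<chi> i. x (Inr i)))"
    by (rule ext) (simp split: sum.split)
qed

lemma for_general_pair_ex:
  assumes "for_general_pair Q" shows "\<exists>a b. Q (linform a) (linform b)"
proof -
  obtain U x where U: "x \<in> U" "\<And>a b. case_sum (($) a) (($) b) \<in> U \<Longrightarrow> Q (linform a) (linform b)"
    using assms unfolding for_general_pair_def by auto
  obtain a b where "x = case_sum (($) a) (($) b)" using case_sum_vec[of x] by (elim exE)
  thus ?thesis using U by blast
qed

text \<open>For one point the condition is the nonvanishing of a nonzero linear polynomial in the
  coefficients of \<open>L1\<close>; finitely many such conditions are intersected.\<close>

lemma for_general_pair_nonvanishing: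
  fixes Z :: "('k::field_char_0 ^ 4) set set"
  assumes "finite Z" "Z \<subseteq> P3"
  shows "for_general_pair (\<lambda>L1 L2. \<forall>P\<in>Z. peval L1 (rep P) \<noteq> 0)"
  using assms
proof (induction Z rule: finite_induct)
  case empty
  have "(UNIV :: (4 + 4 \<Rightarrow> 'k) set) = {a. \<exists>g\<in>{1}. peval g a \<noteq> 0}" by (simp add: peval_one)
  hence "zariski_open (UNIV :: (4 + 4 \<Rightarrow> 'k) set)" unfolding zariski_open_def by (rule exI)
  thus ?case unfolding for_general_pair_def by (intro exI[of _ UNIV]) simp
next
  case (insert P Z)
  have "for_general_pair (\<lambda>L1 L2. peval L1 (rep P) \<noteq> 0)"
  proof -
    let ?g = "\<Sum>i\<in>UNIV. const (rep P i) * mvar (Inl i) :: (4 + 4, 'k) mpoly"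
    let ?U = "{x. peval ?g x \<noteq> 0}"
    have e: "peval ?g x = (\<Sum>i\<in>UNIV. rep P i * x (Inl i))" for x by (simp add: peval_simps)
    have "?U = {a. \<exists>g\<in>{?g}. peval g a \<noteq> 0}" by simp
    hence "zariski_open ?U" unfolding zariski_open_def by (rule exI)
    moreover have "?U \<noteq> {}"
    proof -
      obtain i where i: "rep P i \<noteq> 0" using rep(2) insert(4) by blast
      have "(\<Sum>j\<in>UNIV. rep P j * case_sum (\<lambda>j. if j = i then 1 else 0) (\<lambda>_. 0) (Inl j)) = (\<Sum>j\<in>UNIV. if j = i then rep P i else 0)"
        by (rule sum.cong) auto
      hence "peval ?g (case_sum (\<lambda>j. if j = i then 1 else 0) (\<lambda>_. 0)) \<noteq> 0" using i unfolding e by simp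
      thus ?thesis by blast
    qed
    moreover have "peval (linform a) (rep P) \<noteq> 0" if "case_sum (($) a) (($) b) \<in> ?U" for a b
      using that unfolding e mem_Collect_eq peval_linform by (simp add: mult.commute)
    ultimately show ?thesis unfolding for_general_pair_def by (intro exI[of _ ?U]) simp
  qed
  from for_general_pair_conj[OF this insert(3)] insert(4)
  show ?case by (auto elim: for_general_pair_mono)
qed

lemma ideal_gen_Un_Un:
  fixes I :: "'k::field R set"
  shows "ideal_gen (ideal_gen (I \<union> {L1}) \<union> {L2}) = ideal_gen (I \<union> {L1, L2})"
proof (rule antisym)
  show "ideal_gen (ideal_gen (I \<union> {L1}) \<union> {L2}) \<subseteq> ideal_gen (I \<union> {L1, L2})"
  proof (rule ideal.span_minimal[OF _ ideal.subspace_span])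
    have "ideal_gen (I \<union> {L1}) \<subseteq> ideal_gen (I \<union> {L1, L2})" by (rule ideal.span_mono) blast
    moreover have "L2 \<in> ideal_gen (I \<union> {L1, L2})" by (rule ideal.span_base) simp
    ultimately show "ideal_gen (I \<union> {L1}) \<union> {L2} \<subseteq> ideal_gen (I \<union> {L1, L2})" by simp
  qed
  show "ideal_gen (I \<union> {L1, L2}) \<subseteq> ideal_gen (ideal_gen (I \<union> {L1}) \<union> {L2})"
  proof (rule ideal.span_mono)
    have "I \<union> {L1} \<subseteq> ideal_gen (I \<union> {L1})" by (rule ideal.span_superset)
    thus "I \<union> {L1, L2} \<subseteq> ideal_gen (I \<union> {L1}) \<union> {L2}" by blast
  qed
qed

section \<open>Differences of the Hilbert function as dimensions\<close>

lemma homogeneous_vanishing_ideal: "homogeneous (vanishing_ideal Z)"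
  by (simp add: homogeneous_def subspace_vanishing_ideal hc_vanishing_ideal)

text \<open>A linear form that is nonzero at every point of \<open>Z\<close> is a nonzerodivisor
  modulo the ideal of \<open>Z\<close>, so the colon ideal adds nothing in any degree.\<close>

lemma \<Delta>H_hyperplane_section:
  fixes Z :: "('k::field ^ 4) set set"
  assumes Z: "Z \<subseteq> P3" and L: "L \<in> homog 1" "\<forall>P\<in>Z. peval L (rep P) \<noteq> 0"
  shows "\<Delta>H (vanishing_ideal Z) t = int (hilb (ideal_gen (vanishing_ideal Z \<union> {L})) t)"
proof (cases t)
  case 0
  thus ?thesis using hilb_add_linear(2)[OF homogeneous_vanishing_ideal L(1), of Z] by (simp add: \<Delta>H_def diff1_def)
next
  case (Suc u)
  let ?I = "vanishing_ideal Z"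
  have "homog u \<inter> colon ?I L = homog u \<inter> ?I"
  proof -
    have "f \<in> colon ?I L \<longleftrightarrow> f \<in> ?I" if f: "f \<in> homog u" for f
    proof -
      have "L * f \<in> homog (1 + u)" using L(1) f by (rule homog_mult)
      thus ?thesis using L(2)
        by (simp add: colon_def vanishing_ideal_iff[OF _ Z] vanishing_ideal_iff[OF f Z] peval_mult)
    qed
    thus ?thesis by blast
  qed
  hence "hilb (colon ?I L) u = hilb ?I u"
    by (intro hilb_cong subspace_colon subspace_vanishing_ideal)
  thus ?thesis using hilb_add_linear(1)[OF homogeneous_vanishing_ideal L(1), of Z u] Suc
    by (simp add: \<Delta>H_def diff1_def)
qed

text \<open>The numerical consequence of WLP through which it enters the rest of the
  argument.\<close>

definition good_pair :: "('k::field ^ 4) set set \<Rightarrow> 'k R \<Rightarrow> 'k R \<Rightarrow> bool" where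
  "good_pair Z L1 L2 \<longleftrightarrow>
    (\<forall>t. int (hilb (ideal_gen (vanishing_ideal Z \<union> {L1, L2})) t) = max 0 (\<Delta>2H (vanishing_ideal Z) t))"

text \<open>If multiplication by \<open>L2\<close> into degree \<open>t\<close> is injective, the
  cokernel has dimension \<open>\<Delta>2H\<close>. If it is surjective, the cokernel is zero and
  \<open>\<Delta>2H\<close> is not positive.\<close>

lemma good_pair_if_WLP:
  fixes Z :: "('k::field ^ 4) set set"
  assumes Z: "Z \<subseteq> P3" and L1: "L1 \<in> homog 1" "\<forall>P\<in>Z. peval L1 (rep P) \<noteq> 0" and L2: "L2 \<in> homog 1"
    and wlp: "\<forall>t. mult_inj (ideal_gen (vanishing_ideal Z \<union> {L1})) L2 t \<or>
      mult_surj (ideal_gen (vanishing_ideal Z \<union> {L1})) L2 t"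
  shows "good_pair Z L1 L2"
  unfolding good_pair_def
proof
  fix t
  let ?I = "vanishing_ideal Z"
  let ?J = "ideal_gen (?I \<union> {L1})"
  have J: "homogeneous ?J" by (rule homogeneous_Un[OF homogeneous_vanishing_ideal L1(1)])
  note Js = homogeneousD(1)[OF J]
  note \<Delta> = \<Delta>H_hyperplane_section[OF Z L1]
  show "int (hilb (ideal_gen (?I \<union> {L1, L2})) t) = max 0 (\<Delta>2H ?I t)"
  proof (cases t)
    case 0
    thus ?thesis using hilb_add_linear(2)[OF J L2, unfolded ideal_gen_Un_Un]
      by (simp add: \<Delta>2H_def diff1_def \<Delta>)
  next
    case (Suc u)
    have eq: "int (hilb ?J (Suc u)) = int (hilb (ideal_gen (?I \<union> {L1, L2})) (Suc u)) + int (hilb (colon ?J L2) u)"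
      using hilb_add_linear(1)[OF J L2, of u, unfolded ideal_gen_Un_Un] by simp
    have d2: "\<Delta>2H ?I t = int (hilb ?J (Suc u)) - int (hilb ?J u)"
      by (simp add: \<Delta>2H_def diff1_def \<Delta> Suc)
    show ?thesis
    proof (cases "mult_inj ?J L2 u")
      case True
      have "f \<in> ?J" if f: "f \<in> homog u" "L2 * f \<in> ?J" for f
      proof -
        have "f - 0 \<in> ?J" using True f homog_0 unfolding mult_inj_def by (metis diff_zero mult_zero_right)
        thus ?thesis by simp
      qed
      hence "homog u \<inter> colon ?J L2 = homog u \<inter> ?J"
        using colon_superset[OF Js, of L2] unfolding colon_def by blast
      hence "hilb (colon ?J L2) u = hilb ?J u"
        by (intro hilb_cong subspace_colon Js)
      thus ?thesis using eq d2 Suc by simp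
    next
      case False
      hence surj: "mult_surj ?J L2 u" using wlp by blast
      have "g \<in> ideal_gen (?I \<union> {L1, L2})" if g: "g \<in> homog (Suc u)" for g
      proof -
        obtain f where f: "g - L2 * f \<in> ?J" using surj g unfolding mult_surj_def by (metis Suc_eq_plus1)
        have "g = (g - L2 * f) + L2 * f" by simp
        hence "\<exists>j\<in>?J. \<exists>f. g = j + L2 * f" using f by (intro bexI exI)
        thus ?thesis unfolding ideal_gen_Un_Un[symmetric] mem_ideal_gen_Un[OF Js] .
      qed
      hence "hilb (ideal_gen (?I \<union> {L1, L2})) (Suc u) = 0"
        unfolding hilb_eq_0_iff[OF ideal.subspace_span] by (rule subsetI)
      moreover have "hilb (colon ?J L2) u \<le> hilb ?J u"
        by (rule hilb_antimono[OF Js subspace_colon[OF Js] colon_superset[OF Js]])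
      ultimately show ?thesis using eq d2 Suc by simp
    qed
  qed
qed

lemma for_general_pair_good:
  fixes Z :: "('k::field_char_0 ^ 4) set set"
  assumes Z: "Z \<subseteq> P3" "finite Z" "WLP Z"
  shows "for_general_pair (good_pair Z)"
  using for_general_pair_conj[OF Z(3)[unfolded WLP_def Let_def] for_general_pair_nonvanishing[OF Z(2,1)]]
  by (rule for_general_pair_mono) (auto intro!: good_pair_if_WLP[OF Z(1)] linform_homog)

lemma homog_Suc_ideal:
  fixes f :: "'k::field R"
  assumes J: "ideal.subspace J" "homog t \<subseteq> J" and f: "f \<in> homog (Suc t)"
  shows "f \<in> J"
proof -
  have "Poly_Mapping.single m c \<in> J" if m: "mdeg m = Suc t" for m :: "4 \<Rightarrow>\<^sub>0 nat" and c :: 'k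
  proof -
    have "m \<noteq> 0" using m by auto
    then obtain i where i: "Poly_Mapping.lookup m i \<noteq> 0"
      by (metis lookup_zero poly_mapping_eqI)
    let ?n = "m - Poly_Mapping.single i 1"
    have mn: "Poly_Mapping.single i 1 + ?n = m"
      by (rule poly_mapping_eqI) (use i in \<open>auto simp: lookup_add lookup_minus lookup_single when_def\<close>)
    have "1 + mdeg ?n = Suc t" using mdeg_add[of "Poly_Mapping.single i 1" ?n] m unfolding mn by simp
    hence "Poly_Mapping.single ?n c \<in> homog t" by (auto simp: homog_iff split: if_splits)
    hence "mvar i * Poly_Mapping.single ?n c \<in> J" using J ideal.subspace_scale by blast
    moreover have "mvar i * Poly_Mapping.single ?n c = Poly_Mapping.single m c"
      unfolding mvar_def mult_single mn by simp
    ultimately show ?thesis by simp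
  qed
  hence "(\<Sum>m\<in>Poly_Mapping.keys f. Poly_Mapping.single m (Poly_Mapping.lookup f m)) \<in> J"
    using f by (intro ideal.subspace_sum[OF J(1)]) (simp add: homog_iff)
  thus ?thesis by (simp add: mpoly_sum_single)
qed

lemma hilb_0_mono:
  fixes J :: "'k::field R set"
  assumes J: "ideal.subspace J" and "hilb J t = 0" "t \<le> u"
  shows "hilb J u = 0"
  using assms(3,2)
proof (induction u rule: dec_induct)
  case (step n)
  hence "homog n \<subseteq> J" using hilb_eq_0_iff[OF J] by simp
  hence "homog (Suc n) \<subseteq> J" using homog_Suc_ideal[OF J] by blast
  thus ?case using hilb_eq_0_iff[OF J] by simp
qed

text \<open>The Hilbert function is nondecreasing, its first difference being a dimension, and
  bounded by the number of points. So it is eventually constant.\<close>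

lemma \<Delta>2H_eventually_0:
  fixes Z :: "('k::field_char_0 ^ 4) set set"
  assumes Z: "Z \<subseteq> P3" "finite Z"
  shows "\<exists>T. \<forall>t\<ge>T. \<Delta>2H (vanishing_ideal Z) t = 0"
proof -
  let ?h = "hilb (vanishing_ideal Z)"
  obtain a where a: "\<forall>P\<in>Z. peval (linform a) (rep P) \<noteq> 0"
    using for_general_pair_ex[OF for_general_pair_nonvanishing[OF Z(2,1)]] by blast
  have "?h t \<le> ?h (Suc t)" for t
    using \<Delta>H_hyperplane_section[OF Z(1) linform_homog a, of "Suc t"] by (simp add: \<Delta>H_def diff1_def)
  hence mono: "s \<le> t \<Longrightarrow> ?h s \<le> ?h t" for s t by (rule lift_Suc_mono_le)
  have "\<exists>T. True \<and> (\<forall>t. True \<longrightarrow> ?h t \<le> ?h T)"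
    by (rule Lattices_Big.ex_has_greatest_nat[where b = "Suc (card Z)"])
      (use hilb_le_card[OF Z] in \<open>simp_all add: less_Suc_eq_le\<close>)
  then obtain T where T: "\<And>t. ?h t \<le> ?h T" by blast
  have c: "?h t = ?h T" if "t \<ge> T" for t using mono[OF that] T[of t] by simp
  have "\<Delta>2H (vanishing_ideal Z) t = 0" if "t \<ge> T + 2" for t
    using that c[of t] c[of "t - 1"] c[of "t - 2"] by (simp add: \<Delta>2H_def \<Delta>H_def diff1_def numeral_2_eq_2)
  thus ?thesis by blast
qed

text \<open>For a good pair, the quotient is nonzero exactly in the degrees where
  \<open>\<Delta>2H\<close> is positive. These degrees do not depend on the pair, are closed
  downwards and bounded, and include 0; \<open>r2\<close> is the greatest of them.\<close>

lemma r2_good_pair: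
  fixes Z :: "('k::field_char_0 ^ 4) set set"
  assumes Z: "Z \<subseteq> P3" "finite Z" "Z \<noteq> {}" "WLP Z" and g: "good_pair Z L1 L2"
  shows "t \<le> r2 (vanishing_ideal Z) \<Longrightarrow> \<Delta>2H (vanishing_ideal Z) t > 0"
    and "\<exists>T. hilb (ideal_gen (vanishing_ideal Z \<union> {L1, L2})) T = 0"
proof -
  let ?I = "vanishing_ideal Z"
  define pos where "pos = (\<lambda>t. \<Delta>2H ?I t > 0)"
  obtain T where T: "\<forall>t\<ge>T. \<Delta>2H ?I t = 0" using \<Delta>2H_eventually_0[OF Z(1,2)] by blast
  have hpos: "hilb (ideal_gen (?I \<union> {L1, L2})) t \<noteq> 0 \<longleftrightarrow> pos t" if "good_pair Z L1 L2" for L1 L2 t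
    using that[unfolded good_pair_def, rule_format, of t] by (auto simp: pos_def max_def split: if_splits)
  show "\<exists>T. hilb (ideal_gen (?I \<union> {L1, L2})) T = 0"
    using hpos[OF g, of T] T by (auto simp: pos_def)
  have down: "pos s" if "pos t" "s \<le> t" for s t
    using that hilb_0_mono[OF ideal.subspace_span _ that(2), of "?I \<union> {L1, L2}"] hpos[OF g] by blast
  have p0: "pos 0"
  proof -
    obtain P where P: "P \<in> Z" using Z(3) by blast
    have "const 1 \<notin> ?I" using vanishing_ideal_iff[OF const_homog Z(1), of 1] P by (auto simp: peval_const)
    hence "\<not> homog 0 \<subseteq> ?I" using const_homog by blast
    hence "hilb ?I 0 \<noteq> 0" using hilb_eq_0_iff[OF subspace_vanishing_ideal] by blast
    thus ?thesis by (simp add: pos_def \<Delta>2H_def \<Delta>H_def diff1_def)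
  qed
  have "\<exists>r. pos r \<and> (\<forall>k. pos k \<longrightarrow> k \<le> r)"
  proof (rule Nat.ex_has_greatest_nat[of pos 0 T])
    show "\<forall>y. pos y \<longrightarrow> y \<le> T" using T by (auto simp: pos_def) (metis less_irrefl nat_le_linear)
  qed (rule p0)
  then obtain r where r: "pos r" "\<And>k. pos k \<Longrightarrow> k \<le> r" by blast
  let ?Q = "\<lambda>r L1 L2. hilb (ideal_gen (?I \<union> {L1, L2})) r \<noteq> 0 \<and>
     (\<forall>k. hilb (ideal_gen (?I \<union> {L1, L2})) k \<noteq> 0 \<longrightarrow> k \<le> r)"
  note gg = for_general_pair_good[OF Z(1,2,4)]
  have "r2 ?I = r"
    unfolding r2_def
  proof (rule the_equality)
    show "for_general_pair (?Q r)"
      by (rule for_general_pair_mono[OF gg]) (use hpos r in blast)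
  next
    \<comment> \<open>A pair that is good and also general for \<open>r'\<close> exists, and it
      determines the maximum.\<close>
    fix r' assume "for_general_pair (?Q r')"
    from for_general_pair_ex[OF for_general_pair_conj[OF gg this]]
    obtain a b where ab: "good_pair Z (linform a) (linform b)" "?Q r' (linform a) (linform b)" by blast
    have "pos r'" "\<And>k. pos k \<Longrightarrow> k \<le> r'" using ab(2) hpos[OF ab(1)] by blast+
    thus "r' = r" using r by (meson le_antisym)
  qed
  thus "t \<le> r2 ?I \<Longrightarrow> \<Delta>2H ?I t > 0" using down[OF r(1)] unfolding pos_def by simp
qed

section \<open>Lines through a point\<close>

lemma poly_nonzero_const:
  fixes q :: "'a::idom poly" and h :: "'k::field_char_0 \<Rightarrow> 'a"
  assumes "q \<noteq> 0" "inj h" shows "\<exists>c. poly q (h c) \<noteq> 0"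
proof (rule ccontr)
  assume "\<not> ?thesis"
  hence "range h \<subseteq> {x. poly q x = 0}" by blast
  hence "finite (range h)" using poly_roots_finite[OF assms(1)] by (rule finite_subset)
  hence "finite (UNIV :: 'k set)" using assms(2) by (rule finite_imageD)
  thus False using infinite_UNIV_char_0 by blast
qed

text \<open>With \<open>p = 0\<close> the nested form merely orders the variables. They are given
  values one at a time, avoiding finitely many roots in an infinite field.\<close>

lemma ex_peval_nonzero:
  fixes f :: "'k::field_char_0 R"
  assumes "f \<noteq> 0" shows "\<exists>a. peval f a \<noteq> 0"
proof -
  let ?z = "\<lambda>_::4. 0::'k"
  interpret o: comm_ring_hom "of_poly ?z" by (rule of_poly_hom)
  let ?P = "to_poly ?z f"
  have "?P \<noteq> 0" using of_to_poly[of ?z f] assms by auto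
  then obtain c1 where c1: "poly ?P [:[:[:c1:]:]:] \<noteq> 0"
    using poly_nonzero_const[of ?P "\<lambda>c. [:[:[:c:]:]:]"] by (auto simp: inj_def)
  then obtain c2 where c2: "poly (poly ?P [:[:[:c1:]:]:]) [:[:c2:]:] \<noteq> 0"
    using poly_nonzero_const[of _ "\<lambda>c. [:[:c:]:]"] by (auto simp: inj_def)
  then obtain c3 where c3: "poly (poly (poly ?P [:[:[:c1:]:]:]) [:[:c2:]:]) [:c3:] \<noteq> 0"
    using poly_nonzero_const[of _ "\<lambda>c. [:c:]"] by (auto simp: inj_def)
  then obtain c4 where c4: "poly (poly (poly (poly ?P [:[:[:c1:]:]:]) [:[:c2:]:]) [:c3:]) c4 \<noteq> 0"
    using poly_nonzero_const[of _ "\<lambda>c. c"] by (auto simp: inj_def)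
  let ?a = "\<lambda>i::4. if i = 1 then c1 else if i = 2 then c2 else if i = 3 then c3 else c4"
  let ?E = "\<lambda>P. poly (poly (poly (poly P [:[:[:c1:]:]:]) [:[:c2:]:]) [:c3:]) c4"
  have E: "comm_ring_hom ?E" by unfold_locales auto
  have "?E ?P = ev (\<lambda>c. c) ?a f"
    unfolding to_poly_def ev_comp[OF pconst4_hom E]
    by (rule arg_cong2[where f = "\<lambda>h a. ev h a f"]) (auto simp: fun_eq_iff)
  thus ?thesis using c4 unfolding peval_ev by (intro exI[of _ ?a]) simp
qed

section \<open>Moving general planes and their line of intersection\<close>

definition dot :: "'k::field ^ 4 \<Rightarrow> (4 \<Rightarrow> 'k) \<Rightarrow> 'k" where
  "dot a v = a $ 1 * v 1 + a $ 2 * v 2 + a $ 3 * v 3 + a $ 4 * v 4"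

lemma peval_linform_dot: "peval (linform a) v = dot a v"
  by (simp add: peval_linform sum_4 dot_def)

text \<open>The cross product of the last three coordinates: when \<open>p\<^sub>1 = 1\<close> and the planes \<open>a\<close> and \<open>b\<close>
  pass through \<open>p\<close>, they meet in the line through \<open>p\<close> with direction \<open>cross3 a b\<close>.\<close>

definition cross3 :: "'k::field ^ 4 \<Rightarrow> 'k ^ 4 \<Rightarrow> 4 \<Rightarrow> 'k" where
  "cross3 a b i = (if i = 1 then 0 else if i = 2 then a $ 3 * b $ 4 - a $ 4 * b $ 3
     else if i = 3 then a $ 4 * b $ 2 - a $ 2 * b $ 4 else a $ 2 * b $ 3 - a $ 3 * b $ 2)"

lemma dot_cross3: "dot a (cross3 a b) = 0" "dot b (cross3 a b) = 0"
  by (simp_all add: dot_def cross3_def algebra_simps)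

text \<open>A general pair has the point \<open>n\<close> at \<open>x_1 = 0\<close> on both planes.
  This point is moved towards a point \<open>q\<close> off \<open>F = 0\<close>, and the planes are
  made to follow it along a curve that starts in \<open>U\<close>.\<close>

lemma open_through_point:
  fixes U :: "(4 + 4 \<Rightarrow> 'k::field_char_0) set"
  assumes U: "zariski_open U" "U \<noteq> {}" and F: "F \<in> homog t" "F \<noteq> 0"
  obtains a b p where "case_sum (($) a) (($) b) \<in> U" "p 1 = 1" "peval F p \<noteq> 0" "dot a p = 0" "dot b p = 0"
proof -
  \<comment> \<open>\<open>g\<close> is the fourth coordinate of \<open>cross3\<close>, made nonzero
    so that it can serve as a denominator.\<close>
  define g where "g = (mvar (Inl 2) * mvar (Inr 3) - mvar (Inl 3) * mvar (Inr 2) :: (4 + 4, 'k) mpoly)"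
  let ?W = "{x. peval g x \<noteq> 0}"
  have g: "peval g x = x (Inl 2) * x (Inr 3) - x (Inl 3) * x (Inr 2)" for x by (simp add: g_def peval_simps)
  have "?W = {x. \<exists>h\<in>{g}. peval h x \<noteq> 0}" by simp
  hence W1: "zariski_open ?W" unfolding zariski_open_def by (rule exI)
  have "case_sum (\<lambda>i. if i = 2 then 1 else 0) (\<lambda>i. if i = 3 then 1 else 0) \<in> ?W" by (simp add: g)
  hence W2: "?W \<noteq> {}" by blast
  obtain x where x: "x \<in> U" "x \<in> ?W" using zariski_open_Int(2)[OF U W1 W2] by blast
  obtain a b where ab: "x = case_sum (($) a) (($) b)" using case_sum_vec[of x] by (elim exE)
  define n where "n = cross3 a b"
  have n4: "n 4 \<noteq> 0" using x(2) by (simp add: g ab n_def cross3_def)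
  have an: "dot a n = 0" "dot b n = 0" unfolding n_def by (rule dot_cross3)+
  have "F * mvar 1 \<noteq> 0"
  proof -
    have "peval (mvar 1) (\<lambda>i::4. 1) = (1::'k)" by (rule peval_mvar)
    hence "(mvar 1 :: 'k R) \<noteq> 0" using peval_zero[of "\<lambda>i::4. 1 :: 'k"] by auto
    thus ?thesis using F(2) by simp
  qed
  then obtain q where "peval (F * mvar 1) q \<noteq> 0" using ex_peval_nonzero by blast
  hence q: "peval F q \<noteq> 0" "q 1 \<noteq> 0" by (auto simp: peval_simps)
  define P where "P = (\<lambda>i. [:n i, q i - n i:])"
  define C where "C = smult (1 / n 4) (P 4)"
  define dP where "dP = (\<lambda>a::'k^4. [:a $ 1:] * P 1 + [:a $ 2:] * P 2 + [:a $ 3:] * P 3 + [:a $ 4:] * P 4)"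
  \<comment> \<open>Correcting only the fourth coefficient gives planes through \<open>P\<close> for
    every parameter. At parameter 0 the factor \<open>C\<close> is 1 and the correction vanishes, so
    the original planes are recovered.\<close>
  define A where "A = (\<lambda>(a::'k^4) i. C * [:a $ i:] - dP a * [:if i = 4 then 1 / n 4 else 0:])"
  have dP: "poly (dP a) s = dot a (\<lambda>i. poly (P i) s)" for a s by (simp add: dP_def dot_def)
  have C0: "poly C 0 = 1" using n4 by (simp add: C_def P_def)
  have A0: "poly (A a i) 0 = a $ i" if "dot a n = 0" for a i
  proof -
    have "poly (dP a) 0 = 0" using that by (simp add: dP P_def)
    thus ?thesis by (simp add: A_def C0)
  qed
  define \<Gamma> where "\<Gamma> = case_sum (A a) (A b)"
  have "(\<lambda>v. poly (\<Gamma> v) 0) = x"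
    unfolding ab \<Gamma>_def by (rule ext) (simp add: A0 an split: sum.split)
  hence fin1: "finite {s. (\<lambda>v. poly (\<Gamma> v) s) \<notin> U}" using zariski_open_curve[OF U(1), of \<Gamma> 0] x(1) by simp
  let ?W' = "{v. peval (F * mvar 1) v \<noteq> 0}"
  have "?W' = {v. \<exists>h\<in>{F * mvar 1}. peval h v \<noteq> 0}" by simp
  hence W': "zariski_open ?W'" unfolding zariski_open_def by (rule exI)
  have "(\<lambda>v. poly (P v) 1) \<in> ?W'" using q by (simp add: P_def peval_simps)
  hence fin2: "finite {s. (\<lambda>v. poly (P v) s) \<notin> ?W'}" by (rule zariski_open_curve[OF W'])
  have "finite ({s. (\<lambda>v. poly (\<Gamma> v) s) \<notin> U} \<union> {s. (\<lambda>v. poly (P v) s) \<notin> ?W'})" using fin1 fin2 by simp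
  then obtain s where "s \<notin> {s. (\<lambda>v. poly (\<Gamma> v) s) \<notin> U} \<union> {s. (\<lambda>v. poly (P v) s) \<notin> ?W'}"
    using ex_new_if_finite[OF infinite_UNIV_char_0] by blast
  hence s: "(\<lambda>v. poly (\<Gamma> v) s) \<in> U" "peval F (\<lambda>v. poly (P v) s) \<noteq> 0" "poly (P 1) s \<noteq> 0"
    by (auto simp: peval_simps)
  define r where "r = (\<lambda>v. poly (P v) s)"
  have dot0: "dot (\<chi> i. poly (A a i) s) r = 0" for a
  proof -
    have "dot (\<chi> i. poly (A a i) s) r = poly C s * dot a r - poly (dP a) s * (r 4 / n 4)"
      by (simp add: dot_def A_def algebra_simps)
    also have "poly C s = r 4 / n 4" by (simp add: C_def r_def)
    also have "poly (dP a) s = dot a r" by (simp add: dP r_def)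
    finally show ?thesis by simp
  qed
  \<comment> \<open>Rescaling to first coordinate 1 affects neither incidence with the planes nor
    nonvanishing of the form.\<close>
  define p where "p = (\<lambda>i. (1 / r 1) * r i)"
  have r1: "r 1 \<noteq> 0" using s(3) by (simp add: r_def)
  show thesis
  proof (rule that)
    have "case_sum (($) (\<chi> i. poly (A a i) s)) (($) (\<chi> i. poly (A b i) s)) = (\<lambda>v. poly (\<Gamma> v) s)"
      by (rule ext) (simp add: \<Gamma>_def split: sum.split)
    thus "case_sum (($) (\<chi> i. poly (A a i) s)) (($) (\<chi> i. poly (A b i) s)) \<in> U" using s(1) by simp
    show "p 1 = 1" using r1 by (simp add: p_def)
    show "peval F p \<noteq> 0" unfolding p_def peval_scale[OF F(1)] using s(2) r1 by (simp add: r_def)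
    have "dot a p = (1 / r 1) * dot a r" for a by (simp add: p_def dot_def algebra_simps)
    thus "dot (\<chi> i. poly (A a i) s) p = 0" "dot (\<chi> i. poly (A b i) s) p = 0" using dot0 by simp_all
  qed
qed

text \<open>The point \<open>p\<close> stays fixed. The pair is joined to another pair of planes
  through \<open>p\<close> whose direction avoids \<open>Q = 0\<close>, and a general member of the
  joining family satisfies both conditions.\<close>

lemma open_direction:
  fixes U :: "(4 + 4 \<Rightarrow> 'k::field_char_0) set"
  assumes U: "zariski_open U" "case_sum (($) a) (($) b) \<in> U"
    and p: "p 1 = 1" "dot a p = 0" "dot b p = 0"
    and Q: "Q \<noteq> 0" "\<And>c \<beta>. peval Q (\<lambda>i. c * p i + \<beta> i) = peval Q \<beta>"
  obtains a' b' where "case_sum (($) a') (($) b') \<in> U" "dot a' p = 0" "dot b' p = 0"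
    "cross3 a' b' 4 \<noteq> 0" "peval Q (cross3 a' b') \<noteq> 0"
proof -
  let ?y = "mvar 4 - const (p 4) * mvar 1 :: 'k R"
  have y: "peval ?y v = v 4 - p 4 * v 1" for v by (simp add: peval_simps)
  have "?y \<noteq> 0"
  proof
    assume "?y = 0"
    thus False using y[of "\<lambda>i. if i = 4 then 1 else 0"] by (simp add: peval_zero)
  qed
  hence "Q * ?y \<noteq> 0" using Q(1) by simp
  then obtain w where w: "peval (Q * ?y) w \<noteq> 0" using ex_peval_nonzero by blast
  \<comment> \<open>Translation by a multiple of \<open>p\<close> puts the vector at
    \<open>x_1 = 0\<close> without changing the value of \<open>Q\<close>; the factor
    \<open>?y\<close> guarantees that the fourth coordinate is nonzero.\<close>
  define \<beta> where "\<beta> = (\<lambda>i. (- w 1) * p i + w i)"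
  have \<beta>: "peval Q \<beta> \<noteq> 0" "\<beta> 4 \<noteq> 0" "\<beta> 1 = 0"
    using w Q(2)[of "- w 1" w] p(1) unfolding \<beta>_def peval_mult y by auto
  \<comment> \<open>The last three coefficients are chosen so that \<open>cross3 a0 b0\<close> is
    \<open>\<beta>\<close>.\<close>
  define a0 :: "'k ^ 4" where "a0 = (\<chi> i. if i = 2 then 1 else if i = 4 then - \<beta> 2 / \<beta> 4 else 0)"
  define b0 :: "'k ^ 4" where "b0 = (\<chi> i. if i = 3 then \<beta> 4 else if i = 4 then - \<beta> 3 else 0)"
  define A where "A = (\<lambda>(a0::'k^4) (a::'k^4) i. [:a0 $ i, a $ i - a0 $ i:])"
  \<comment> \<open>The first coefficient is determined by passage through \<open>p\<close>, since
    \<open>p 1 = 1\<close>. As \<open>cross3\<close> ignores it, \<open>X\<close> can be formed from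
    \<open>A\<close>.\<close>
  define A' where "A' = (\<lambda>a0 a i. if i = 1 then - ([:p 2:] * A a0 a 2 + [:p 3:] * A a0 a 3 + [:p 4:] * A a0 a 4) else A a0 a i)"
  define \<Gamma> where "\<Gamma> = case_sum (A' a0 a) (A' b0 b)"
  define X where "X = (\<lambda>i::4. if i = 1 then 0 else if i = 2 then A a0 a 3 * A b0 b 4 - A a0 a 4 * A b0 b 3
     else if i = 3 then A a0 a 4 * A b0 b 2 - A a0 a 2 * A b0 b 4 else A a0 a 2 * A b0 b 3 - A a0 a 3 * A b0 b 2)"
  have A'1: "poly (A' a0 a i) 1 = a $ i" if "dot a p = 0" for a0 a i
  proof (cases "i = 1")
    case True
    have "a $ 1 = - (p 2 * a $ 2 + p 3 * a $ 3 + p 4 * a $ 4)"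
      using that p(1) by (simp add: dot_def eq_neg_iff_add_eq_0 algebra_simps)
    thus ?thesis using True by (simp add: A'_def A_def algebra_simps)
  qed (simp add: A'_def A_def)
  have "(\<lambda>v. poly (\<Gamma> v) 1) = case_sum (($) a) (($) b)"
    unfolding \<Gamma>_def by (rule ext) (simp add: A'1 p split: sum.split)
  hence fin1: "finite {s. (\<lambda>v. poly (\<Gamma> v) s) \<notin> U}" using zariski_open_curve[OF U(1), of \<Gamma> 1] U(2) by simp
  let ?W' = "{v. peval (Q * mvar 4) v \<noteq> 0}"
  have "?W' = {v. \<exists>h\<in>{Q * mvar 4}. peval h v \<noteq> 0}" by simp
  hence W': "zariski_open ?W'" unfolding zariski_open_def by (rule exI)
  have "(\<lambda>v. poly (X v) 0) = \<beta>"
  proof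
    fix v :: 4
    consider "v = 1" | "v = 2" | "v = 3" | "v = 4" using four_cases by blast
    thus "poly (X v) 0 = \<beta> v" by cases (simp_all add: X_def A_def a0_def b0_def \<beta>)
  qed
  hence "(\<lambda>v. poly (X v) 0) \<in> ?W'" using \<beta> by (simp add: peval_mult peval_mvar)
  hence fin2: "finite {s. (\<lambda>v. poly (X v) s) \<notin> ?W'}" by (rule zariski_open_curve[OF W'])
  have "finite ({s. (\<lambda>v. poly (\<Gamma> v) s) \<notin> U} \<union> {s. (\<lambda>v. poly (X v) s) \<notin> ?W'})" using fin1 fin2 by simp
  then obtain s where "s \<notin> {s. (\<lambda>v. poly (\<Gamma> v) s) \<notin> U} \<union> {s. (\<lambda>v. poly (X v) s) \<notin> ?W'}"
    using ex_new_if_finite[OF infinite_UNIV_char_0] by blast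
  hence s: "(\<lambda>v. poly (\<Gamma> v) s) \<in> U" "peval Q (\<lambda>v. poly (X v) s) \<noteq> 0" "poly (X 4) s \<noteq> 0"
    by (auto simp: peval_mult peval_mvar)
  let ?a = "\<chi> i. poly (A' a0 a i) s" and ?b = "\<chi> i. poly (A' b0 b i) s"
  have X: "cross3 ?a ?b = (\<lambda>v. poly (X v) s)"
    by (rule ext) (simp add: cross3_def X_def A'_def)
  show thesis
  proof (rule that)
    have "case_sum (($) ?a) (($) ?b) = (\<lambda>v. poly (\<Gamma> v) s)"
      by (rule ext) (simp add: \<Gamma>_def split: sum.split)
    thus "case_sum (($) ?a) (($) ?b) \<in> U" using s(1) by simp
    show "dot ?a p = 0" "dot ?b p = 0" by (simp_all add: dot_def A'_def p(1) algebra_simps)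
    show "cross3 ?a ?b 4 \<noteq> 0" "peval Q (cross3 ?a ?b) \<noteq> 0" unfolding X using s(2,3) by simp_all
  qed
qed

section \<open>Restriction to a line\<close>

text \<open>The line through \<open>p\<close> and \<open>\<beta>\<close> in an affine coordinate
  whose point at infinity is \<open>p\<close>.\<close>

definition restrict_line :: "(4 \<Rightarrow> 'k) \<Rightarrow> (4 \<Rightarrow> 'k) \<Rightarrow> 'k::field R \<Rightarrow> 'k poly" where
  "restrict_line p \<beta> = ev (\<lambda>c. [:c:]) (\<lambda>i. [:\<beta> i, p i:])"

lemma restrict_line_hom: "comm_ring_hom (restrict_line p \<beta>)"
  unfolding restrict_line_def by (rule ev_hom[OF pconst_hom])

lemma poly_restrict_line: "poly (restrict_line p \<beta> f) x = peval f (\<lambda>i. x * p i + \<beta> i)"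
proof -
  have "(\<lambda>i. x * p i + \<beta> i) = (\<lambda>i. poly [:\<beta> i, p i:] x)" by (simp add: algebra_simps)
  thus ?thesis using peval_curve[of f "\<lambda>i. [:\<beta> i, p i:]" x] by (simp add: restrict_line_def)
qed

lemma degree_restrict_line:
  assumes "f \<in> homog t" shows "degree (restrict_line p \<beta> f) \<le> t"
  unfolding restrict_line_def ev_def
proof (rule degree_sum_le)
  fix m assume m: "m \<in> Poly_Mapping.keys f"
  have "degree ([:Poly_Mapping.lookup f m:] * (\<Prod>i\<in>UNIV. [:\<beta> i, p i:] ^ Poly_Mapping.lookup m i))
      \<le> degree (\<Prod>i\<in>UNIV. [:\<beta> i, p i:] ^ Poly_Mapping.lookup m i)"
    by simp
  also have "\<dots> \<le> (\<Sum>i\<in>UNIV. degree ([:\<beta> i, p i:] ^ Poly_Mapping.lookup m i))"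
    using degree_prod_sum_le[of UNIV "\<lambda>i. [:\<beta> i, p i:] ^ Poly_Mapping.lookup m i"] by (simp add: o_def)
  also have "\<dots> \<le> (\<Sum>i\<in>UNIV. Poly_Mapping.lookup m i)"
  proof (rule sum_mono)
    fix i
    have "degree ([:\<beta> i, p i:] ^ Poly_Mapping.lookup m i) \<le> degree [:\<beta> i, p i:] * Poly_Mapping.lookup m i"
      by (rule degree_power_le)
    also have "\<dots> \<le> 1 * Poly_Mapping.lookup m i" by (rule mult_right_mono) auto
    finally show "degree ([:\<beta> i, p i:] ^ Poly_Mapping.lookup m i) \<le> Poly_Mapping.lookup m i" by simp
  qed
  also have "\<dots> = t" using assms m by (simp add: homog_iff mdeg_def)
  finally show "degree ([:Poly_Mapping.lookup f m:] * (\<Prod>i\<in>UNIV. [:\<beta> i, p i:] ^ Poly_Mapping.lookup m i)) \<le> t" .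
qed simp

lemma ideal_mult_cong:
  assumes S: "ideal.subspace S" and "x - x' \<in> S" "y - y' \<in> (S :: 'a::comm_ring_1 set)"
  shows "x * y - x' * y' \<in> S"
proof -
  have "x * y - x' * y' = y * (x - x') + x' * (y - y')" by (simp add: algebra_simps)
  thus ?thesis using assms by (simp add: ideal.subspace_add ideal.subspace_scale)
qed

lemma ev_cong_mod:
  fixes S :: "('v::finite, 'k::field) mpoly set"
  assumes S: "ideal.subspace S" and ab: "\<And>i. a i - b i \<in> S"
  shows "ev const a f - ev const b f \<in> S"
proof (induction f rule: mpoly_induct)
  case zero
  show ?case using ideal.subspace_0[OF S] by (simp add: ev_def)
next
  case (single m c)
  have pow: "a i ^ n - b i ^ n \<in> S" for i n
    by (induction n) (simp_all add: ideal.subspace_0[OF S] ideal_mult_cong[OF S ab])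
  have "(\<Prod>i\<in>A. a i ^ Poly_Mapping.lookup m i) - (\<Prod>i\<in>A. b i ^ Poly_Mapping.lookup m i) \<in> S" if "finite A" for A
    using that by induction (simp_all add: ideal.subspace_0[OF S] ideal_mult_cong[OF S pow])
  from ideal.subspace_scale[OF S this[OF finite], of "const c"]
  show ?case by (simp add: ev_single[OF const_hom] right_diff_distrib)
next
  case (add p q)
  from ideal.subspace_add[OF S this] show ?case by (simp add: ev_add[OF const_hom] algebra_simps)
qed

section \<open>Forms on the line cut out by two planes\<close>

locale line =
  fixes a b :: "'k::field_char_0 ^ 4" and p :: "4 \<Rightarrow> 'k"
  assumes p1: "p 1 = 1" and ap: "dot a p = 0" and bp: "dot b p = 0" and n4: "cross3 a b 4 \<noteq> 0"
begin

abbreviation "\<beta> \<equiv> cross3 a b"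
abbreviation "\<rho> \<equiv> restrict_line p \<beta>"

text \<open>The homogenising coordinate: this linear form vanishes at \<open>p\<close> and equals 1
  on the affine parametrisation.\<close>

definition \<eta> :: "'k R" where
  "\<eta> = const (1 / \<beta> 4) * (mvar 4 - const (p 4) * mvar 1)"

sublocale \<rho>: comm_ring_hom \<rho> by (rule restrict_line_hom)

lemma \<rho>_const: "\<rho> (const c) = [:c:]" and \<rho>_mvar: "\<rho> (mvar i) = [:\<beta> i, p i:]"
  unfolding restrict_line_def by (rule ev_const[OF pconst_hom] ev_mvar[OF pconst_hom])+

lemma \<beta>1: "\<beta> 1 = 0" by (simp add: cross3_def)

lemma \<rho>_x: "\<rho> (mvar 1) = [:0, 1:]"
  by (simp add: \<rho>_mvar \<beta>1 p1)

lemma peval_\<eta>: "peval \<eta> v = (v 4 - p 4 * v 1) / \<beta> 4"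
  by (simp add: \<eta>_def peval_simps)

lemma \<eta>_homog: "\<eta> \<in> homog 1"
  unfolding \<eta>_def by (intro homog_const_mult homog_diff mvar_homog)

lemma poly_eqI_char_0: "(\<And>x. poly f x = poly g x) \<Longrightarrow> f = (g :: 'k poly)"
  using poly_eq_poly_eq_iff by (metis ext)

lemma \<rho>_\<eta>: "\<rho> \<eta> = 1"
  by (rule poly_eqI_char_0) (use n4 in \<open>simp add: poly_restrict_line peval_\<eta> p1 \<beta>1 field_simps\<close>)

lemma \<rho>_linform: "dot c p = 0 \<Longrightarrow> dot c \<beta> = 0 \<Longrightarrow> \<rho> (linform c) = 0"
proof (rule poly_eqI_char_0)
  fix x assume c: "dot c p = 0" "dot c \<beta> = 0"
  have "dot c (\<lambda>i. x * p i + \<beta> i) = x * dot c p + dot c \<beta>"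
    by (simp add: dot_def algebra_simps)
  thus "poly (\<rho> (linform c)) x = poly 0 x"
    using c by (simp add: poly_restrict_line peval_linform_dot)
qed

lemma \<rho>_L: "\<rho> (linform a) = 0" "\<rho> (linform b) = 0"
  by (simp_all add: \<rho>_linform ap bp dot_cross3)

lemma const_mult: "const (c * d) = (const c * const d :: 'k R)" and const_add: "const (c + d) = (const c + const d :: 'k R)"
  and const_diff: "const (c - d) = (const c - const d :: 'k R)" and const_uminus: "const (- c) = (- const c :: 'k R)"
  and const_1: "const 1 = (1 :: 'k R)" and const_0: "const 0 = (0 :: 'k R)"
proof -
  interpret comm_ring_hom "const :: 'k \<Rightarrow> 'k R" by (rule const_hom)
  show "const (c * d) = (const c * const d :: 'k R)" "const (c + d) = (const c + const d :: 'k R)"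
    "const (c - d) = (const c - const d :: 'k R)" "const (- c) = (- const c :: 'k R)"
    "const 1 = (1 :: 'k R)" "const 0 = (0 :: 'k R)"
    by (simp_all add: hom_mult hom_add hom_minus hom_uminus)
qed

lemma linform_expand:
  assumes "dot c p = 0"
  shows "linform c = (\<Sum>i\<in>{2, 3, 4}. const (c $ i) * (mvar i - const (p i) * mvar 1))"
proof -
  have "c $ 1 = - (c $ 2 * p 2 + c $ 3 * p 3 + c $ 4 * p 4)"
    using assms p1 by (simp add: dot_def eq_neg_iff_add_eq_0 algebra_simps)
  hence c1: "const (c $ 1) = (- (const (c $ 2) * const (p 2) + const (c $ 3) * const (p 3) + const (c $ 4) * const (p 4)) :: 'k R)"
    by (simp only: const_mult const_add const_uminus)
  show ?thesis
    unfolding linform_def pscale_def sum_4 c1 by (simp add: algebra_simps)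
qed

abbreviation "M \<equiv> {linform a, linform b}"

text \<open>On the line, \<open>x_1\<close> and \<open>\<eta>\<close> are homogeneous coordinates.
  The remaining cases are Cramer's rule.\<close>

lemma coordinate_mod: "mvar i - (const (p i) * mvar 1 + const (\<beta> i) * \<eta>) \<in> ideal_gen M"
proof -
  note Ms = ideal.subspace_span[of M]
  let ?y = "\<lambda>i. mvar i - const (p i) * mvar 1 :: 'k R"
  let ?\<kappa> = "const (1 / \<beta> 4) :: 'k R"
  have \<kappa>: "?\<kappa> * const (\<beta> 4) = 1" using n4 by (simp add: const_mult[symmetric] const_1)
  have L: "linform a \<in> ideal_gen M" "linform b \<in> ideal_gen M" by (simp_all add: ideal.span_base)
  have comb: "?\<kappa> * (const c * linform a + const d * linform b) \<in> ideal_gen M" for c d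
    by (intro ideal.span_scale ideal.span_add L)
  consider "i = 1" | "i = 2" | "i = 3" | "i = 4" using four_cases by blast
  thus ?thesis
  proof cases
    case 1 thus ?thesis by (simp add: p1 \<beta>1 const_0 const_1 ideal.span_zero)
  next
    case 4
    have "const (\<beta> 4) * \<eta> = (?\<kappa> * const (\<beta> 4)) * ?y 4" unfolding \<eta>_def by (simp add: algebra_simps)
    hence "const (\<beta> 4) * \<eta> = ?y 4" unfolding \<kappa> by simp
    thus ?thesis using 4 by (simp add: ideal.span_zero)
  next
    case 2
    \<comment> \<open>This combination of the two planes eliminates \<open>?y 3\<close>.\<close>
    have "const (\<beta> 4) * ?y 2 - const (\<beta> 2) * ?y 4 = const (b $ 3) * linform a + const (- a $ 3) * linform b"
      unfolding linform_expand[OF ap] linform_expand[OF bp]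
      by (simp add: cross3_def const_mult const_diff const_uminus algebra_simps)
    hence "?\<kappa> * (const (\<beta> 4) * ?y 2 - const (\<beta> 2) * ?y 4) \<in> ideal_gen M" using comb by simp
    also have "?\<kappa> * (const (\<beta> 4) * ?y 2 - const (\<beta> 2) * ?y 4) = (?\<kappa> * const (\<beta> 4)) * ?y 2 - const (\<beta> 2) * \<eta>"
      unfolding \<eta>_def by (simp add: algebra_simps)
    finally show ?thesis using 2 unfolding \<kappa> by (simp add: algebra_simps)
  next
    case 3
    have "const (\<beta> 4) * ?y 3 - const (\<beta> 3) * ?y 4 = const (- b $ 2) * linform a + const (a $ 2) * linform b"
      unfolding linform_expand[OF ap] linform_expand[OF bp]
      by (simp add: cross3_def const_mult const_diff const_uminus algebra_simps)
    hence "?\<kappa> * (const (\<beta> 4) * ?y 3 - const (\<beta> 3) * ?y 4) \<in> ideal_gen M" using comb by simp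
    also have "?\<kappa> * (const (\<beta> 4) * ?y 3 - const (\<beta> 3) * ?y 4) = (?\<kappa> * const (\<beta> 4)) * ?y 3 - const (\<beta> 3) * \<eta>"
      unfolding \<eta>_def by (simp add: algebra_simps)
    finally show ?thesis using 3 unfolding \<kappa> by (simp add: algebra_simps)
  qed
qed

lemma \<eta>_nonzero: "\<eta> \<noteq> 0"
  using \<rho>_\<eta> by auto

text \<open>Modulo the two planes, \<open>f\<close> equals its rewriting in \<open>x_1\<close> and
  \<open>\<eta>\<close>, which is \<open>\<eta> ^ t\<close> times the value of
  \<open>\<rho> f\<close> at \<open>x_1 / \<eta>\<close>. This vanishes wherever
  \<open>\<eta>\<close> is nonzero, hence identically.\<close>

lemma kernel:
  assumes f: "f \<in> homog t" "\<rho> f = 0"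
  shows "f \<in> ideal_gen M"
proof -
  let ?\<chi> = "ev const (\<lambda>i. const (p i) * mvar 1 + const (\<beta> i) * \<eta>) f"
  have "?\<chi> = 0"
  proof (rule ccontr)
    assume "?\<chi> \<noteq> 0"
    hence "?\<chi> * \<eta> \<noteq> 0" using \<eta>_nonzero by simp
    then obtain v where "peval (?\<chi> * \<eta>) v \<noteq> 0" using ex_peval_nonzero by blast
    hence v: "peval ?\<chi> v \<noteq> 0" "peval \<eta> v \<noteq> 0" by (auto simp: peval_mult)
    have "peval ?\<chi> v = ev (\<lambda>c. peval (const c) v) (\<lambda>i. peval (const (p i) * mvar 1 + const (\<beta> i) * \<eta>) v) f"
      by (rule ev_comp[OF const_hom peval_hom])
    also have "\<dots> = peval f (\<lambda>i. p i * v 1 + \<beta> i * peval \<eta> v)"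
      unfolding peval_ev[of f] by (simp add: peval_simps)
    also have "(\<lambda>i. p i * v 1 + \<beta> i * peval \<eta> v) = (\<lambda>i. peval \<eta> v * ((v 1 / peval \<eta> v) * p i + \<beta> i))"
      using v(2) by (simp add: fun_eq_iff field_simps)
    also have "peval f \<dots> = peval \<eta> v ^ t * poly (\<rho> f) (v 1 / peval \<eta> v)"
      unfolding peval_scale[OF f(1)] poly_restrict_line ..
    finally show False using v(1) f(2) by simp
  qed
  moreover have "ev const mvar f - ?\<chi> \<in> ideal_gen M"
    by (rule ev_cong_mod[OF ideal.subspace_span coordinate_mod])
  ultimately show ?thesis by (simp add: ev_id)
qed

text \<open>Homogenise the polynomial with \<open>x_1\<close> and \<open>\<eta>\<close>.\<close>

lemma surjective:
  assumes "degree q \<le> t" shows "\<exists>g\<in>homog t. \<rho> g = q"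
proof (intro bexI)
  let ?g = "\<Sum>k\<le>t. const (coeff q k) * (mvar 1 ^ k * \<eta> ^ (t - k))"
  show "?g \<in> homog t"
  proof (rule homog_sum, rule homog_const_mult)
    fix k assume "k \<in> {..t}"
    moreover have "mvar 1 ^ k * \<eta> ^ (t - k) \<in> homog (1 * k + 1 * (t - k))"
      by (intro homog_mult homog_power mvar_homog \<eta>_homog)
    ultimately show "mvar 1 ^ k * \<eta> ^ (t - k) \<in> homog t" by simp
  qed
  have "\<rho> ?g = (\<Sum>k\<le>t. monom (coeff q k) k)"
    by (simp add: \<rho>.hom_sum \<rho>.hom_mult \<rho>.hom_power \<rho>_\<eta> \<rho>_x \<rho>_const monom_altdef)
  also have "\<dots> = q" by (rule poly_as_sum_of_monoms'[OF assms])
  finally show "\<rho> ?g = q" .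
qed

text \<open>With \<open>surjective\<close>, this identifies the quotient in degree \<open>t\<close>
  with the polynomials of degree at most \<open>t\<close> modulo the restrictions of forms in
  \<open>I\<close>.\<close>

lemma mem_iff:
  assumes I: "homogeneous I" and f: "f \<in> homog t"
  shows "f \<in> ideal_gen (I \<union> M) \<longleftrightarrow> (\<exists>i\<in>I \<inter> homog t. \<rho> f = \<rho> i)"
proof
  assume "f \<in> ideal_gen (I \<union> M)"
  hence "f \<in> ideal_gen (ideal_gen (I \<union> {linform a}) \<union> {linform b})" by (simp only: ideal_gen_Un_Un)
  then obtain j h where j: "j \<in> ideal_gen (I \<union> {linform a})" "f = j + linform b * h"
    unfolding mem_ideal_gen_Un[OF ideal.subspace_span] by (elim bexE exE)
  then obtain i g where i: "i \<in> I" "j = i + linform a * g"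
    unfolding mem_ideal_gen_Un[OF homogeneousD(1)[OF I]] by (elim bexE exE)
  have z: "\<rho> (hc t (linform c * x)) = 0" if "\<rho> (linform c) = 0" for c x
    using that by (simp add: hc_mult[OF linform_homog] \<rho>.hom_mult)
  have "f = hc t i + hc t (linform a * g) + hc t (linform b * h)"
    using hc_id[OF f] unfolding j(2) i(2) hc_add by simp
  hence "\<rho> f = \<rho> (hc t i)" using z[OF \<rho>_L(1)] z[OF \<rho>_L(2)] by (simp add: \<rho>.hom_add)
  moreover have "hc t i \<in> I \<inter> homog t" using homogeneousD(2)[OF I i(1)] hc_homog by simp
  ultimately show "\<exists>i\<in>I \<inter> homog t. \<rho> f = \<rho> i" by (rule bexI)
next
  assume "\<exists>i\<in>I \<inter> homog t. \<rho> f = \<rho> i"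
  then obtain i where i: "i \<in> I" "i \<in> homog t" "\<rho> f = \<rho> i" by blast
  have "f - i \<in> ideal_gen M"
    by (rule kernel[OF homog_diff[OF f i(2)]]) (simp add: \<rho>.hom_minus i(3))
  hence "f - i \<in> ideal_gen (I \<union> M)" using ideal.span_mono[of M "I \<union> M"] by blast
  moreover have "i \<in> ideal_gen (I \<union> M)" using i(1) by (simp add: ideal.span_base)
  ultimately have "f - i + i \<in> ideal_gen (I \<union> M)" by (rule ideal.span_add)
  thus "f \<in> ideal_gen (I \<union> M)" by simp
qed

text \<open>Modulo the two linear forms and \<open>\<eta>\<close>, every form of degree \<open>t\<close> is a multiple of \<open>x\<^sub>1\<^sup>t\<close>, and
  a form not vanishing at \<open>p\<close> is a nonzero one.\<close>

lemma hilb_section_0: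
  assumes I: "homogeneous I" and F: "F \<in> I" "F \<in> homog e" "peval F p \<noteq> 0"
  shows "hilb (ideal_gen (ideal_gen (I \<union> M) \<union> {\<eta>})) (Suc e) = 0"
proof -
  let ?J = "ideal_gen (ideal_gen (I \<union> M) \<union> {\<eta>})"
  note Js = ideal.subspace_span[of "ideal_gen (I \<union> M) \<union> {\<eta>}"]
  have sub: "ideal_gen (I \<union> M) \<subseteq> ?J" using ideal.span_superset[of "ideal_gen (I \<union> M) \<union> {\<eta>}"] by blast
  have gen: "I \<union> M \<subseteq> ideal_gen (I \<union> M)" by (rule ideal.span_superset)
  have MJ: "ideal_gen M \<subseteq> ?J"
    by (rule ideal.span_minimal[OF _ Js]) (use gen sub in blast)
  have IJ: "I \<subseteq> ?J" using gen sub by blast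
  have \<eta>J: "\<eta> \<in> ?J" by (simp add: ideal.span_base)
  have x: "mvar i - const (p i) * mvar 1 \<in> ?J" for i
  proof -
    have "mvar i - (const (p i) * mvar 1 + const (\<beta> i) * \<eta>) \<in> ?J" using coordinate_mod MJ by blast
    from ideal.subspace_add[OF Js this ideal.subspace_scale[OF Js \<eta>J, of "const (\<beta> i)"]]
    show ?thesis by simp
  qed
  define x :: "'k R" where "x = mvar 1"
  have red: "f - x ^ t * const (peval f p) \<in> ?J" if f: "f \<in> homog t" for f t
  proof -
    have "ev const (\<lambda>i. const (p i) * x) f = ev const (\<lambda>i. x * const (p i)) f"
      by (simp only: mult.commute)
    also have "\<dots> = x ^ t * ev const (\<lambda>i. const (p i)) f"
      by (rule ev_scale[OF const_hom f])
    also have "ev const (\<lambda>i. const (p i)) f = (const (peval f p) :: 'k R)"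
      unfolding peval_ev by (rule ev_comp[OF id_hom const_hom, symmetric])
    finally have "ev const (\<lambda>i. const (p i) * x) f = x ^ t * const (peval f p)" .
    moreover have "ev const mvar f - ev const (\<lambda>i. const (p i) * x) f \<in> ?J"
      unfolding x_def by (rule ev_cong_mod[OF Js x])
    ultimately show ?thesis by (simp only: ev_id)
  qed
  have "F - (F - x ^ e * const (peval F p)) \<in> ?J"
    by (rule ideal.subspace_diff[OF Js subsetD[OF IJ F(1)] red[OF F(2)]])
  from ideal.subspace_scale[OF Js this, of "const (1 / peval F p)"]
  have "(const (1 / peval F p) * const (peval F p)) * x ^ e \<in> ?J" by (simp only: diff_diff_eq2 add_diff_cancel_left' ac_simps)
  hence xe: "x ^ e \<in> ?J" using F(3) by (simp only: const_mult[symmetric] const_1 mult_1_left nonzero_divide_eq_eq divide_self_if times_divide_eq_left if_False)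
  have "f \<in> ?J" if f: "f \<in> homog (Suc e)" for f
  proof -
    have "x * const (peval f p) * x ^ e \<in> ?J" by (rule ideal.subspace_scale[OF Js xe])
    hence "x ^ Suc e * const (peval f p) \<in> ?J" by (simp only: power_Suc ac_simps)
    from ideal.subspace_add[OF Js red[OF f] this] show ?thesis by (simp only: diff_add_cancel)
  qed
  thus ?thesis unfolding hilb_eq_0_iff[OF Js] by (rule subsetI)
qed

lemma peval_kernel:
  assumes "f \<in> ideal_gen M" shows "peval f p = 0"
  using assms
proof (induction rule: ideal.span_induct_alt)
  case (step c x y)
  thus ?case by (auto simp: peval_simps peval_linform_dot ap bp)
qed (simp add: peval_zero)

text \<open>Multiplication by \<open>\<eta>\<close> is onto in degree \<open>e + 1\<close> by
  \<open>hilb_section_0\<close>, so the dimension inequality makes it injective. The space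
  \<open>W\<close> of restrictions is then closed under the shift by the variable and consists of
  multiples of one polynomial.\<close>

lemma restriction_common_factor:
  assumes I: "homogeneous I" and F: "F \<in> I" "F \<in> homog e" "peval F p \<noteq> 0"
    and h0: "hilb (ideal_gen (I \<union> M)) e \<noteq> 0"
    and le: "hilb (ideal_gen (I \<union> M)) e \<le> hilb (ideal_gen (I \<union> M)) (Suc e)"
  shows "\<exists>D. degree D \<ge> 1 \<and> (\<forall>f\<in>I \<inter> homog e. D dvd \<rho> f)"
proof -
  let ?J = "ideal_gen (I \<union> M)"
  note Is = homogeneousD(1)[OF I]
  have J: "homogeneous ?J"
    using homogeneous_Un[OF homogeneous_Un[OF I linform_homog] linform_homog, of a b] by (simp only: ideal_gen_Un_Un)
  note Js = homogeneousD(1)[OF J]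
  have "hilb ?J (Suc e) = hilb (colon ?J \<eta>) e"
    using hilb_add_linear(1)[OF J \<eta>_homog, of e] hilb_section_0[OF I F] by simp
  hence inj: "g \<in> ?J" if "g \<in> homog e" "\<eta> * g \<in> ?J" for g
    using hilb_antimono_eq[OF Js subspace_colon[OF Js] colon_superset[OF Js], of e \<eta> g] le that
    by (simp add: colon_def)
  define W where "W = \<rho> ` (I \<inter> homog e)"
  have W_deg: "degree w \<le> e" if "w \<in> W" for w using that degree_restrict_line unfolding W_def by blast
  have W_0: "0 \<in> W" unfolding W_def using ideal.subspace_0[OF Is] by (intro image_eqI[of _ _ 0]) auto
  have W_add: "v + w \<in> W" if vw: "v \<in> W" "w \<in> W" for v w
  proof -
    obtain f g where "f \<in> I \<inter> homog e" "g \<in> I \<inter> homog e" "v = \<rho> f" "w = \<rho> g" using vw unfolding W_def by blast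
    thus ?thesis unfolding W_def using ideal.subspace_add[OF Is]
      by (intro image_eqI[of _ _ "f + g"]) (auto simp: \<rho>.hom_add homog_add)
  qed
  have W_smult: "smult c w \<in> W" if w: "w \<in> W" for c w
  proof -
    obtain f where "f \<in> I \<inter> homog e" "w = \<rho> f" using w unfolding W_def by blast
    thus ?thesis unfolding W_def using ideal.subspace_scale[OF Is]
      by (intro image_eqI[of _ _ "const c * f"]) (auto simp: \<rho>.hom_mult \<rho>_const homog_const_mult)
  qed
  \<comment> \<open>A form \<open>g\<close> with restriction \<open>X w\<close> exists, and
    \<open>\<eta> * g\<close> restricts to the same polynomial as \<open>mvar 1 * f\<close>. So
    \<open>\<eta> * g\<close> lies in the ideal, and injectivity removes
    \<open>\<eta>\<close>.\<close>
  have W_step: "[:0, 1:] * w \<in> W" if w: "w \<in> W" and d: "degree w < e" for w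
  proof -
    obtain f where f: "f \<in> I" "f \<in> homog e" "w = \<rho> f" using w unfolding W_def by blast
    have "degree ([:0, 1:] * w) \<le> e" using d degree_mult_le[of "[:0, 1:]" w] by simp
    then obtain g where g: "g \<in> homog e" "\<rho> g = [:0, 1:] * w" using surjective by blast
    have h: "\<eta> * g \<in> homog (Suc e)" "mvar 1 * f \<in> homog (Suc e)"
      using homog_mult[OF \<eta>_homog g(1)] homog_mult[OF mvar_homog f(2)] by simp_all
    have "mvar 1 * f \<in> I" by (rule ideal.subspace_scale[OF Is f(1)])
    moreover have "\<rho> (\<eta> * g) = \<rho> (mvar 1 * f)" by (simp add: \<rho>.hom_mult \<rho>_\<eta> g(2) \<rho>_x f(3))
    ultimately have "\<eta> * g \<in> ?J" using mem_iff[OF I h(1)] h(2) by blast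
    hence "g \<in> ?J" by (rule inj[OF g(1)])
    hence "\<exists>i\<in>I \<inter> homog e. \<rho> g = \<rho> i" using mem_iff[OF I g(1)] by blast
    thus ?thesis unfolding W_def g(2) by blast
  qed
  have "\<rho> F \<noteq> 0"
  proof
    assume "\<rho> F = 0"
    hence "F \<in> ideal_gen M" by (rule kernel[OF F(2)])
    thus False using peval_kernel F(3) by simp
  qed
  hence "\<rho> F \<in> W \<and> \<rho> F \<noteq> 0" using F unfolding W_def by blast
  from ex_has_least_nat[of "\<lambda>w. w \<in> W \<and> w \<noteq> 0", OF this, of degree]
  obtain D where D: "D \<in> W" "D \<noteq> 0" and min: "\<And>w. w \<in> W \<Longrightarrow> w \<noteq> 0 \<Longrightarrow> degree D \<le> degree w"
    by auto
  have pow: "[:0, 1:] ^ k * D \<in> W \<and> degree ([:0, 1:] ^ k * D) = k + degree D" if "k + degree D \<le> e" for k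
    using that
  proof (induction k)
    case (Suc k)
    hence IH: "[:0, 1:] ^ k * D \<in> W" "degree ([:0, 1:] ^ k * D) = k + degree D" by simp_all
    have nz: "[:0, 1:] ^ k * D \<noteq> 0" using D(2) by simp
    have "[:0, 1:] * ([:0, 1:] ^ k * D) \<in> W" using IH Suc.prems by (intro W_step) simp_all
    moreover have "degree ([:0, 1:] * ([:0, 1:] ^ k * D)) = Suc k + degree D"
      by (subst degree_mult_eq) (use nz IH(2) in auto)
    ultimately show ?case by (simp only: power_Suc mult.assoc)
  qed (use D in simp)
  have mult: "D * q \<in> W" if q: "degree q + degree D \<le> e" for q
  proof -
    have "D * q = D * (\<Sum>k\<le>degree q. monom (coeff q k) k)" by (simp add: poly_as_sum_of_monoms)
    also have "\<dots> = (\<Sum>k\<le>degree q. smult (coeff q k) ([:0, 1:] ^ k * D))"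
      by (simp add: sum_distrib_left monom_altdef mult.commute)
    also have "\<dots> \<in> W"
    proof -
      have "(\<Sum>k\<in>A. smult (coeff q k) ([:0, 1:] ^ k * D)) \<in> W" if "finite A" "A \<subseteq> {..degree q}" for A
        using that
      proof (induction A)
        case (insert k A)
        hence "[:0, 1:] ^ k * D \<in> W" using pow[of k] q by auto
        thus ?case using insert by (simp add: W_add W_smult)
      qed (simp add: W_0)
      thus ?thesis by simp
    qed
    finally show ?thesis .
  qed
  \<comment> \<open>Division by the element \<open>D\<close> of least degree: the quotient times
    \<open>D\<close> stays in \<open>W\<close>, so the remainder lies in \<open>W\<close> and must
    be zero.\<close>
  have dvd: "D dvd w" if w: "w \<in> W" for w
  proof -
    let ?q = "w div D" and ?r = "w mod D"
    have wr: "w = D * ?q + ?r" by simp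
    have r: "?r = 0 \<or> degree ?r < degree D" using degree_mod_less[OF D(2), of w] .
    have "D * ?q \<in> W"
    proof (cases "?q = 0")
      case False
      have "degree (D * ?q) \<le> e"
      proof (cases "?r = 0")
        case True thus ?thesis using wr W_deg[OF w] by simp
      next
        case False
        have "degree ?r < degree (D * ?q)" using r False degree_mult_eq[OF D(2) \<open>?q \<noteq> 0\<close>] by simp
        hence "degree (D * ?q + ?r) = degree (D * ?q)" by (rule degree_add_eq_left)
        thus ?thesis using wr W_deg[OF w] by simp
      qed
      thus ?thesis using degree_mult_eq[OF D(2) False] by (intro mult) simp
    qed (simp add: W_0)
    hence "w + smult (- 1) (D * ?q) \<in> W" using w by (intro W_add W_smult)
    moreover have "w + smult (- 1) (D * ?q) = ?r" using wr by (simp add: minus_mult_div_eq_mod)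
    ultimately have "?r \<in> W" by simp
    hence "?r = 0" using min[of ?r] r by (metis leD)
    thus ?thesis by (simp add: dvd_eq_mod_eq_0)
  qed
  \<comment> \<open>A constant \<open>D\<close> would put every polynomial of degree at most
    \<open>e\<close> into \<open>W\<close>, against \<open>h0\<close>.\<close>
  have "degree D \<noteq> 0"
  proof
    assume d0: "degree D = 0"
    then obtain c where c: "D = [:c:]" by (rule degree_eq_zeroE)
    have "f \<in> ?J" if f: "f \<in> homog e" for f
    proof -
      have "D * smult (1 / c) (\<rho> f) \<in> W" using degree_restrict_line[OF f, of p \<beta>] d0 by (intro mult) simp
      hence "\<rho> f \<in> W" using D(2) c by simp
      thus ?thesis unfolding mem_iff[OF I f] W_def by blast
    qed
    hence "hilb ?J e = 0" unfolding hilb_eq_0_iff[OF Js] by (rule subsetI)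
    thus False using h0 by simp
  qed
  hence "degree D \<ge> 1" by simp
  moreover have "\<forall>f\<in>I \<inter> homog e. D dvd \<rho> f" using dvd unfolding W_def by blast
  ultimately show ?thesis by (intro exI conjI)
qed

end

section \<open>Minimal generators\<close>

text \<open>The general section has finite length, so a power of \<open>\<eta>\<close> lies in it
  and \<open>G\<close> restricts to a nonzero constant \<open>c\<close>. Then \<open>G\<close>
  agrees at \<open>p\<close> with \<open>c\<close> times a power of \<open>\<eta>\<close>. As
  \<open>\<eta>\<close> vanishes at \<open>p\<close> and \<open>G\<close> does not, \<open>G\<close>
  is a constant, yet it vanishes on \<open>Z\<close>.\<close>

lemma vanishing_ideal_not_principal:
  fixes Z :: "('k::field_char_0 ^ 4) set set"
  assumes Z: "Z \<subseteq> P3" "finite Z" "Z \<noteq> {}" "WLP Z" and G: "G \<in> homog d"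
  shows "vanishing_ideal Z \<noteq> ideal_gen {G}"
proof
  assume IG: "vanishing_ideal Z = ideal_gen {G}"
  let ?I = "vanishing_ideal Z"
  obtain U where U: "zariski_open U" "U \<noteq> {}"
    "\<And>a b. case_sum (($) a) (($) b) \<in> U \<Longrightarrow> good_pair Z (linform a) (linform b)"
    using for_general_pair_good[OF Z(1,2,4)] unfolding for_general_pair_def by blast
  have one: "(1 :: 'k R) \<in> homog 0" using const_homog[of "1::'k"] by (simp add: const_def)
  \<comment> \<open>\<open>F\<close> is \<open>G\<close> if that is nonzero and may be taken as 1
    otherwise, so that a point \<open>p\<close> can be chosen before \<open>G = 0\<close> is
    excluded.\<close>
  obtain F :: "'k R" and t where F: "F \<in> homog t" "F \<noteq> 0" "G \<noteq> 0 \<Longrightarrow> F = G"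
    using one G by (metis zero_neq_one)
  obtain a b p where ab: "case_sum (($) a) (($) b) \<in> U" "p 1 = 1" "peval F p \<noteq> 0" "dot a p = 0" "dot b p = 0"
    by (rule open_through_point[OF U(1,2) F(1,2)])
  \<comment> \<open>No condition on the direction is needed beyond a nonzero fourth coordinate,
    hence the polynomial 1.\<close>
  obtain a' b' where ab': "case_sum (($) a') (($) b') \<in> U" "dot a' p = 0" "dot b' p = 0" "cross3 a' b' 4 \<noteq> 0"
    by (rule open_direction[OF U(1) ab(1,2,4,5), of 1]) (simp_all add: peval_one)
  interpret line a' b' p by unfold_locales (use ab' ab(2) in auto)
  obtain T where T: "hilb (ideal_gen (?I \<union> M)) T = 0"
    using r2_good_pair(2)[OF Z U(3)[OF ab'(1)]] by (rule exE)
  have \<eta>T: "\<eta> ^ T \<in> homog T" using homog_power[OF \<eta>_homog, of T] by simp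
  hence "\<eta> ^ T \<in> ideal_gen (?I \<union> M)" using T hilb_eq_0_iff[OF ideal.subspace_span] by blast
  then obtain i where i: "i \<in> ?I" "\<rho> (\<eta> ^ T) = \<rho> i"
    using mem_iff[OF homogeneous_vanishing_ideal \<eta>T] by blast
  obtain g where g: "i = g * G" using i(1) unfolding IG ideal.span_singleton by blast
  have one: "1 = \<rho> g * \<rho> G" using i(2) by (simp add: g \<rho>.hom_power \<rho>.hom_mult \<rho>_\<eta>)
  have "G \<noteq> 0"
  proof
    assume "G = 0"
    thus False using one by simp
  qed
  hence Gp: "peval G p \<noteq> 0" using F(3) ab(3) by simp
  have "\<rho> G dvd 1" using one by (metis dvd_triv_right)
  then obtain c where c: "\<rho> G = [:c:]" unfolding is_unit_poly_iff by blast
  have "G - const c * \<eta> ^ d \<in> homog d"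
    using homog_power[OF \<eta>_homog, of d] by (intro homog_diff G homog_const_mult) simp
  moreover have "\<rho> (G - const c * \<eta> ^ d) = 0"
    by (simp add: \<rho>.hom_minus \<rho>.hom_mult \<rho>.hom_power \<rho>_const \<rho>_\<eta> c)
  ultimately have "peval (G - const c * \<eta> ^ d) p = 0" by (intro peval_kernel kernel)
  hence eq: "peval G p = c * peval \<eta> p ^ d" by (simp add: peval_simps)
  have d: "d = 0"
  proof (rule ccontr)
    assume "d \<noteq> 0"
    thus False using eq Gp ab(2) by (simp add: peval_\<eta>)
  qed
  obtain P where P: "P \<in> Z" using Z(3) by blast
  have GI: "G \<in> ?I" unfolding IG by (simp add: ideal.span_base)
  have "peval G (rep P) = 0" using vanishing_ideal_iff[OF G Z(1)] GI P by blast
  moreover have "G = const (Poly_Mapping.lookup G 0)" using G d homog_0_const by blast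
  ultimately show False using Gp peval_const by metis
qed

lemma minimal_gens_low_degree:
  assumes gens: "minimal_homog_gens I m F d" and mono: "mono_on {1..m} d" and m: "1 \<le> m"
    and f: "f \<in> I" "f \<in> homog t" and t: "t < d 1"
  shows "f = 0"
proof -
  have I: "f \<in> ideal_gen (F ` {1..m})" and F: "\<And>i. i \<in> {1..m} \<Longrightarrow> F i \<in> homog (d i)"
    using gens f(1) by (auto simp: minimal_homog_gens_def)
  from I have "hc t f = 0"
  proof (induction rule: ideal.span_induct_alt)
    case (step c x y)
    then obtain i where i: "i \<in> {1..m}" "x = F i" by blast
    have "t < d i" using t mono_onD[OF mono, of 1 i] i(1) m by auto
    hence "hc t (F i * c) = 0" using hc_mult[OF F[OF i(1)], of t c] by simp
    thus ?case using step(2) i(2) by (simp add: hc_add mult.commute)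
  qed simp
  thus ?thesis using hc_id[OF f(2)] by simp
qed

text \<open>\<open>D\<close> turns out to lie in the ideal and to divide \<open>F 1\<close> and
  \<open>F 2\<close>. Comparing degrees makes it proportional to \<open>F 1\<close>, so
  \<open>F 2\<close> is redundant.\<close>

lemma common_prime_factor_contradiction:
  fixes Z :: "('k::field ^ 4) set set"
  assumes Z: "Z \<subseteq> P3" "finite Z" "UPP Z"
    and gens: "minimal_homog_gens (vanishing_ideal Z) m F d" and mono: "mono_on {1..m} d"
    and m: "2 \<le> m" and e: "d 2 \<le> e"
    and D: "s \<ge> 1" "D \<in> homog s" "prime_elem D" "\<forall>f\<in>vanishing_ideal Z \<inter> homog e. D dvd f"
  shows False
proof -
  let ?I = "vanishing_ideal Z"
  have I: "?I = ideal_gen (F ` {1..m})" and F: "\<And>i. i \<in> {1..m} \<Longrightarrow> F i \<in> homog (d i)"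
    and min: "\<And>i. i \<in> {1..m} \<Longrightarrow> F i \<notin> ideal_gen (F ` ({1..m} - {i}))"
    using gens by (auto simp: minimal_homog_gens_def)
  have m12: "1 \<in> {1..m}" "2 \<in> {1..m}" using m by auto
  have d12: "d 1 \<le> d 2" using mono_onD[OF mono m12] by simp
  have FI: "F i \<in> ?I" if "i \<in> {1..m}" for i unfolding I using that by (simp add: ideal.span_base)
  have F0: "F 1 \<noteq> 0" using min[OF m12(1)] ideal.span_zero by metis
  have van: "f \<in> ?I \<longleftrightarrow> (\<forall>P\<in>Z. peval f (rep P) = 0)" if "f \<in> homog t" for f t
    by (rule vanishing_ideal_iff[OF that Z(1)])
  have low: "f = 0" if "f \<in> homog t" "t < d 1" "\<forall>P\<in>Z. peval f (rep P) = 0" for f t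
    using minimal_gens_low_degree[OF gens mono _ _ that(1,2)] m van[OF that(1)] that(3) by simp
  \<comment> \<open>Raise the degree of \<open>f\<close> to \<open>e\<close> by powers of each
    variable. If \<open>D\<close> did not divide \<open>f\<close>, it would divide all the
    variables.\<close>
  have dvd: "D dvd f" if f: "f \<in> ?I" "f \<in> homog t" "t \<le> e" for f t
  proof (rule ccontr)
    assume nd: "\<not> D dvd f"
    have x: "D dvd mvar i" for i
    proof -
      have "mvar i ^ (e - t) * f \<in> homog (1 * (e - t) + t)" by (intro homog_mult homog_power mvar_homog f(2))
      hence "mvar i ^ (e - t) * f \<in> homog e" using f(3) by simp
      moreover have "mvar i ^ (e - t) * f \<in> ?I" by (rule ideal.subspace_scale[OF subspace_vanishing_ideal f(1)])
      ultimately have "D dvd mvar i ^ (e - t) * f" using D(4) by blast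
      hence "D dvd mvar i ^ (e - t)" using prime_elem_dvd_multD[OF D(3), of "mvar i ^ (e - t)" f] nd by argo
      thus ?thesis by (rule prime_elem_dvd_power[OF D(3)])
    qed
    let ?u = "\<lambda>i::4. if i = 2 then 1 else (0::'k)"
    have "peval (mvar 1) (\<lambda>i::4. 1::'k) \<noteq> 0" by (simp add: peval_mvar)
    hence "(mvar 1 :: 'k R) \<noteq> 0" using peval_zero by metis
    thus False
      by (rule no_common_linear_factor[OF D(2,1) mvar_homog _ x x, of 1 ?u 2]) (simp_all add: peval_mvar)
  qed
  have DF: "D dvd F 1" "D dvd F 2"
    using dvd[OF FI[OF m12(1)] F[OF m12(1)]] dvd[OF FI[OF m12(2)] F[OF m12(2)]] d12 e by linarith+
  have "\<forall>P\<in>Z. peval D (rep P) = 0"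
  proof (rule common_prime_factor_vanishes[OF Z(3,1,2) D(2,1,3)])
    show "g = 0" if "g \<in> homog t" "t < d 1" "\<forall>P\<in>Z. peval g (rep P) = 0" for g t using low[OF that] .
    show "F 1 \<in> homog (d 1)" by (rule F[OF m12(1)])
    show "F 1 \<noteq> 0" by (rule F0)
    show "\<forall>P\<in>Z. peval (F 1) (rep P) = 0" using van[OF F[OF m12(1)]] FI[OF m12(1)] by blast
    show "d 1 \<le> e" using d12 e by simp
    show "D dvd f" if "f \<in> homog e" "\<forall>P\<in>Z. peval f (rep P) = 0" for f
      using D(4) van[OF that(1)] that by blast
  qed (rule DF(1))
  \<comment> \<open>\<open>D\<close> now lies in the ideal, so its degree is at least the initial
    degree \<open>d 1\<close>; as a factor of \<open>F 1\<close> it has exactly this degree.\<close>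
  hence sd: "\<not> s < d 1" using low[OF D(2)] prime_elem_not_zeroI[OF D(3)] by blast
  obtain g where g: "F 1 = D * g" using DF(1) by (rule dvdE)
  have "g * D \<in> homog (d 1)" "g * D \<noteq> 0" using F[OF m12(1)] F0 unfolding g by (simp_all only: mult.commute not_False_eq_True)
  then obtain r where r: "g \<in> homog r" using homog_factor by blast
  have "s + r = d 1" using homog_unique[OF homog_mult[OF D(2) r]] F[OF m12(1)] F0 unfolding g by blast
  hence "r = 0" using sd by simp
  hence gc: "g = const (Poly_Mapping.lookup g 0)" using r homog_0_const by blast
  define c where "c = Poly_Mapping.lookup g 0"
  have c: "c \<noteq> 0"
  proof
    assume "c = 0"
    hence "g = 0" using gc by (simp add: c_def const_def)
    thus False using g F0 by simp
  qed
  obtain h where h: "F 2 = D * h" using DF(2) by (rule dvdE)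
  have "(const (1 / c) * h) * F 1 = (const (1 / c) * const c) * (D * h)"
    using g gc unfolding c_def[symmetric] by (simp only: ac_simps)
  also have "const (1 / c) * const c = (1 :: 'k R)" using c by (simp add: const_def mult_single)
  finally have F2: "F 2 = (const (1 / c) * h) * F 1" unfolding h by (simp only: mult_1_left)
  have "F 1 \<in> F ` ({1..m} - {2})" using m12 by (intro imageI) simp
  from ideal.span_scale[OF ideal.span_base[OF this], of "const (1 / c) * h"]
  have "F 2 \<in> ideal_gen (F ` ({1..m} - {2}))" using F2 by simp
  thus False using min[OF m12(2)] by blast
qed

theorem corollary6p12:
  fixes Z :: "('k::field_char_0 ^ 4) set set"
    and F :: "nat \<Rightarrow> 'k R" and d :: "nat \<Rightarrow> nat" and m e :: nat
  assumes "Z \<subseteq> P3" and "finite Z" and "Z \<noteq> {}"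
    and "UPP Z" and "WLP Z"
    and "minimal_homog_gens (vanishing_ideal Z) m F d"
    and "mono_on {1..m} d"
    and "d 2 \<le> e" and "e < r2 (vanishing_ideal Z)"
  shows "\<Delta>2H (vanishing_ideal Z) e > \<Delta>2H (vanishing_ideal Z) (e + 1)"
proof (rule ccontr)
  let ?I = "vanishing_ideal Z"
  assume "\<not> \<Delta>2H ?I e > \<Delta>2H ?I (e + 1)"
  hence le: "\<Delta>2H ?I e \<le> \<Delta>2H ?I (Suc e)" by simp
  note Z = assms(1,2,3,5) and gens = assms(6) and mono = assms(7)
  have I: "?I = ideal_gen (F ` {1..m})" and F: "\<And>i. i \<in> {1..m} \<Longrightarrow> F i \<in> homog (d i)"
    and min: "\<And>i. i \<in> {1..m} \<Longrightarrow> F i \<notin> ideal_gen (F ` ({1..m} - {i}))"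
    using gens by (auto simp: minimal_homog_gens_def)
  \<comment> \<open>Ensures that \<open>F 2\<close> and \<open>d 2\<close> refer to an actual
    generator: with fewer than two the ideal would be principal.\<close>
  have m: "2 \<le> m"
  proof (rule ccontr)
    assume "\<not> 2 \<le> m"
    then consider "m = 0" | "m = 1" by linarith
    thus False
    proof cases
      case 1
      have "?I = ideal_gen {0}" unfolding I 1 by (auto simp: ideal.span_singleton)
      thus False using vanishing_ideal_not_principal[OF Z homog_0[of 0]] by simp
    next
      case 2
      have "?I = ideal_gen {F 1}" unfolding I 2 by simp
      thus False using vanishing_ideal_not_principal[OF Z F[of 1]] 2 by simp
    qed
  qed
  have m12: "1 \<in> {1..m}" "2 \<in> {1..m}" using m by auto
  have d1e: "d 1 \<le> e" using mono_onD[OF mono m12] assms(8) by simp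
  have "F 1 \<noteq> 0" using min[OF m12(1)] ideal.span_zero by metis
  define V where "V = ?I \<inter> homog e"
  \<comment> \<open>A nonzero form of degree exactly \<open>e\<close> in the ideal, used to choose
    \<open>p\<close> off its zero set and to start the elimination.\<close>
  define G where "G = mvar 1 ^ (e - d 1) * F 1"
  have "mvar 1 ^ (e - d 1) * F 1 \<in> homog (1 * (e - d 1) + d 1)"
    by (intro homog_mult homog_power mvar_homog F m12)
  hence Ge: "G \<in> homog e" using d1e by (simp add: G_def)
  have GI: "G \<in> ?I" unfolding G_def I using m12(1) by (intro ideal.span_scale ideal.span_base) simp
  have "peval (mvar 1) (\<lambda>i::4. 1::'k) \<noteq> 0" by (simp add: peval_mvar)
  hence "(mvar 1 :: 'k R) \<noteq> 0" using peval_zero by metis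
  hence G0: "G \<noteq> 0" using \<open>F 1 \<noteq> 0\<close> by (simp add: G_def)
  have GV: "G \<in> V" using Ge GI by (simp add: V_def)
  obtain U where U: "zariski_open U" "U \<noteq> {}"
    "\<And>a b. case_sum (($) a) (($) b) \<in> U \<Longrightarrow> good_pair Z (linform a) (linform b)"
    using for_general_pair_good[OF Z(1,2,4)] unfolding for_general_pair_def by blast
  obtain a b p where ab: "case_sum (($) a) (($) b) \<in> U" "p 1 = 1" "peval G p \<noteq> 0" "dot a p = 0" "dot b p = 0"
    by (rule open_through_point[OF U(1,2) Ge G0])
  have Ve: "V \<subseteq> homog e" by (simp add: V_def)
  from common_factor_or_eliminant[where p = p, OF Ve GV G0 ab(2)]
  have "\<exists>Q\<in>ideal_gen V. Q \<noteq> 0 \<and> (\<forall>c \<beta>. peval Q (\<lambda>i. c * p i + \<beta> i) = peval Q \<beta>)"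
  proof (rule disjE)
    assume "\<exists>D s. s \<ge> 1 \<and> D \<in> homog s \<and> prime_elem D \<and> (\<forall>f\<in>V. D dvd f)"
    hence False unfolding V_def
      by (elim exE conjE) (rule common_prime_factor_contradiction[OF Z(1,2) assms(4) gens mono m assms(8)])
    thus ?thesis by (rule FalseE)
  qed
  then obtain Q where Q: "Q \<in> ideal_gen V" "Q \<noteq> 0" "\<And>c \<beta>. peval Q (\<lambda>i. c * p i + \<beta> i) = peval Q \<beta>"
    by blast
  \<comment> \<open>The planes are chosen anew because \<open>Q\<close> depends on \<open>p\<close>.
    They still pass through \<open>p\<close>, and now \<open>Q\<close> is nonzero on their common
    line.\<close>
  obtain a' b' where ab': "case_sum (($) a') (($) b') \<in> U" "dot a' p = 0" "dot b' p = 0"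
    "cross3 a' b' 4 \<noteq> 0" "peval Q (cross3 a' b') \<noteq> 0"
    by (rule open_direction[OF U(1) ab(1,2,4,5) Q(2,3)])
  interpret line a' b' p by unfold_locales (use ab' ab(2) in auto)
  note good = U(3)[OF ab'(1)]
  \<comment> \<open>Since \<open>e + 1\<close> does not exceed \<open>r2\<close>,
    \<open>\<Delta>2H\<close> is positive in both degrees and equals the dimension of the
    section.\<close>
  have h: "int (hilb (ideal_gen (?I \<union> M)) t) = \<Delta>2H ?I t" "hilb (ideal_gen (?I \<union> M)) t \<noteq> 0"
    if "t \<le> Suc e" for t
    using good[unfolded good_pair_def, rule_format, of t] r2_good_pair(1)[OF Z good, of t] that assms(9) by simp_all
  have "hilb (ideal_gen (?I \<union> M)) e \<noteq> 0" using h(2)[of e] by simp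
  moreover have "hilb (ideal_gen (?I \<union> M)) e \<le> hilb (ideal_gen (?I \<union> M)) (Suc e)"
    using h(1)[of e] h(1)[of "Suc e"] le by simp
  ultimately obtain D where D: "degree D \<ge> 1" "\<forall>f\<in>V. D dvd \<rho> f"
    using restriction_common_factor[OF homogeneous_vanishing_ideal GI Ge ab(3)] unfolding V_def by blast
  \<comment> \<open>A common factor of the restrictions of \<open>V\<close> also divides that of
    \<open>Q\<close>, a nonzero constant, which contradicts its positive degree.\<close>
  have "D dvd \<rho> Q" using Q(1)
  proof (induction rule: ideal.span_induct_alt)
    case (step c x y)
    thus ?case using D(2) by (simp add: \<rho>.hom_add \<rho>.hom_mult)
  qed simp
  moreover have "\<rho> Q = [:peval Q (cross3 a' b'):]"
    by (rule poly_eqI_char_0) (simp add: poly_restrict_line Q(3))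
  ultimately have "degree D \<le> 0" using dvd_imp_degree_le[of D "\<rho> Q"] ab'(5) by simp
  thus False using D(1) by simp
qed

end
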